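(* Let $d\ge1$ and let $\beta:\mathbb{R}\to\mathbb{R}$, $b:\mathbb{R}\to\mathbb{R}$, $D:\mathbb{R}^d\to\mathbb{R}^d$ satisfy Hypotheses (j)--(jv) listed in the context. Let $T>0$ and $u\in L^\infty((0,T)\times\mathbb{R}^d)$. Let $\rho_0\in\mathcal{M}(\mathbb{R}^d)$, $\rho_0\ge0$, and let $y_1,y_2\in L^1((0,T)\times\mathbb{R}^d)\cap L^2((0,T)\times\mathbb{R}^d)$ be two nonnegative solutions $\rho=y_1$, $\rho=y_2$ of $$\int_0^T\!\!\int_{\mathbb{R}^d}\Big(\varphi_t+\frac{\beta(u)}{u}\Delta\varphi+b(u)D\cdot\nabla\varphi\Big)\rho\,dx\,dt+\int_{\mathbb{R}^d}\varphi(0,x)\,\rho_0(dx)=0\quad\text{for all }\varphi\in C_0^\infty([0,T)\times\mathbb{R}^d),$$ where $\frac{\beta(0)}{0}:=\beta'(0)$. Then $y_1\equiv y_2$ (a.e. on $(0,T)\times\mathbb{R}^d$).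
   Context: Hypotheses: (j) $\beta\in C^1(\mathbb{R})$, $\beta'(r)\ge0$ for all $r\in\mathbb{R}$, $\beta(0)=0$. (jj) $D\in L^\infty(\mathbb{R}^d;\mathbb{R}^d)$. (jjj) $b\in C^1(\mathbb{R})$. (jv) For each compact $K\subset\mathbb{R}$ there exists $\alpha_K\in(0,\infty)$ such that $|b'(r)r+b(r)|\le\alpha_K|\beta'(r)|$ for all $r\in K$ (or, equivalently, $|b(r)r-b(\bar r)\bar r|\le\alpha_K|\beta(r)-\beta(\bar r)|$ for all $r,\bar r\in K$). $\mathcal{M}(\mathbb{R}^d)$ is the space of signed Radon measures on $\mathbb{R}^d$ of bounded variation. $C_0^\infty([0,T)\times\mathbb{R}^d)$ denotes smooth functions with compact support in $[0,T)\times\mathbb{R}^d$. *)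

theory Defs
  imports "HOL-Analysis.Analysis"
begin

definition Linfty :: "'a measure \<Rightarrow> ('a \<Rightarrow> 'b::real_normed_vector) set" where
  "Linfty M = {f. f \<in> borel_measurable M \<and> (\<exists>C. AE x in M. norm (f x) \<le> C)}"

definition L1 :: "'a measure \<Rightarrow> ('a \<Rightarrow> real) set" where
  "L1 M = {f. integrable M f}"

definition L2 :: "'a measure \<Rightarrow> ('a \<Rightarrow> real) set" where
  "L2 M = {f. f \<in> borel_measurable M \<and> integrable M (\<lambda>x. (f x)\<^sup>2)}"

text \<open>
  Smoothness relative to a set that need not be open. All derivatives are taken within \<open>S\<close>.
  This is meant for convex \<open>S\<close> with nonempty interior, where derivatives within \<open>S\<close> are
  unique even at boundary points (here: one-sided in time at \<open>t = 0\<close>).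
\<close>

primrec Ck_on :: "nat \<Rightarrow> 'a::real_normed_vector set \<Rightarrow> ('a \<Rightarrow> 'b::real_normed_vector) \<Rightarrow> bool" where
  "Ck_on 0 S f \<longleftrightarrow> continuous_on S f"
| "Ck_on (Suc k) S f \<longleftrightarrow>
     f differentiable_on S \<and> (\<forall>v. Ck_on k S (\<lambda>x. frechet_derivative f (at x within S) v))"

definition smooth_on :: "'a::real_normed_vector set \<Rightarrow> ('a \<Rightarrow> 'b::real_normed_vector) \<Rightarrow> bool" where
  "smooth_on S f \<longleftrightarrow> (\<forall>k. Ck_on k S f)"

text \<open>
  The space \<open>C\<^sub>0\<^sup>\<infinity>([0,T) \<times> \<real>\<^sup>d)\<close>. The functions need not vanish at \<open>t = 0\<close>; their values
  outside \<open>[0,T) \<times> \<real>\<^sup>d\<close> are irrelevant.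
\<close>

definition test_functions :: "real \<Rightarrow> (real \<times> (real ^ 'n) \<Rightarrow> real) set" where
  "test_functions T = {\<phi>. smooth_on ({0..<T} \<times> UNIV) \<phi> \<and>
     compact (closure (support_on ({0..<T} \<times> UNIV) \<phi>)) \<and>
     closure (support_on ({0..<T} \<times> UNIV) \<phi>) \<subseteq> {0..<T} \<times> UNIV}"

definition time_deriv :: "(real \<times> (real ^ 'n) \<Rightarrow> real) \<Rightarrow> real \<times> (real ^ 'n) \<Rightarrow> real" where
  "time_deriv \<phi> z = frechet_derivative \<phi> (at z) (1, 0)"

definition space_deriv :: "'n \<Rightarrow> (real \<times> (real ^ 'n) \<Rightarrow> real) \<Rightarrow> real \<times> (real ^ 'n) \<Rightarrow> real" where
  "space_deriv i \<phi> z = frechet_derivative \<phi> (at z) (0, axis i 1)"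

definition space_grad :: "(real \<times> (real ^ 'n) \<Rightarrow> real) \<Rightarrow> real \<times> (real ^ 'n) \<Rightarrow> real ^ 'n" where
  "space_grad \<phi> z = (\<chi> i. space_deriv i \<phi> z)"

definition space_laplacian :: "(real \<times> (real ^ 'n) \<Rightarrow> real) \<Rightarrow> real \<times> (real ^ 'n) \<Rightarrow> real" where
  "space_laplacian \<phi> z = (\<Sum>i\<in>UNIV. space_deriv i (space_deriv i \<phi>) z)"

definition diff_quot :: "(real \<Rightarrow> real) \<Rightarrow> real \<Rightarrow> real" where
  "diff_quot \<beta> r = (if r = 0 then deriv \<beta> 0 else \<beta> r / r)"

abbreviation cylinder :: "real \<Rightarrow> (real \<times> (real ^ 'n)) measure" where
  "cylinder T \<equiv> lebesgue_on ({0<..<T} \<times> UNIV)"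

text \<open>
  The double integral over time and space is taken with respect to Lebesgue measure on the product;
  for \<open>u \<in> L\<^sup>\<infinity>\<close>, \<open>D \<in> L\<^sup>\<infinity>\<close>, \<open>\<rho> \<in> L\<^sup>1\<close> and continuous coefficients the integrand is integrable.
\<close>

definition weak_solution ::
  "real \<Rightarrow> (real \<Rightarrow> real) \<Rightarrow> (real \<Rightarrow> real) \<Rightarrow> (real ^ 'n \<Rightarrow> real ^ 'n) \<Rightarrow>
   (real \<times> (real ^ 'n) \<Rightarrow> real) \<Rightarrow> (real ^ 'n) measure \<Rightarrow> (real \<times> (real ^ 'n) \<Rightarrow> real) \<Rightarrow> bool" where
  "weak_solution T \<beta> b D u \<rho>\<^sub>0 \<rho> \<longleftrightarrow>
    (\<forall>\<phi>\<in>test_functions T.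
      (LINT z|cylinder T.
         (time_deriv \<phi> z + diff_quot \<beta> (u z) * space_laplacian \<phi> z
            + b (u z) * (D (snd z) \<bullet> space_grad \<phi> z)) * \<rho> z)
      + (LINT x|\<rho>\<^sub>0. \<phi> (0, x)) = 0)"

end

theory Submission
  imports Defs "HOL-Probability.Probability"
begin

text \<open>
  The difference \<open>y = y\<^sub>1 - y\<^sub>2\<close> solves \<open>y\<^sub>t = \<Delta>(a y) - div(c y)\<close> weakly with zero initial
  value, where \<open>a = \<beta>(u)/u\<close> and \<open>c = b(u) D\<close>. By the hypotheses \<open>a\<close> is bounded and nonnegative and
  \<open>|c| \<le> const a\<close>, so the drift is dominated by the (possibly degenerate) diffusion. Uniqueness
  is an energy estimate in \<open>H\<^sup>-\<^sup>1\<close>: with \<open>e(t) = \<integral> |F y(t)|\<^sup>2 / (1 + |\<xi>|\<^sup>2) d\<xi>\<close> one has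
  \<open>e' \<le> const e\<close>: the leading term \<open>- 2 K \<integral> a y\<^sup>2\<close> absorbs small multiples of \<open>\<parallel>a y\<parallel>\<^sup>2\<close> and
  \<open>\<parallel>c y\<parallel>\<^sup>2\<close>, which are bounded by multiples of \<open>\<integral> a y\<^sup>2\<close>. Gronwall then gives \<open>e = 0\<close>. To stay with real functions, \<open>F\<close> is
  the Hartley transform, with kernel \<open>cos + sin\<close>, and only the Parseval identity on
  \<open>L\<^sup>1 \<inter> L\<^sup>2\<close> is needed. Testing the equation with \<open>cas(\<xi> \<bullet> x)\<close> (through cutoffs) turns it, for
  each frequency \<open>\<xi>\<close>, into an ordinary differential equation in integrated form.
\<close>

section \<open>The Hartley transform\<close>

text \<open>Neither solution is assumed differentiable in space or continuous in time, and
  \<open>a\<close> may vanish on large sets, so pairing the equation with \<open>y\<close> itself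
  gives nothing usable. The weight 1 / (1 + |\<xi>|^2) repairs this: as |\<xi>|^2 / (1 + |\<xi>|^2)
  = 1 - 1 / (1 + |\<xi>|^2), the Laplacian loses both derivatives and leaves - 2 F(y) F(a y) plus a
  term of lower order, and Parseval turns the leading part into the integral of a y^2 without any
  regularity of \<open>a\<close>. This dissipation controls a y^2 but not y^2, so every other term
  must have a factor bounded by a |y|. For the diffusion remainder one uses (a y)^2 \<le> sup a * a
  y^2; for the drift, the condition tying (b(r) r)' to \<beta>'(r), integrated from 0 by the mean
  value theorem. The missing continuity in time is met by replacing F y with the primitive of the
  right-hand side. The two agree only for almost every time, with an exceptional set that depends on
  \<xi>; Fubini exchanges the order of these null sets.\<close>

definition cas :: "real \<Rightarrow> real" where "cas \<theta> = cos \<theta> + sin \<theta>"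

lemma abs_cas_le: "\<bar>cas \<theta>\<bar> \<le> 2"
  using abs_cos_le_one[of \<theta>] abs_sin_le_one[of \<theta>] unfolding cas_def by linarith

lemma cas_measurable [measurable]: "cas \<in> borel_measurable borel"
  unfolding cas_def[abs_def] by measurable

text \<open>With a = \<xi> . x and b = \<xi> . y the cosine is even and the sine odd in \<xi>.
  Against an even weight only cos (\<xi> . (x - y)) survives, which is why one real kernel suffices
  for Parseval.\<close>

lemma cas_mult: "cas a * cas b = cos (a - b) + sin (a + b)"
  by (simp add: cas_def cos_diff sin_add algebra_simps)

text \<open>Fubini for integrands that factor over the coordinates: \<open>lborel\<close> is the
  image of the finite product of one-dimensional Lebesgue measures. The range is a general normed
  field because the factors will also be complex exponentials.\<close>

lemma
  fixes f :: "'a::euclidean_space \<Rightarrow> real \<Rightarrow> 'b::{real_normed_field,banach,second_countable_topology}"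
  assumes f: "\<And>b. b \<in> Basis \<Longrightarrow> integrable lborel (f b)"
  shows integrable_lborel_prod_Basis: "integrable lborel (\<lambda>x. \<Prod>b\<in>Basis. f b (x \<bullet> b))" (is ?I)
    and integral_lborel_prod_Basis:
      "(LINT x|lborel. (\<Prod>b\<in>Basis. f b (x \<bullet> b))) = (\<Prod>b\<in>Basis. LINT s|lborel. f b s)" (is ?E)
proof -
  have meas: "f b \<in> borel_measurable borel" if "b \<in> Basis" for b
    using borel_measurable_integrable[OF f[OF that]] by simp
  interpret product_sigma_finite "\<lambda>_::'a. lborel :: real measure" ..
  let ?P = "Pi\<^sub>M (Basis::'a set) (\<lambda>_. lborel :: real measure)"
  have m: "(\<lambda>x. \<Prod>b\<in>Basis. f b (x \<bullet> b)) \<in> borel_measurable borel"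
    by (intro borel_measurable_prod measurable_compose[OF _ meas]) auto
  have eq: "(\<Prod>b\<in>Basis. f b ((\<Sum>c\<in>Basis. y c *\<^sub>R c) \<bullet> b)) = (\<Prod>b\<in>Basis. f b (y b))" for y
    by (intro prod.cong refl) (simp add: inner_sum_left inner_Basis if_distrib sum.delta cong: if_cong)
  have dm: "(\<lambda>y. \<Sum>b\<in>Basis. y b *\<^sub>R b) \<in> measurable ?P (borel :: 'a measure)"
    by measurable
  have i: "integrable ?P (\<lambda>y. \<Prod>b\<in>Basis. f b (y b))"
    by (rule product_integrable_prod) (auto intro: f)
  show ?I
    by (subst lborel_eq, subst integrable_distr_eq[OF dm m]) (simp add: eq i)
  show ?E
    by (subst lborel_eq, subst integral_distr[OF dm m], simp add: eq, rule product_integral_prod) (auto intro: f)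
qed

section \<open>Fourier integrals of the standard Gaussian\<close>

definition gauss :: "'a::euclidean_space \<Rightarrow> real" where "gauss x = exp (- (norm x)\<^sup>2 / 2)"

lemma gauss_pos: "gauss x > 0" and gauss_0: "gauss 0 = 1"
  by (auto simp: gauss_def)

lemma continuous_gauss: "continuous_on UNIV gauss"
  unfolding gauss_def[abs_def] by (intro continuous_intros) auto

lemma gauss_measurable [measurable]: "gauss \<in> borel_measurable borel"
  by (rule borel_measurable_continuous_onI[OF continuous_gauss])

lemma gauss_prod: "gauss x = (\<Prod>b\<in>Basis. exp (- (x \<bullet> b)\<^sup>2 / 2))" for x :: "'a::euclidean_space"
proof -
  have "(norm x)\<^sup>2 = (\<Sum>b\<in>Basis. (x \<bullet> b)\<^sup>2)"
    unfolding power2_norm_eq_inner by (subst euclidean_inner) (simp add: power2_eq_square)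
  then show ?thesis
    by (simp add: gauss_def sum_negf[symmetric] sum_divide_distrib exp_sum)
qed

text \<open>The Gaussian is sqrt (2 pi) times the standard normal density, so the integral is read
  off from the characteristic function of the normal distribution.\<close>

lemma
  shows integrable_exp_neg_square: "integrable lborel (\<lambda>s. exp (- s\<^sup>2 / 2) :: real)"
    and integral_cis_gauss: "(LINT s|lborel. cis (t * s) * complex_of_real (exp (- s\<^sup>2 / 2)))
      = complex_of_real (sqrt (2 * pi) * exp (- t\<^sup>2 / 2))"
    and integrable_cis_gauss: "integrable lborel (\<lambda>s. cis (t * s) * complex_of_real (exp (- s\<^sup>2 / 2)))"
proof -
  have eq: "exp (- s\<^sup>2 / 2) = sqrt (2 * pi) * std_normal_density s" for s :: real
    by (simp add: std_normal_density_def)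
  show 1: "integrable lborel (\<lambda>s. exp (- s\<^sup>2 / 2) :: real)"
    unfolding eq by (intro integrable_mult_right integrable_normal_density) auto
  have 2: "integrable lborel (\<lambda>s. complex_of_real (exp (- s\<^sup>2 / 2)))"
    using 1 by (rule integrable_of_real)
  have m: "(\<lambda>s. cis (t * s)) \<in> borel_measurable borel"
    by (intro borel_measurable_continuous_onI continuous_on_cis continuous_intros)
  show "integrable lborel (\<lambda>s. cis (t * s) * complex_of_real (exp (- s\<^sup>2 / 2)))"
    by (rule Bochner_Integration.integrable_bound[OF 2]) (use m in \<open>auto simp: norm_mult\<close>)
  have "complex_of_real (exp (- t\<^sup>2 / 2)) = char std_normal_distribution t"
    by (simp add: char_std_normal_distribution)
  also have "\<dots> = (LINT s|lborel. std_normal_density s *\<^sub>R cis (t * s))"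
    unfolding char_def using m
    by (subst integral_density) (auto simp: normal_density_nonneg cis_conv_exp)
  finally have *: "complex_of_real (exp (- t\<^sup>2 / 2)) = (LINT s|lborel. std_normal_density s *\<^sub>R cis (t * s))" .
  have "(LINT s|lborel. cis (t * s) * complex_of_real (exp (- s\<^sup>2 / 2))) =
    (LINT s|lborel. complex_of_real (sqrt (2 * pi)) * (std_normal_density s *\<^sub>R cis (t * s)))"
    unfolding eq by (intro Bochner_Integration.integral_cong) (auto simp: scaleR_conv_of_real)
  also have "\<dots> = complex_of_real (sqrt (2 * pi) * exp (- t\<^sup>2 / 2))"
    by (subst integral_mult_right_zero) (simp flip: *)
  finally show "(LINT s|lborel. cis (t * s) * complex_of_real (exp (- s\<^sup>2 / 2)))
      = complex_of_real (sqrt (2 * pi) * exp (- t\<^sup>2 / 2))" .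
qed

lemma cis_sum: "cis (\<Sum>i\<in>I. f i) = (\<Prod>i\<in>I. cis (f i))"
  by (induction I rule: infinite_finite_induct) (auto simp: cis_mult[symmetric])

lemma integrable_gauss: "integrable lborel (gauss :: 'a::euclidean_space \<Rightarrow> real)"
  unfolding gauss_prod[abs_def]
  using integrable_lborel_prod_Basis[of "\<lambda>_::'a. \<lambda>s. exp (- s\<^sup>2 / 2) :: real"] integrable_exp_neg_square
  by simp

text \<open>Both the exponential of v . x and the Gaussian factor over the coordinates, so the value
  is a product of one-dimensional ones.\<close>

lemma integral_cis_inner_gauss:
  fixes v :: "'a::euclidean_space"
  shows "(LINT x|lborel. cis (v \<bullet> x) * complex_of_real (gauss x))
    = complex_of_real (sqrt (2 * pi) ^ DIM('a) * gauss v)"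
proof -
  have "cis (v \<bullet> x) * complex_of_real (gauss x) =
     (\<Prod>b\<in>Basis. cis ((v \<bullet> b) * (x \<bullet> b)) * complex_of_real (exp (- (x \<bullet> b)\<^sup>2 / 2)))" for x :: 'a
    by (subst euclidean_inner) (simp add: gauss_prod cis_sum prod.distrib)
  then have "(LINT x|lborel. cis (v \<bullet> x) * complex_of_real (gauss x)) =
     (LINT x|lborel. (\<Prod>b\<in>(Basis::'a set). cis ((v \<bullet> b) * (x \<bullet> b)) * complex_of_real (exp (- (x \<bullet> b)\<^sup>2 / 2))))"
    by simp
  also have "\<dots> = (\<Prod>b\<in>(Basis::'a set). LINT s|lborel. cis ((v \<bullet> b) * s) * complex_of_real (exp (- s\<^sup>2 / 2)))"
    by (rule integral_lborel_prod_Basis) (rule integrable_cis_gauss)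
  also have "\<dots> = complex_of_real (sqrt (2 * pi) ^ DIM('a) * gauss v)"
    by (simp only: integral_cis_gauss) (simp add: prod.distrib gauss_prod)
  finally show ?thesis .
qed

lemma
  fixes v :: "'a::euclidean_space"
  shows integral_cos_gauss: "(LINT x|lborel. cos (v \<bullet> x) * gauss x) = sqrt (2 * pi) ^ DIM('a) * gauss v"
    and integral_sin_gauss: "(LINT x|lborel. sin (v \<bullet> x) * gauss x) = 0"
    and integrable_cos_gauss: "integrable lborel (\<lambda>x. cos (v \<bullet> x) * gauss x)"
    and integrable_sin_gauss: "integrable lborel (\<lambda>x. sin (v \<bullet> x) * gauss x)"
proof -
  have m: "(\<lambda>x. cis (v \<bullet> x)) \<in> borel_measurable borel"
    by (intro borel_measurable_continuous_onI continuous_on_cis continuous_intros)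
  have "integrable lborel (\<lambda>x::'a. complex_of_real (gauss x))"
    by (rule integrable_of_real[OF integrable_gauss])
  then have i: "integrable lborel (\<lambda>x. cis (v \<bullet> x) * complex_of_real (gauss x))"
    by (rule Bochner_Integration.integrable_bound) (use m in \<open>auto simp: norm_mult\<close>)
  from integral_Re[OF i] integral_Im[OF i] integrable_Re[OF i] integrable_Im[OF i]
  show "(LINT x|lborel. cos (v \<bullet> x) * gauss x) = sqrt (2 * pi) ^ DIM('a) * gauss v"
    "(LINT x|lborel. sin (v \<bullet> x) * gauss x) = 0"
    "integrable lborel (\<lambda>x. cos (v \<bullet> x) * gauss x)"
    "integrable lborel (\<lambda>x. sin (v \<bullet> x) * gauss x)"
    by (simp_all add: integral_cis_inner_gauss)
qed

lemma integral_gauss: "(LINT x|lborel. gauss (x::'a::euclidean_space)) = sqrt (2 * pi) ^ DIM('a)"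
  using integral_cos_gauss[of "0::'a"] by (simp add: gauss_0)

lemma
  fixes f :: "'a::euclidean_space \<Rightarrow> real"
  assumes [measurable]: "f \<in> borel_measurable borel" and c: "c \<noteq> 0"
  shows integral_lborel_affine: "(LINT x|lborel. f x) = \<bar>c\<bar> ^ DIM('a) * (LINT x|lborel. f (t + c *\<^sub>R x))"
    and integrable_lborel_affine_iff: "integrable lborel f \<longleftrightarrow> integrable lborel (\<lambda>x. f (t + c *\<^sub>R x))"
  using c
  by (subst lborel_affine[OF c, of t], simp add: integral_density integral_distr integrable_density integrable_distr_eq)+

text \<open>After rescaling \<xi>, \<open>cas_mult\<close> leaves the Gaussian integral of a cosine
  in x - y and of a sine in x + y; the latter is zero. The result is an approximate identity in x -
  y of total mass (2 pi)^d.\<close>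

lemma integral_cas_cas_gauss:
  fixes x y :: "'a::euclidean_space"
  assumes "\<epsilon> > 0"
  shows "(LINT \<xi>|lborel. cas (\<xi> \<bullet> x) * cas (\<xi> \<bullet> y) * gauss (\<epsilon> *\<^sub>R \<xi>))
    = (1 / \<epsilon>) ^ DIM('a) * (sqrt (2 * pi) ^ DIM('a) * gauss ((1 / \<epsilon>) *\<^sub>R (x - y)))"
proof -
  let ?c = "1 / \<epsilon>"
  have "(LINT \<xi>|lborel. cas (\<xi> \<bullet> x) * cas (\<xi> \<bullet> y) * gauss (\<epsilon> *\<^sub>R \<xi>)) =
    ?c ^ DIM('a) * (LINT \<xi>|lborel. cas (?c *\<^sub>R \<xi> \<bullet> x) * cas (?c *\<^sub>R \<xi> \<bullet> y) * gauss \<xi>)"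
    using assms by (subst integral_lborel_affine[where c="?c" and t=0]) auto
  also have "(LINT \<xi>|lborel. cas (?c *\<^sub>R \<xi> \<bullet> x) * cas (?c *\<^sub>R \<xi> \<bullet> y) * gauss \<xi>) =
    (LINT \<xi>|lborel. cos ((?c *\<^sub>R (x - y)) \<bullet> \<xi>) * gauss \<xi> + sin ((?c *\<^sub>R (x + y)) \<bullet> \<xi>) * gauss \<xi>)"
    unfolding cas_mult
    by (intro Bochner_Integration.integral_cong refl)
       (simp add: inner_simps inner_commute algebra_simps diff_divide_distrib)
  also have "\<dots> = sqrt (2 * pi) ^ DIM('a) * gauss (?c *\<^sub>R (x - y))"
    by (subst Bochner_Integration.integral_add)
       (simp_all only: integrable_cos_gauss integrable_sin_gauss integral_cos_gauss integral_sin_gauss)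
  finally show ?thesis .
qed

section \<open>The transform of an integrable function\<close>

lemma (in pair_sigma_finite) integrable_pair_bound:
  fixes f :: "'a \<Rightarrow> real" and g :: "'b \<Rightarrow> real" and h :: "'a \<times> 'b \<Rightarrow> real"
  assumes f: "integrable M1 f" and g: "integrable M2 g"
    and h: "h \<in> borel_measurable (M1 \<Otimes>\<^sub>M M2)"
    and bound: "\<And>x y. \<bar>h (x, y)\<bar> \<le> \<bar>f x\<bar> * \<bar>g y\<bar>"
  shows "integrable (M1 \<Otimes>\<^sub>M M2) h"
proof -
  have [measurable]: "f \<in> borel_measurable M1" "g \<in> borel_measurable M2"
    using f g by auto
  have "integrable (M1 \<Otimes>\<^sub>M M2) (\<lambda>(x, y). f x * g y)"
    by (rule Fubini_integrable) (use f g in \<open>auto simp: abs_mult\<close>)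
  then show ?thesis
    by (rule Bochner_Integration.integrable_bound[OF _ h]) (auto simp: bound abs_mult)
qed

text \<open>No normalising constant is included, so Parseval will carry the factor (2 pi)^d.\<close>

definition hartley :: "('a::euclidean_space \<Rightarrow> real) \<Rightarrow> 'a \<Rightarrow> real" where
  "hartley f \<xi> = (LINT x|lborel. cas (\<xi> \<bullet> x) * f x)"

lemma integrable_cas_mult:
  assumes "integrable lborel f"
  shows "integrable lborel (\<lambda>x. cas (\<xi> \<bullet> x) * f x)"
proof -
  have [measurable]: "f \<in> borel_measurable borel"
    using borel_measurable_integrable[OF assms] by simp
  show ?thesis
    by (rule Bochner_Integration.integrable_bound[OF integrable_mult_right[OF assms, of 2]])
       (auto simp: abs_mult intro!: mult_mono abs_cas_le)
qed

lemma hartley_bound: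
  assumes "integrable lborel f"
  shows "\<bar>hartley f \<xi>\<bar> \<le> 2 * (LINT x|lborel. \<bar>f x\<bar>)"
proof -
  have "\<bar>hartley f \<xi>\<bar> \<le> (LINT x|lborel. \<bar>cas (\<xi> \<bullet> x) * f x\<bar>)"
    unfolding hartley_def by (rule integral_abs_bound)
  also have "\<dots> \<le> (LINT x|lborel. 2 * \<bar>f x\<bar>)"
    by (intro integral_mono integrable_abs integrable_mult_right integrable_cas_mult assms)
       (auto simp: abs_mult intro!: mult_right_mono abs_cas_le)
  finally show ?thesis by simp
qed

text \<open>Function and frequency may both depend on the parameter. With time as part of it, this
  yields measurability in (t, \<xi>) of the transforms of time slices.\<close>

lemma hartley_measurable [measurable (raw)]:
  assumes [measurable]: "(\<lambda>(z, x). f z x) \<in> borel_measurable (M \<Otimes>\<^sub>M borel)" "g \<in> borel_measurable M"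
  shows "(\<lambda>z. hartley (f z) (g z)) \<in> borel_measurable M"
proof -
  have "sets (M \<Otimes>\<^sub>M lborel) = sets (M \<Otimes>\<^sub>M borel)"
    by (intro sets_pair_measure_cong) auto
  then have "(\<lambda>(z, x). cas (g z \<bullet> x) * f z x) \<in> borel_measurable (M \<Otimes>\<^sub>M lborel)"
    by (subst measurable_cong_sets[OF _ refl]) measurable
  then show ?thesis
    unfolding hartley_def by (rule lborel.borel_measurable_lebesgue_integral)
qed

lemma AE_lborelI:
  assumes "AE x in lebesgue. P x"
  shows "AE x in lborel. P x"
  using assms by (simp add: AE_completion_iff)

text \<open>Truncation in value and in space reduces the claim to a bounded function of bounded
  support. Such a function is an almost everywhere limit of continuous ones; once these are cut to a
  common bound and a common ball, dominated convergence applies.\<close>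

lemma L2_approx_bounded_continuous:
  fixes g :: "'a::euclidean_space \<Rightarrow> real"
  assumes g[measurable]: "g \<in> borel_measurable borel" and g2: "integrable lborel (\<lambda>x. (g x)\<^sup>2)"
    and e: "e > 0"
  obtains h C where "continuous_on UNIV h" "\<And>x. \<bar>h x\<bar> \<le> C" "integrable lborel (\<lambda>x. (h x)\<^sup>2)"
    "(LINT x|lborel. (g x - h x)\<^sup>2) < e"
proof -
  define q where "q k x = (if \<bar>g x\<bar> \<le> real k \<and> norm x \<le> real k then g x else 0)" for k :: nat and x
  have q[measurable]: "q k \<in> borel_measurable borel" for k
    unfolding q_def[abs_def] by measurable
  have "(\<lambda>k. LINT x|lborel. (g x - q k x)\<^sup>2) \<longlonglongrightarrow> (LINT x|(lborel::'a measure). 0)"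
  proof (rule integral_dominated_convergence[where w="\<lambda>x. (g x)\<^sup>2"])
    show "AE x in lborel. (\<lambda>k. (g x - q k x)\<^sup>2) \<longlonglongrightarrow> 0"
    proof (rule AE_I2, rule tendsto_eventually)
      fix x
      obtain n where n: "max \<bar>g x\<bar> (norm x) \<le> real n"
        using real_arch_simple by blast
      have "(g x - q k x)\<^sup>2 = 0" if "k \<ge> n" for k
      proof -
        have "real n \<le> real k" using that by simp
        then show ?thesis using n by (auto simp: q_def)
      qed
      then show "\<forall>\<^sub>F k in sequentially. (g x - q k x)\<^sup>2 = 0"
        unfolding eventually_sequentially by blast
    qed
  qed (auto simp: q_def g2)
  then have "(\<lambda>k. LINT x|lborel. (g x - q k x)\<^sup>2) \<longlonglongrightarrow> 0" by simp
  \<comment> \<open>An error of e/4 in each of the two approximations is enough, because (x + y)^2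
    \<le> 2 x^2 + 2 y^2.\<close>
  from order_tendstoD(2)[OF this, of "e/4"] e
  obtain k where k: "(LINT x|lborel. (g x - q k x)\<^sup>2) < e/4"
    by (auto simp: eventually_sequentially)
  have "q k measurable_on UNIV"
    by (rule lebesgue_measurable_imp_measurable_on) (auto intro: measurable_completion)
  then obtain N c where N: "negligible N" and c: "\<And>n. continuous_on UNIV (c n)"
    and lim: "\<And>x. x \<notin> N \<Longrightarrow> (\<lambda>n. c n x) \<longlonglongrightarrow> q k x"
    unfolding measurable_on_def by auto
  have aeN: "AE x in lborel. x \<notin> N"
    using AE_not_in[OF N[unfolded negligible_iff_null_sets]] by (rule AE_lborelI)
  \<comment> \<open>Clamping to [-k, k] does not change \<open>q k\<close>, and the spatial factor
    is 1 on the ball of radius k, outside of which \<open>q k\<close> is 0. So \<open>p n\<close>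
    keeps the limit \<open>q k\<close> while being continuous, bounded by k and zero beyond radius k
    + 1.\<close>
  define p where "p n x = max (- real k) (min (real k) (c n x)) * max 0 (min 1 (real k + 1 - norm x))" for n x
  have pc: "continuous_on UNIV (p n)" for n
    unfolding p_def[abs_def] by (intro continuous_intros c)
  have pm[measurable]: "p n \<in> borel_measurable borel" for n
    by (rule borel_measurable_continuous_onI[OF pc])
  have pb: "\<bar>p n x\<bar> \<le> real k * indicator (cball 0 (real k + 1)) x" for n x
  proof (cases "norm x \<le> real k + 1")
    case True
    have "\<bar>p n x\<bar> \<le> real k * 1"
      unfolding p_def abs_mult by (intro mult_mono) auto
    then show ?thesis using True by simp
  next
    case False
    then show ?thesis by (simp add: p_def)
  qed
  have qb: "\<bar>q k x\<bar> \<le> real k * indicator (cball 0 (real k + 1)) x" for x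
    by (auto simp: q_def)
  have ind: "integrable lborel (\<lambda>x. C * indicator (cball (0::'a) r) x :: real)" for C r
    by (intro integrable_mult_right integrable_real_indicator) (use emeasure_lborel_cball_finite[of "0::'a" r] in \<open>auto simp: less_top\<close>)
  have sq: "(s * indicator A x)\<^sup>2 = s\<^sup>2 * indicator A x" for s :: real and A and x :: 'a
    by (simp add: indicator_def)
  have p2: "integrable lborel (\<lambda>x. (p n x)\<^sup>2)" for n
  proof (rule Bochner_Integration.integrable_bound[OF ind[of "(real k)\<^sup>2" "real k + 1"]])
    show "AE x in lborel. norm ((p n x)\<^sup>2) \<le> norm ((real k)\<^sup>2 * indicator (cball 0 (real k + 1)) x)"
      using power_mono[OF pb, of n _ 2] by (intro AE_I2) (simp add: sq)
  qed simp
  have q2: "integrable lborel (\<lambda>x. (q k x)\<^sup>2)"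
    by (rule Bochner_Integration.integrable_bound[OF g2]) (auto simp: q_def)
  have bnd: "(q k x - p n x)\<^sup>2 \<le> (2 * real k)\<^sup>2 * indicator (cball 0 (real k + 1)) x" for n x
  proof -
    have "\<bar>q k x - p n x\<bar> \<le> 2 * real k * indicator (cball 0 (real k + 1)) x"
      using qb[of x] pb[of n x] by linarith
    from power_mono[OF this, of 2] show ?thesis by (simp add: sq del: power_mult_distrib)
  qed
  have "(\<lambda>n. LINT x|lborel. (q k x - p n x)\<^sup>2) \<longlonglongrightarrow> (LINT x|(lborel::'a measure). 0)"
  proof (rule integral_dominated_convergence[OF _ _ ind[of "(2 * real k)\<^sup>2" "real k + 1"]])
    show "AE x in lborel. norm ((q k x - p n x)\<^sup>2) \<le> (2 * real k)\<^sup>2 * indicator (cball 0 (real k + 1)) x" for n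
      using bnd[of _ n] by (intro AE_I2) simp
    show "AE x in lborel. (\<lambda>n. (q k x - p n x)\<^sup>2) \<longlonglongrightarrow> 0"
      using aeN
    proof eventually_elim
      case (elim x)
      have "(\<lambda>n. p n x) \<longlonglongrightarrow> max (- real k) (min (real k) (q k x)) * max 0 (min 1 (real k + 1 - norm x))"
        unfolding p_def by (intro tendsto_intros lim elim)
      moreover have "max (- real k) (min (real k) (q k x)) * max 0 (min 1 (real k + 1 - norm x)) = q k x"
        by (auto simp: q_def)
      ultimately have "(\<lambda>n. p n x) \<longlonglongrightarrow> q k x" by simp
      then have "(\<lambda>n. (q k x - p n x)\<^sup>2) \<longlonglongrightarrow> (q k x - q k x)\<^sup>2" by (intro tendsto_intros)
      then show ?case by simp
    qed
  qed auto
  then have "(\<lambda>n. LINT x|lborel. (q k x - p n x)\<^sup>2) \<longlonglongrightarrow> 0" by simp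
  from order_tendstoD(2)[OF this, of "e/4"] e
  obtain n where n: "(LINT x|lborel. (q k x - p n x)\<^sup>2) < e/4"
    by (auto simp: eventually_sequentially)
  have i1: "integrable lborel (\<lambda>x. (g x - q k x)\<^sup>2)"
    by (rule Bochner_Integration.integrable_bound[OF g2]) (auto simp: q_def)
  have i2: "integrable lborel (\<lambda>x. (q k x - p n x)\<^sup>2)"
    by (rule Bochner_Integration.integrable_bound[OF ind[of "(2 * real k)\<^sup>2" "real k + 1"]])
       (use bnd[of _ n] in \<open>auto intro!: AE_I2\<close>)
  have pw: "(g x - p n x)\<^sup>2 \<le> 2 * (g x - q k x)\<^sup>2 + 2 * (q k x - p n x)\<^sup>2" for x
    using zero_le_power2[of "(g x - q k x) - (q k x - p n x)"] by (simp add: power2_eq_square algebra_simps)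
  have "(LINT x|lborel. (g x - p n x)\<^sup>2) \<le> (LINT x|lborel. 2 * (g x - q k x)\<^sup>2 + 2 * (q k x - p n x)\<^sup>2)"
  proof (rule integral_mono)
    show "integrable lborel (\<lambda>x. (g x - p n x)\<^sup>2)"
      by (rule Bochner_Integration.integrable_bound[of _ "\<lambda>x. 2 * (g x - q k x)\<^sup>2 + 2 * (q k x - p n x)\<^sup>2"])
         (use i1 i2 pw in auto)
  qed (use i1 i2 pw in auto)
  also have "\<dots> < e" using k n i1 i2 by simp
  finally have "(LINT x|lborel. (g x - p n x)\<^sup>2) < e" .
  moreover have "\<bar>p n x\<bar> \<le> real k" for x
    using pb[of n x] by (cases "norm x \<le> real k + 1") auto
  ultimately show ?thesis
    using that[of "p n" "real k"] pc p2 by blast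
qed

text \<open>The Gaussian factor makes the multiple integral absolutely convergent, which Parseval
  without it would not have. Integrating out \<xi> then replaces the two kernels by a Gaussian
  average of \<open>g\<close> at scale \<epsilon>.\<close>

lemma hartley_mult_gauss:
  fixes f g :: "'a::euclidean_space \<Rightarrow> real"
  assumes f: "integrable lborel f" and g: "integrable lborel g" and \<epsilon>: "\<epsilon> > 0"
  shows "(LINT \<xi>|lborel. hartley f \<xi> * hartley g \<xi> * gauss (\<epsilon> *\<^sub>R \<xi>)) =
    sqrt (2 * pi) ^ DIM('a) * (LINT x|lborel. f x * (LINT v|lborel. g (x - \<epsilon> *\<^sub>R v) * gauss v))"
proof -
  have [measurable]: "f \<in> borel_measurable borel" "g \<in> borel_measurable borel"
    using f g by (auto dest: borel_measurable_integrable)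
  let ?s = "sqrt (2 * pi) ^ DIM('a)"
  have G: "integrable lborel (\<lambda>\<xi>::'a. gauss (\<epsilon> *\<^sub>R \<xi>))"
    using integrable_lborel_affine_iff[of "gauss :: 'a \<Rightarrow> real" \<epsilon> 0] \<epsilon> integrable_gauss[where 'a='a] by simp
  have inner: "(LINT \<xi>|lborel. cas (\<xi> \<bullet> x) * hartley g \<xi> * gauss (\<epsilon> *\<^sub>R \<xi>)) =
      ?s * (LINT v|lborel. g (x - \<epsilon> *\<^sub>R v) * gauss v)" for x
  proof -
    have "(LINT \<xi>|lborel. cas (\<xi> \<bullet> x) * hartley g \<xi> * gauss (\<epsilon> *\<^sub>R \<xi>)) =
      (LINT \<xi>|lborel. LINT y|lborel. cas (\<xi> \<bullet> x) * gauss (\<epsilon> *\<^sub>R \<xi>) * (cas (\<xi> \<bullet> y) * g y))"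
      unfolding hartley_def by (subst integral_mult_right_zero) (simp add: mult_ac)
    also have "\<dots> = (LINT y|lborel. LINT \<xi>|lborel. cas (\<xi> \<bullet> x) * gauss (\<epsilon> *\<^sub>R \<xi>) * (cas (\<xi> \<bullet> y) * g y))"
    proof (rule lborel_pair.Fubini_integral,
        rule lborel_pair.integrable_pair_bound[OF integrable_mult_right[OF g, of 4] G])
      fix y \<xi> :: 'a
      have "\<bar>cas (\<xi> \<bullet> x)\<bar> * \<bar>cas (\<xi> \<bullet> y)\<bar> \<le> 2 * 2"
        by (intro mult_mono abs_cas_le) auto
      then have "\<bar>cas (\<xi> \<bullet> x)\<bar> * \<bar>cas (\<xi> \<bullet> y)\<bar> * (\<bar>g y\<bar> * \<bar>gauss (\<epsilon> *\<^sub>R \<xi>)\<bar>) \<le> 4 * (\<bar>g y\<bar> * \<bar>gauss (\<epsilon> *\<^sub>R \<xi>)\<bar>)"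
        by (intro mult_right_mono) auto
      then show "\<bar>case (y, \<xi>) of (y, \<xi>) \<Rightarrow> cas (\<xi> \<bullet> x) * gauss (\<epsilon> *\<^sub>R \<xi>) * (cas (\<xi> \<bullet> y) * g y)\<bar>
         \<le> \<bar>4 * g y\<bar> * \<bar>gauss (\<epsilon> *\<^sub>R \<xi>)\<bar>"
        by (simp add: abs_mult mult_ac)
    qed measurable
    also have "\<dots> = (LINT y|lborel. g y * ((1 / \<epsilon>) ^ DIM('a) * (?s * gauss ((1 / \<epsilon>) *\<^sub>R (x - y)))))"
    proof (intro Bochner_Integration.integral_cong refl)
      fix y
      have "(LINT \<xi>|lborel. cas (\<xi> \<bullet> x) * gauss (\<epsilon> *\<^sub>R \<xi>) * (cas (\<xi> \<bullet> y) * g y)) =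
        (LINT \<xi>|lborel. g y * (cas (\<xi> \<bullet> x) * cas (\<xi> \<bullet> y) * gauss (\<epsilon> *\<^sub>R \<xi>)))"
        by (simp add: mult_ac)
      then show "(LINT \<xi>|lborel. cas (\<xi> \<bullet> x) * gauss (\<epsilon> *\<^sub>R \<xi>) * (cas (\<xi> \<bullet> y) * g y)) =
        g y * ((1 / \<epsilon>) ^ DIM('a) * (?s * gauss ((1 / \<epsilon>) *\<^sub>R (x - y))))"
        by (simp only: integral_mult_right_zero integral_cas_cas_gauss[OF \<epsilon>])
    qed
    \<comment> \<open>Substitution y = x - \<epsilon> v; its Jacobian \<epsilon>^d cancels the
      factor (1 / \<epsilon>)^d.\<close>
    also have "\<dots> = \<bar>- \<epsilon>\<bar> ^ DIM('a) * (LINT v|lborel. g (x + (- \<epsilon>) *\<^sub>R v) *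
        ((1 / \<epsilon>) ^ DIM('a) * (?s * gauss ((1 / \<epsilon>) *\<^sub>R (x - (x + (- \<epsilon>) *\<^sub>R v))))))"
      by (rule integral_lborel_affine) (use \<epsilon> in auto)
    also have "\<dots> = (LINT v|lborel. ?s * (g (x - \<epsilon> *\<^sub>R v) * gauss v))"
      using \<epsilon> by (subst integral_mult_right_zero[symmetric]) (simp add: power_divide mult_ac)
    finally show ?thesis by simp
  qed
  have "(LINT \<xi>|lborel. hartley f \<xi> * hartley g \<xi> * gauss (\<epsilon> *\<^sub>R \<xi>)) =
    (LINT \<xi>|lborel. LINT x|lborel. f x * (cas (\<xi> \<bullet> x) * hartley g \<xi> * gauss (\<epsilon> *\<^sub>R \<xi>)))"
  proof (intro Bochner_Integration.integral_cong refl)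
    fix \<xi> :: 'a
    have "(LINT x|lborel. f x * (cas (\<xi> \<bullet> x) * hartley g \<xi> * gauss (\<epsilon> *\<^sub>R \<xi>))) =
      (LINT x|lborel. (hartley g \<xi> * gauss (\<epsilon> *\<^sub>R \<xi>)) * (cas (\<xi> \<bullet> x) * f x))"
      by (simp add: mult_ac)
    also have "\<dots> = hartley f \<xi> * hartley g \<xi> * gauss (\<epsilon> *\<^sub>R \<xi>)"
      unfolding integral_mult_right_zero hartley_def[of f, symmetric] by (simp only: mult_ac)
    finally show "hartley f \<xi> * hartley g \<xi> * gauss (\<epsilon> *\<^sub>R \<xi>) =
      (LINT x|lborel. f x * (cas (\<xi> \<bullet> x) * hartley g \<xi> * gauss (\<epsilon> *\<^sub>R \<xi>)))" by simp
  qed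
  also have "\<dots> = (LINT x|lborel. LINT \<xi>|lborel. f x * (cas (\<xi> \<bullet> x) * hartley g \<xi> * gauss (\<epsilon> *\<^sub>R \<xi>)))"
  proof (rule lborel_pair.Fubini_integral,
      rule lborel_pair.integrable_pair_bound[OF integrable_mult_right[OF f, of "4 * (LINT x|lborel. \<bar>g x\<bar>)"] G])
    fix x \<xi> :: 'a
    have "\<bar>cas (\<xi> \<bullet> x)\<bar> * \<bar>hartley g \<xi>\<bar> \<le> 2 * (2 * (LINT x|lborel. \<bar>g x\<bar>))"
      by (intro mult_mono abs_cas_le hartley_bound g) auto
    then have "\<bar>cas (\<xi> \<bullet> x)\<bar> * \<bar>hartley g \<xi>\<bar> * (\<bar>f x\<bar> * \<bar>gauss (\<epsilon> *\<^sub>R \<xi>)\<bar>)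
        \<le> 2 * (2 * (LINT x|lborel. \<bar>g x\<bar>)) * (\<bar>f x\<bar> * \<bar>gauss (\<epsilon> *\<^sub>R \<xi>)\<bar>)"
      by (intro mult_right_mono) auto
    then show "\<bar>case (x, \<xi>) of (x, \<xi>) \<Rightarrow> f x * (cas (\<xi> \<bullet> x) * hartley g \<xi> * gauss (\<epsilon> *\<^sub>R \<xi>))\<bar>
        \<le> \<bar>4 * (LINT x|lborel. \<bar>g x\<bar>) * f x\<bar> * \<bar>gauss (\<epsilon> *\<^sub>R \<xi>)\<bar>"
      by (simp add: abs_mult mult_ac)
  qed measurable
  also have "\<dots> = (LINT x|lborel. ?s * (f x * (LINT v|lborel. g (x - \<epsilon> *\<^sub>R v) * gauss v)))"
    by (simp add: inner mult.left_commute[of _ ?s])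
  finally show ?thesis by simp
qed

section \<open>Parseval identity\<close>

text \<open>By translation invariance in x the value does not depend on \<epsilon>, and \<epsilon> =
  0 is included. Applied to squares this gives the bounds that are uniform in \<epsilon>.\<close>

lemma
  fixes G :: "'a::euclidean_space \<Rightarrow> real"
  assumes G: "integrable lborel G"
  shows integrable_gauss_shift: "integrable (lborel \<Otimes>\<^sub>M lborel) (\<lambda>(v, x). gauss v * G (x - \<epsilon> *\<^sub>R v))"
    and integral_gauss_shift: "(LINT z|(lborel \<Otimes>\<^sub>M lborel). (case z of (v, x) \<Rightarrow> gauss v * G (x - \<epsilon> *\<^sub>R v)))
      = sqrt (2 * pi) ^ DIM('a) * (LINT x|lborel. G x)"
proof -
  have G_meas[measurable]: "G \<in> borel_measurable borel"
    using G by (auto dest: borel_measurable_integrable)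
  have shift: "(LINT x|lborel. F (x - w)) = (LINT x|lborel. F x)"
    if "F \<in> borel_measurable borel" for F :: "'a \<Rightarrow> real" and w
    using integral_lborel_affine[of F 1 "- w"] that by simp
  have ishift: "integrable lborel (\<lambda>x. G (x - w))" for w
    using integrable_lborel_affine_iff[of G 1 "- w"] G by simp
  show i: "integrable (lborel \<Otimes>\<^sub>M lborel) (\<lambda>(v, x). gauss v * G (x - \<epsilon> *\<^sub>R v))"
  proof (rule lborel_pair.Fubini_integrable)
    have "(LINT x|lborel. norm (gauss v * G (x - \<epsilon> *\<^sub>R v))) = gauss v * (LINT x|lborel. \<bar>G x\<bar>)" for v
      using shift[of "\<lambda>x. \<bar>G x\<bar>" "\<epsilon> *\<^sub>R v"] gauss_pos[of v] by (simp add: abs_mult)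
    then show "integrable lborel (\<lambda>v. LINT x|lborel. norm (case (v, x) of (v, x) \<Rightarrow> gauss v * G (x - \<epsilon> *\<^sub>R v)))"
      using integrable_gauss[where 'a='a] by simp
    show "AE v in lborel. integrable lborel (\<lambda>x. case (v, x) of (v, x) \<Rightarrow> gauss v * G (x - \<epsilon> *\<^sub>R v))"
      using ishift by auto
  qed measurable
  have "(LINT z|(lborel \<Otimes>\<^sub>M lborel). (case z of (v, x) \<Rightarrow> gauss v * G (x - \<epsilon> *\<^sub>R v)))
      = (LINT v|lborel. LINT x|lborel. gauss v * G (x - \<epsilon> *\<^sub>R v))"
    using lborel_pair.integral_fst'[OF i] by simp
  also have "\<dots> = (LINT v|lborel. gauss (v::'a) * (LINT x|lborel. G x))"
    by (simp add: shift)
  finally show "(LINT z|(lborel \<Otimes>\<^sub>M lborel). (case z of (v, x) \<Rightarrow> gauss v * G (x - \<epsilon> *\<^sub>R v)))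
      = sqrt (2 * pi) ^ DIM('a) * (LINT x|lborel. G x)"
    by (simp add: integral_gauss)
qed

text \<open>Young's inequality. The weight \<delta> stays free because it is what later balances a
  small error against a fixed norm, and dissipation against energy.\<close>

lemma abs_mult_le_weighted:
  fixes a b \<delta> :: real
  assumes "\<delta> > 0"
  shows "\<bar>a * b\<bar> \<le> (\<delta> * a\<^sup>2 + b\<^sup>2 / \<delta>) / 2"
proof -
  have "0 \<le> (sqrt \<delta> * \<bar>a\<bar> - \<bar>b\<bar> / sqrt \<delta>)\<^sup>2" by simp
  then show ?thesis
    using assms by (simp add: power2_diff power_mult_distrib power_divide abs_mult)
qed

text \<open>Up to a constant, the right-hand side of \<open>hartley_mult_gauss\<close>, written as
  one integral over the product space so that dominated convergence applies to it directly.\<close>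

definition gconv :: "real \<Rightarrow> ('a::euclidean_space \<Rightarrow> real) \<Rightarrow> ('a \<Rightarrow> real) \<Rightarrow> real" where
  "gconv \<epsilon> f g = (LINT z|(lborel \<Otimes>\<^sub>M lborel). (case z of (v, x) \<Rightarrow> f x * g (x - \<epsilon> *\<^sub>R v) * gauss v))"

lemma
  fixes f g :: "'a::euclidean_space \<Rightarrow> real"
  assumes fm: "f \<in> borel_measurable borel" and gm: "g \<in> borel_measurable borel"
    and f2: "integrable lborel (\<lambda>x. (f x)\<^sup>2)" and g2: "integrable lborel (\<lambda>x. (g x)\<^sup>2)"
  shows integrable_gconv: "integrable (lborel \<Otimes>\<^sub>M lborel) (\<lambda>(v, x). f x * g (x - \<epsilon> *\<^sub>R v) * gauss v)"
    and gconv_bound: "\<delta> > 0 \<Longrightarrow> \<bar>gconv \<epsilon> f g\<bar> \<le>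
      sqrt (2 * pi) ^ DIM('a) * (\<delta> * (LINT x|lborel. (f x)\<^sup>2) + (LINT x|lborel. (g x)\<^sup>2) / \<delta>) / 2"
proof -
  note [measurable] = fm gm
  let ?P = "lborel \<Otimes>\<^sub>M lborel :: ('a \<times> 'a) measure"
  let ?F = "\<lambda>(v, x). gauss v * (f (x - 0 *\<^sub>R v))\<^sup>2"
  let ?G = "\<lambda>(v, x). gauss v * (g (x - \<epsilon> *\<^sub>R v))\<^sup>2"
  have F: "integrable ?P ?F" "integral\<^sup>L ?P ?F = sqrt (2 * pi) ^ DIM('a) * (LINT x|lborel. (f x)\<^sup>2)"
    using integrable_gauss_shift[OF f2, of 0] integral_gauss_shift[OF f2, of 0] by simp_all
  have G: "integrable ?P ?G" "integral\<^sup>L ?P ?G = sqrt (2 * pi) ^ DIM('a) * (LINT x|lborel. (g x)\<^sup>2)"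
    using integrable_gauss_shift[OF g2, of \<epsilon>] integral_gauss_shift[OF g2, of \<epsilon>] by simp_all
  have bd: "\<bar>case z of (v, x) \<Rightarrow> f x * g (x - \<epsilon> *\<^sub>R v) * gauss v\<bar> \<le> (\<delta> * ?F z + ?G z / \<delta>) / 2"
    if "\<delta> > 0" for \<delta> z
  proof (cases z)
    case (Pair v x)
    have "\<bar>f x * g (x - \<epsilon> *\<^sub>R v)\<bar> * gauss v \<le> (\<delta> * (f x)\<^sup>2 + (g (x - \<epsilon> *\<^sub>R v))\<^sup>2 / \<delta>) / 2 * gauss v"
      using gauss_pos[of v] by (intro mult_right_mono abs_mult_le_weighted that) auto
    then show ?thesis
      using Pair gauss_pos[of v] by (simp add: abs_mult field_simps)
  qed
  have I: "integrable ?P (\<lambda>z. (\<delta> * ?F z + ?G z / \<delta>) / 2)" for \<delta>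
    by (intro integrable_divide Bochner_Integration.integrable_add integrable_mult_right F G)
  show i: "integrable ?P (\<lambda>(v, x). f x * g (x - \<epsilon> *\<^sub>R v) * gauss v)"
    by (rule Bochner_Integration.integrable_bound[OF I[of 1]])
       (measurable, use bd[of 1] in \<open>auto intro!: AE_I2 order_trans[OF _ abs_ge_self]\<close>)
  show "\<bar>gconv \<epsilon> f g\<bar> \<le>
      sqrt (2 * pi) ^ DIM('a) * (\<delta> * (LINT x|lborel. (f x)\<^sup>2) + (LINT x|lborel. (g x)\<^sup>2) / \<delta>) / 2" if "\<delta> > 0"
  proof -
    have "\<bar>gconv \<epsilon> f g\<bar> \<le> (LINT z|?P. \<bar>case z of (v, x) \<Rightarrow> f x * g (x - \<epsilon> *\<^sub>R v) * gauss v\<bar>)"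
      unfolding gconv_def by (rule integral_abs_bound)
    also have "\<dots> \<le> (LINT z|?P. (\<delta> * ?F z + ?G z / \<delta>) / 2)"
      by (intro integral_mono integrable_abs i I bd that)
    also have "\<dots> = (\<delta> * integral\<^sup>L ?P ?F + integral\<^sup>L ?P ?G / \<delta>) / 2"
      by (simp only: integral_divide_zero integral_mult_right_zero
          Bochner_Integration.integral_add[OF integrable_mult_right[OF F(1)] integrable_divide[OF G(1)]])
    finally show ?thesis unfolding F G by (simp add: algebra_simps)
  qed
qed

lemma integrable_mult_L2:
  fixes f g :: "'a \<Rightarrow> real"
  assumes [measurable]: "f \<in> borel_measurable M" "g \<in> borel_measurable M"
    and f2: "integrable M (\<lambda>x. (f x)\<^sup>2)" and g2: "integrable M (\<lambda>x. (g x)\<^sup>2)"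
  shows "integrable M (\<lambda>x. f x * g x)"
proof (rule Bochner_Integration.integrable_bound[OF Bochner_Integration.integrable_add[OF f2 g2]])
  show "AE x in M. norm (f x * g x) \<le> norm ((f x)\<^sup>2 + (g x)\<^sup>2)"
  proof (rule AE_I2)
    fix x
    have "\<bar>f x * g x\<bar> \<le> (1 * (f x)\<^sup>2 + (g x)\<^sup>2 / 1) / 2" by (rule abs_mult_le_weighted) simp
    then show "norm (f x * g x) \<le> norm ((f x)\<^sup>2 + (g x)\<^sup>2)" by simp
  qed
qed simp

lemma gconv_zero:
  fixes f g :: "'a::euclidean_space \<Rightarrow> real"
  assumes "f \<in> borel_measurable borel" "g \<in> borel_measurable borel"
    "integrable lborel (\<lambda>x. (f x)\<^sup>2)" "integrable lborel (\<lambda>x. (g x)\<^sup>2)"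
  shows "gconv 0 f g = sqrt (2 * pi) ^ DIM('a) * (LINT x|lborel. f x * g x)"
  using integral_gauss_shift[of "\<lambda>x. f x * g x" 0] integrable_mult_L2[of f lborel g] assms
  by (simp add: gconv_def mult_ac)

lemma gconv_diff:
  fixes f g h :: "'a::euclidean_space \<Rightarrow> real"
  assumes "f \<in> borel_measurable borel" "g \<in> borel_measurable borel" "h \<in> borel_measurable borel"
    "integrable lborel (\<lambda>x. (f x)\<^sup>2)" "integrable lborel (\<lambda>x. (g x)\<^sup>2)" "integrable lborel (\<lambda>x. (h x)\<^sup>2)"
  shows "gconv \<epsilon> f (\<lambda>x. g x - h x) = gconv \<epsilon> f g - gconv \<epsilon> f h"
  unfolding gconv_def
  by (subst Bochner_Integration.integral_diff[OF integrable_gconv integrable_gconv, symmetric])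
     (auto intro!: assms Bochner_Integration.integral_cong simp: algebra_simps)

text \<open>The integrand converges pointwise by continuity of \<open>h\<close> and is dominated by
  C |f| \<open>gauss\<close>, so \<open>f\<close> in L^1 is enough. The terms with factor 0 keep the
  shape of \<open>integrable_gauss_shift\<close> at \<epsilon> = 0.\<close>

lemma gconv_tendsto_bounded_continuous:
  fixes f h :: "'a::euclidean_space \<Rightarrow> real"
  assumes f: "integrable lborel f" and h: "continuous_on UNIV h" and C: "\<And>x. \<bar>h x\<bar> \<le> C"
    and \<epsilon>: "\<epsilon> \<longlonglongrightarrow> 0"
  shows "(\<lambda>k. gconv (\<epsilon> k) f h) \<longlonglongrightarrow> gconv 0 f h"
  unfolding gconv_def
proof (rule integral_dominated_convergence)
  have [measurable]: "f \<in> borel_measurable borel" "h \<in> borel_measurable borel"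
    using f h by (auto dest: borel_measurable_integrable intro: borel_measurable_continuous_onI)
  show "integrable (lborel \<Otimes>\<^sub>M lborel) (\<lambda>(v, x). C * (gauss v * \<bar>f (x - 0 *\<^sub>R v)\<bar>))"
    unfolding split_beta'
    using integrable_mult_right[OF integrable_gauss_shift[OF integrable_abs[OF f], of 0], of C]
    by (simp only: split_beta')
  show "AE z in lborel \<Otimes>\<^sub>M lborel. norm (case z of (v, x) \<Rightarrow> f x * h (x - \<epsilon> k *\<^sub>R v) * gauss v)
      \<le> (case z of (v, x) \<Rightarrow> C * (gauss v * \<bar>f (x - 0 *\<^sub>R v)\<bar>))" for k
  proof (rule AE_I2)
    fix z :: "'a \<times> 'a"
    obtain v x where z: "z = (v, x)" by (cases z)
    have "\<bar>h (x - \<epsilon> k *\<^sub>R v)\<bar> * (\<bar>f x\<bar> * gauss v) \<le> C * (\<bar>f x\<bar> * gauss v)"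
      using gauss_pos[of v] by (intro mult_right_mono C) auto
    then show "norm (case z of (v, x) \<Rightarrow> f x * h (x - \<epsilon> k *\<^sub>R v) * gauss v)
      \<le> (case z of (v, x) \<Rightarrow> C * (gauss v * \<bar>f (x - 0 *\<^sub>R v)\<bar>))"
      using gauss_pos[of v] by (simp add: z abs_mult mult_ac)
  qed
  show "AE z in lborel \<Otimes>\<^sub>M lborel. (\<lambda>k. case z of (v, x) \<Rightarrow> f x * h (x - \<epsilon> k *\<^sub>R v) * gauss v)
      \<longlonglongrightarrow> (case z of (v, x) \<Rightarrow> f x * h (x - 0 *\<^sub>R v) * gauss v)"
  proof (rule AE_I2)
    fix z :: "'a \<times> 'a"
    obtain v x where z: "z = (v, x)" by (cases z)
    have "(\<lambda>k. h (x - \<epsilon> k *\<^sub>R v)) \<longlonglongrightarrow> h (x - 0 *\<^sub>R v)"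
      by (rule continuous_on_tendsto_compose[OF h tendsto_diff[OF tendsto_const tendsto_scaleR[OF \<epsilon> tendsto_const]]]) auto
    then show "(\<lambda>k. case z of (v, x) \<Rightarrow> f x * h (x - \<epsilon> k *\<^sub>R v) * gauss v)
      \<longlonglongrightarrow> (case z of (v, x) \<Rightarrow> f x * h (x - 0 *\<^sub>R v) * gauss v)"
      unfolding z by (auto intro!: tendsto_intros)
  qed
  show "(\<lambda>(v, x). f x * h (x - \<epsilon> k *\<^sub>R v) * gauss v) \<in> borel_measurable (lborel \<Otimes>\<^sub>M lborel)" for k
    by measurable
  show "(\<lambda>(v, x). f x * h (x - 0 *\<^sub>R v) * gauss v) \<in> borel_measurable (lborel \<Otimes>\<^sub>M lborel)"
    by measurable
qed

text \<open>A density argument: replacing \<open>g\<close> by a bounded continuous \<open>h\<close>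
  changes \<open>gconv\<close> by a small amount uniformly in \<epsilon>, because
  \<open>gconv_bound\<close> does not involve \<epsilon>.\<close>

lemma gconv_tendsto:
  fixes f g :: "'a::euclidean_space \<Rightarrow> real"
  assumes f: "integrable lborel f" and f2: "integrable lborel (\<lambda>x. (f x)\<^sup>2)"
    and gm[measurable]: "g \<in> borel_measurable borel" and g2: "integrable lborel (\<lambda>x. (g x)\<^sup>2)"
    and \<epsilon>: "\<epsilon> \<longlonglongrightarrow> 0"
  shows "(\<lambda>k. gconv (\<epsilon> k) f g) \<longlonglongrightarrow> sqrt (2 * pi) ^ DIM('a) * (LINT x|lborel. f x * g x)"
proof (rule LIMSEQ_I)
  fix r :: real assume r: "0 < r"
  have fm[measurable]: "f \<in> borel_measurable borel"
    using f by (auto dest: borel_measurable_integrable)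
  define K where "K = sqrt (2 * pi) ^ DIM('a)"
  define A where "A = (LINT x|lborel. (f x)\<^sup>2)"
  have K: "K > 0" and A: "A \<ge> 0" by (auto simp: K_def A_def)
  \<comment> \<open>With this \<delta> the part of \<open>gconv_bound\<close> that contains
    \<open>f\<close> is at most r/4; adding 1 avoids division by zero when \<open>f\<close> is null.
    The distance of \<open>h\<close> to \<open>g\<close> is then chosen after \<delta>, so that
    division by \<delta> still leaves at most r/4.\<close>
  define \<delta> where "\<delta> = r / (4 * (K * A + 1))"
  have KA: "K * A + 1 > 0" using K A by (simp add: add_nonneg_pos)
  have \<delta>: "\<delta> > 0" using r KA by (simp add: \<delta>_def)
  have \<delta>A: "K * (\<delta> * A) \<le> r / 4"
  proof -
    have "K * (\<delta> * A) = (r / 4) * (K * A / (K * A + 1))" by (simp add: \<delta>_def)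
    also have "\<dots> \<le> (r / 4) * 1" using r KA by (intro mult_left_mono) auto
    finally show ?thesis by simp
  qed
  obtain h C where h: "continuous_on UNIV h" "\<And>x. \<bar>h x\<bar> \<le> C" and h2: "integrable lborel (\<lambda>x. (h x)\<^sup>2)"
    and gh: "(LINT x|lborel. (g x - h x)\<^sup>2) < \<delta> * (r / (4 * K))"
    using L2_approx_bounded_continuous[OF gm g2, of "\<delta> * (r / (4 * K))"] \<delta> r K by auto
  have hm[measurable]: "h \<in> borel_measurable borel"
    by (rule borel_measurable_continuous_onI[OF h(1)])
  have gh2: "integrable lborel (\<lambda>x. (g x - h x)\<^sup>2)"
  proof (rule Bochner_Integration.integrable_bound)
    show "integrable lborel (\<lambda>x. 2 * (g x)\<^sup>2 + 2 * (h x)\<^sup>2)"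
      by (intro Bochner_Integration.integrable_add integrable_mult_right g2 h2)
    show "AE x in lborel. norm ((g x - h x)\<^sup>2) \<le> norm (2 * (g x)\<^sup>2 + 2 * (h x)\<^sup>2)"
    proof (rule AE_I2)
      fix x
      have "0 \<le> (g x + h x)\<^sup>2" by simp
      then have "(g x - h x)\<^sup>2 \<le> 2 * (g x)\<^sup>2 + 2 * (h x)\<^sup>2"
        by (simp add: power2_eq_square algebra_simps)
      then show "norm ((g x - h x)\<^sup>2) \<le> norm (2 * (g x)\<^sup>2 + 2 * (h x)\<^sup>2)"
        by simp
    qed
  qed measurable
  have small: "\<bar>gconv \<epsilon>' f g - gconv \<epsilon>' f h\<bar> < r / 3" for \<epsilon>'
  proof -
    have "\<bar>gconv \<epsilon>' f g - gconv \<epsilon>' f h\<bar> = \<bar>gconv \<epsilon>' f (\<lambda>x. g x - h x)\<bar>"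
      by (simp add: gconv_diff fm f2 g2 h2)
    also have "\<dots> \<le> K * (\<delta> * A + (LINT x|lborel. (g x - h x)\<^sup>2) / \<delta>) / 2"
      unfolding K_def A_def by (rule gconv_bound[OF fm _ f2 gh2 \<delta>]) simp
    also have "\<dots> = (K * (\<delta> * A) + K * ((LINT x|lborel. (g x - h x)\<^sup>2) / \<delta>)) / 2"
      by (simp add: algebra_simps)
    also have "\<dots> \<le> (r / 4 + r / 4) / 2"
    proof -
      have "(LINT x|lborel. (g x - h x)\<^sup>2) / \<delta> \<le> r / (4 * K)"
        using gh \<delta> by (simp add: pos_divide_le_eq mult.commute)
      then have "K * ((LINT x|lborel. (g x - h x)\<^sup>2) / \<delta>) \<le> K * (r / (4 * K))"
        using K by (intro mult_left_mono) auto
      then show ?thesis using \<delta>A K by simp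
    qed
    also have "\<dots> < r / 3" using r by simp
    finally show ?thesis .
  qed
  from LIMSEQ_D[OF gconv_tendsto_bounded_continuous[OF f h \<epsilon>], of "r / 3"] r
  obtain n where n: "\<And>k. k \<ge> n \<Longrightarrow> norm (gconv (\<epsilon> k) f h - gconv 0 f h) < r / 3" by auto
  show "\<exists>n. \<forall>k\<ge>n. norm (gconv (\<epsilon> k) f g - sqrt (2 * pi) ^ DIM('a) * (LINT x|lborel. f x * g x)) < r"
  proof (intro exI allI impI)
    fix k assume "n \<le> k"
    from n[OF this] small[of "\<epsilon> k"] small[of 0]
    have "\<bar>gconv (\<epsilon> k) f g - gconv 0 f g\<bar> < r" unfolding real_norm_def by linarith
    then show "norm (gconv (\<epsilon> k) f g - sqrt (2 * pi) ^ DIM('a) * (LINT x|lborel. f x * g x)) < r"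
      by (simp add: gconv_zero f2 g2)
  qed
qed

text \<open>As \<epsilon> decreases to 0, the Gaussian-weighted integrals increase to the unweighted
  one while \<open>gconv\<close> converges, so monotone convergence gives integrability and value at
  once. The constant consists of two factors sqrt (2 pi)^d, one from the kernel integral and one
  from the Gaussian average.\<close>

lemma
  fixes f :: "'a::euclidean_space \<Rightarrow> real"
  assumes f: "integrable lborel f" and f2: "integrable lborel (\<lambda>x. (f x)\<^sup>2)"
  shows integrable_hartley_square: "integrable lborel (\<lambda>\<xi>. (hartley f \<xi>)\<^sup>2)"
    and integral_hartley_square: "(LINT \<xi>|lborel. (hartley f \<xi>)\<^sup>2) = (2 * pi) ^ DIM('a) * (LINT x|lborel. (f x)\<^sup>2)"
proof -
  have fm[measurable]: "f \<in> borel_measurable borel"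
    using f by (auto dest: borel_measurable_integrable)
  define \<epsilon> where "\<epsilon> k = 1 / real (Suc k)" for k
  have \<epsilon>: "\<epsilon> \<longlonglongrightarrow> 0" unfolding \<epsilon>_def by (rule LIMSEQ_Suc[OF lim_1_over_n])
  have \<epsilon>_pos: "\<epsilon> k > 0" for k by (simp add: \<epsilon>_def)
  have eq: "(LINT \<xi>|lborel. (hartley f \<xi>)\<^sup>2 * gauss (\<epsilon> k *\<^sub>R \<xi>)) = sqrt (2 * pi) ^ DIM('a) * gconv (\<epsilon> k) f f" for k
  proof -
    have "gconv (\<epsilon> k) f f = (LINT x|lborel. LINT v|lborel. f x * f (x - \<epsilon> k *\<^sub>R v) * gauss v)"
      unfolding gconv_def
      using lborel_pair.integral_snd[OF integrable_gconv[OF fm fm f2 f2, of "\<epsilon> k"]] by simp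
    then show ?thesis
      using hartley_mult_gauss[OF f f \<epsilon>_pos, of k] by (simp add: power2_eq_square mult.assoc)
  qed
  have K: "sqrt (2 * pi) ^ DIM('a) * (sqrt (2 * pi) ^ DIM('a) * r) = (2 * pi) ^ DIM('a) * r" for r
  proof -
    have "sqrt (2 * pi) ^ DIM('a) * sqrt (2 * pi) ^ DIM('a) = (sqrt (2 * pi) * sqrt (2 * pi)) ^ DIM('a)"
      by (rule power_mult_distrib[symmetric])
    then show ?thesis by (simp flip: mult.assoc)
  qed
  have ilim: "(\<lambda>k. LINT \<xi>|lborel. (hartley f \<xi>)\<^sup>2 * gauss (\<epsilon> k *\<^sub>R \<xi>)) \<longlonglongrightarrow> (2 * pi) ^ DIM('a) * (LINT x|lborel. (f x)\<^sup>2)"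
    unfolding eq K[symmetric]
    unfolding power2_eq_square[of "f _"] by (rule tendsto_mult[OF tendsto_const gconv_tendsto[OF f f2 fm f2 \<epsilon>]])
  have i: "integrable lborel (\<lambda>\<xi>. (hartley f \<xi>)\<^sup>2 * gauss (\<epsilon> k *\<^sub>R \<xi>))" for k
  proof (rule Bochner_Integration.integrable_bound)
    show "integrable lborel (\<lambda>\<xi>::'a. (2 * (LINT x|lborel. \<bar>f x\<bar>))\<^sup>2 * gauss (\<epsilon> k *\<^sub>R \<xi>))"
      using integrable_lborel_affine_iff[of "gauss :: 'a \<Rightarrow> real" "\<epsilon> k" 0] \<epsilon>_pos[of k] integrable_gauss[where 'a='a]
      by (intro integrable_mult_right) simp
    show "AE \<xi> in lborel. norm ((hartley f \<xi>)\<^sup>2 * gauss (\<epsilon> k *\<^sub>R \<xi>))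
        \<le> norm ((2 * (LINT x|lborel. \<bar>f x\<bar>))\<^sup>2 * gauss (\<epsilon> k *\<^sub>R \<xi>))"
    proof (rule AE_I2)
      fix \<xi>
      have "(hartley f \<xi>)\<^sup>2 \<le> (2 * (LINT x|lborel. \<bar>f x\<bar>))\<^sup>2"
        using power_mono[OF hartley_bound[OF f, of \<xi>], of 2] by simp
      then show "norm ((hartley f \<xi>)\<^sup>2 * gauss (\<epsilon> k *\<^sub>R \<xi>))
        \<le> norm ((2 * (LINT x|lborel. \<bar>f x\<bar>))\<^sup>2 * gauss (\<epsilon> k *\<^sub>R \<xi>))"
        by (simp add: abs_mult mult_right_mono)
    qed
  qed measurable
  have mono: "mono (\<lambda>k. (hartley f \<xi>)\<^sup>2 * gauss (\<epsilon> k *\<^sub>R \<xi>))" for \<xi>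
  proof (intro monoI mult_left_mono)
    fix m n :: nat assume "m \<le> n"
    then have "\<epsilon> n \<le> \<epsilon> m" by (auto simp: \<epsilon>_def field_simps)
    then have "norm (\<epsilon> n *\<^sub>R \<xi>) \<le> norm (\<epsilon> m *\<^sub>R \<xi>)"
      using \<epsilon>_pos[of n] by (auto intro!: mult_right_mono)
    then show "gauss (\<epsilon> m *\<^sub>R \<xi>) \<le> gauss (\<epsilon> n *\<^sub>R \<xi>)"
      unfolding gauss_def by (simp only: exp_le_cancel_iff) (auto intro!: power_mono simp: divide_right_mono)
  qed simp
  have lim: "(\<lambda>k. (hartley f \<xi>)\<^sup>2 * gauss (\<epsilon> k *\<^sub>R \<xi>)) \<longlonglongrightarrow> (hartley f \<xi>)\<^sup>2" for \<xi>
  proof -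
    have "(\<lambda>k. gauss (\<epsilon> k *\<^sub>R \<xi>)) \<longlonglongrightarrow> gauss (0 *\<^sub>R \<xi>)"
      by (rule continuous_on_tendsto_compose[OF continuous_gauss tendsto_scaleR[OF \<epsilon> tendsto_const]]) auto
    then have "(\<lambda>k. (hartley f \<xi>)\<^sup>2 * gauss (\<epsilon> k *\<^sub>R \<xi>)) \<longlonglongrightarrow> (hartley f \<xi>)\<^sup>2 * gauss (0 *\<^sub>R \<xi>)"
      by (intro tendsto_intros)
    then show ?thesis by (simp add: gauss_0)
  qed
  show "integrable lborel (\<lambda>\<xi>. (hartley f \<xi>)\<^sup>2)"
    by (rule integrable_monotone_convergence[OF i _ _ ilim]) (auto simp: mono lim)
  show "(LINT \<xi>|lborel. (hartley f \<xi>)\<^sup>2) = (2 * pi) ^ DIM('a) * (LINT x|lborel. (f x)\<^sup>2)"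
    by (rule integral_monotone_convergence[OF i _ _ ilim]) (auto simp: mono lim)
qed

lemma hartley_add:
  assumes "integrable lborel f" "integrable lborel g"
  shows "hartley (\<lambda>x. f x + g x) \<xi> = hartley f \<xi> + hartley g \<xi>"
  using assms by (simp add: hartley_def distrib_left integrable_cas_mult)

text \<open>Polarisation of the identity for squares.\<close>

lemma integral_hartley_mult:
  fixes f g :: "'a::euclidean_space \<Rightarrow> real"
  assumes f: "integrable lborel f" and f2: "integrable lborel (\<lambda>x. (f x)\<^sup>2)"
    and g: "integrable lborel g" and g2: "integrable lborel (\<lambda>x. (g x)\<^sup>2)"
  shows "(LINT \<xi>|lborel. hartley f \<xi> * hartley g \<xi>) = (2 * pi) ^ DIM('a) * (LINT x|lborel. f x * g x)"
proof -
  have [measurable]: "f \<in> borel_measurable borel" "g \<in> borel_measurable borel"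
    using f g by (auto dest: borel_measurable_integrable)
  have fg: "integrable lborel (\<lambda>x. f x * g x)"
    by (rule integrable_mult_L2) (auto simp: f2 g2)
  have Hfg: "integrable lborel (\<lambda>\<xi>. hartley f \<xi> * hartley g \<xi>)"
    by (rule integrable_mult_L2) (auto simp: f f2 g g2 integrable_hartley_square)
  have sq: "(a + b)\<^sup>2 = a\<^sup>2 + b\<^sup>2 + 2 * (a * b)" for a b :: real by (simp add: power2_sum)
  have fg2: "integrable lborel (\<lambda>x. (f x + g x)\<^sup>2)"
    unfolding sq using fg f2 g2 by simp
  have "(LINT \<xi>|lborel. (hartley (\<lambda>x. f x + g x) \<xi>)\<^sup>2) = (2 * pi) ^ DIM('a) * (LINT x|lborel. (f x + g x)\<^sup>2)"
    by (rule integral_hartley_square[OF Bochner_Integration.integrable_add[OF f g] fg2])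
  also have "(LINT x|lborel. (f x + g x)\<^sup>2) = (LINT x|lborel. (f x)\<^sup>2) + (LINT x|lborel. (g x)\<^sup>2) + 2 * (LINT x|lborel. f x * g x)"
    unfolding sq using fg f2 g2 by simp
  also have "(LINT \<xi>|lborel. (hartley (\<lambda>x. f x + g x) \<xi>)\<^sup>2) =
    (LINT \<xi>|lborel. (hartley f \<xi>)\<^sup>2) + (LINT \<xi>|lborel. (hartley g \<xi>)\<^sup>2) + 2 * (LINT \<xi>|lborel. hartley f \<xi> * hartley g \<xi>)"
    unfolding hartley_add[OF f g] sq
    using Hfg integrable_hartley_square[OF f f2] integrable_hartley_square[OF g g2] by simp
  finally show ?thesis
    by (simp add: integral_hartley_square[OF f f2] integral_hartley_square[OF g g2] algebra_simps)
qed

section \<open>Smooth test functions\<close>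

text \<open>
  An algebra of functions that is closed under directional derivatives; membership therefore implies
  smoothness of every order without computing higher derivatives.
\<close>

inductive_set smooth_alg :: "('a::real_normed_vector \<Rightarrow> real) set" where
  base: "(\<And>k s. (D k has_real_derivative D (Suc k) s) (at s)) \<Longrightarrow> bounded_linear l
    \<Longrightarrow> (\<lambda>z. D k (l z + c)) \<in> smooth_alg"
| add: "f \<in> smooth_alg \<Longrightarrow> g \<in> smooth_alg \<Longrightarrow> (\<lambda>z. f z + g z) \<in> smooth_alg"
| mult: "f \<in> smooth_alg \<Longrightarrow> g \<in> smooth_alg \<Longrightarrow> (\<lambda>z. f z * g z) \<in> smooth_alg"

lemma smooth_alg_const: "(\<lambda>z. c) \<in> smooth_alg"
  using smooth_alg.base[of "\<lambda>k _. if k = 0 then c else 0" "\<lambda>_. 0" 0 0] by simp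

lemma smooth_alg_prod:
  "(\<And>i. i \<in> I \<Longrightarrow> f i \<in> smooth_alg) \<Longrightarrow> (\<lambda>z. \<Prod>i\<in>I. f i z) \<in> smooth_alg"
  by (induction I rule: infinite_finite_induct) (auto intro: smooth_alg_const smooth_alg.mult)

lemma smooth_alg_compose_affine:
  assumes "f \<in> smooth_alg" and l: "bounded_linear l"
  shows "(\<lambda>z. f (l z + c)) \<in> smooth_alg"
  using assms(1)
proof induction
  case (base D l' k c')
  interpret l': bounded_linear l' by fact
  have "(\<lambda>z. D k (l' (l z) + (l' c + c'))) \<in> smooth_alg"
    by (rule smooth_alg.base[where D=D, OF base(1) bounded_linear_compose[OF base(2) l]])
  then show ?case by (simp add: l'.add add.assoc)
qed (auto intro: smooth_alg.intros)

text \<open>In the base case the derivative in direction v is the next member of the family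
  \<open>D\<close> times the constant \<open>l v\<close>; sum and product rule handle the
  rest.\<close>

lemma smooth_alg_has_derivative:
  assumes "f \<in> smooth_alg"
  shows "\<exists>f'. (\<forall>z. (f has_derivative f' z) (at z)) \<and> (\<forall>v. (\<lambda>z. f' z v) \<in> smooth_alg)"
  using assms
proof induction
  case (base D l k c)
  have "((\<lambda>z. D k (l z + c)) has_derivative (\<lambda>v. D (Suc k) (l z + c) * l v)) (at z)" for z
    by (rule has_derivative_compose[OF has_derivative_add_const[OF bounded_linear_imp_has_derivative[OF base(2)]]
          base(1)[unfolded has_field_derivative_def]])
  moreover have "(\<lambda>z. D (Suc k) (l z + c) * l v) \<in> smooth_alg" for v
    by (intro smooth_alg.mult smooth_alg.base[where D=D, OF base] smooth_alg_const)
  ultimately show ?case by (intro exI[of _ "\<lambda>z v. D (Suc k) (l z + c) * l v"]) auto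
next
  case (add f g)
  then obtain f' g' where "\<forall>z. (f has_derivative f' z) (at z)" "\<forall>v. (\<lambda>z. f' z v) \<in> smooth_alg"
    "\<forall>z. (g has_derivative g' z) (at z)" "\<forall>v. (\<lambda>z. g' z v) \<in> smooth_alg" by auto
  then show ?case
    by (intro exI[of _ "\<lambda>z v. f' z v + g' z v"]) (auto intro!: has_derivative_add smooth_alg.add)
next
  case (mult f g)
  then obtain f' g' where "\<forall>z. (f has_derivative f' z) (at z)" "\<forall>v. (\<lambda>z. f' z v) \<in> smooth_alg"
    "\<forall>z. (g has_derivative g' z) (at z)" "\<forall>v. (\<lambda>z. g' z v) \<in> smooth_alg" by auto
  with mult show ?case
    by (intro exI[of _ "\<lambda>z v. f z * g' z v + f' z v * g z"])
      (auto intro!: has_derivative_mult smooth_alg.add smooth_alg.mult)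
qed

lemma smooth_alg_differentiable: "f \<in> smooth_alg \<Longrightarrow> f differentiable (at z)"
  using smooth_alg_has_derivative[of f] by (auto simp: differentiable_def)

lemma smooth_alg_frechet_derivative:
  assumes "f \<in> smooth_alg"
  shows "(\<lambda>z. frechet_derivative f (at z) v) \<in> smooth_alg"
proof -
  obtain f' where f': "\<And>z. (f has_derivative f' z) (at z)" "\<And>v. (\<lambda>z. f' z v) \<in> smooth_alg"
    using smooth_alg_has_derivative[OF assms] by auto
  show ?thesis using f'(2)[of v] by (simp flip: frechet_derivative_at[OF f'(1)])
qed

lemma smooth_alg_continuous_on: "f \<in> smooth_alg \<Longrightarrow> continuous_on S f"
  by (rule differentiable_imp_continuous_on) (auto simp: differentiable_on_def intro: differentiable_at_withinI smooth_alg_differentiable)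

text \<open>The condition on \<open>S\<close> provides points of \<open>S\<close> arbitrarily close
  to x along every axis. This makes derivatives within \<open>S\<close> unique, so they coincide
  with the full derivative also at boundary points.\<close>

lemma smooth_alg_smooth_on:
  fixes f :: "'a::euclidean_space \<Rightarrow> real"
  assumes S: "\<And>x i e. \<lbrakk>x \<in> S; i \<in> Basis; e > 0\<rbrakk> \<Longrightarrow> \<exists>d. 0 < \<bar>d\<bar> \<and> \<bar>d\<bar> < e \<and> (x + d *\<^sub>R i) \<in> S"
    and f: "f \<in> smooth_alg"
  shows "smooth_on S f"
proof -
  \<comment> \<open>The induction is over functions that merely agree on \<open>S\<close> with a
    member of the algebra: outside \<open>S\<close> nothing is known about the derivative within
    \<open>S\<close>.\<close>
  have "Ck_on k S g" if "f \<in> smooth_alg" "\<And>x. x \<in> S \<Longrightarrow> g x = f x" for k and f g :: "'a \<Rightarrow> real"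
    using that
  proof (induction k arbitrary: f g)
    case 0
    then show ?case using smooth_alg_continuous_on[of f S] by (simp cong: continuous_on_cong)
  next
    case (Suc k)
    obtain f' where f': "\<And>z. (f has_derivative f' z) (at z)" "\<And>v. (\<lambda>z. f' z v) \<in> smooth_alg"
      using smooth_alg_has_derivative[OF Suc.prems(1)] by auto
    have g: "(g has_derivative f' x) (at x within S)" if "x \<in> S" for x
      using that Suc.prems(2) by (rule has_derivative_transform[OF _ _ has_derivative_at_withinI[OF f'(1)]])
    have "frechet_derivative g (at x within S) = f' x" if "x \<in> S" for x
    proof (rule frechet_derivative_unique_within[OF _ g[OF that] S[OF that]])
      show "(g has_derivative frechet_derivative g (at x within S)) (at x within S)"
        using g[OF that] by (metis differentiableI frechet_derivative_works)
    qed
    then have "Ck_on k S (\<lambda>x. frechet_derivative g (at x within S) v)" for v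
      by (intro Suc.IH[OF f'(2)[of v]]) simp
    moreover have "g differentiable_on S"
      unfolding differentiable_on_def using g by (auto simp: differentiable_def)
    ultimately show ?case by simp
  qed
  then show ?thesis using f unfolding smooth_on_def by blast
qed

text \<open>
  The functions \<open>p(1/s) exp(-1/s)\<close>, extended by \<open>0\<close>, are closed under differentiation;
  \<open>p = 1\<close> is the standard flat function.
\<close>

definition flat_exp :: "real poly \<Rightarrow> real \<Rightarrow> real" where
  "flat_exp p s = (if s > 0 then poly p (1 / s) * exp (- (1 / s)) else 0)"

lemma poly_mult_exp_neg_tendsto_0: "((\<lambda>x::real. poly p x * exp (- x)) \<longlongrightarrow> 0) at_top"
proof -
  have "((\<lambda>x::real. \<Sum>i\<le>degree p. coeff p i * (x ^ i / exp x)) \<longlongrightarrow> (\<Sum>i\<le>degree p. coeff p i * 0)) at_top"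
    by (intro tendsto_intros tendsto_power_div_exp_0)
  then show ?thesis
    by (simp add: poly_altdef exp_minus divide_simps sum_divide_distrib)
qed

text \<open>Differentiating p(1/s) exp (-1/s) gives (1/s)^2 (p - p')(1/s) exp (-1/s), and
  \<open>[:0, 0, 1:]\<close> is the square of the variable. Only s = 0 needs a limit.\<close>

lemma flat_exp_has_derivative:
  "(flat_exp p has_real_derivative flat_exp ([:0, 0, 1:] * (p - pderiv p)) s) (at s)"
proof (cases "s > 0" "s < 0" rule: case_split[case_product case_split])
  case True_True then show ?thesis by simp
next
  case True_False
  have "((\<lambda>s. poly p (1 / s) * exp (- (1 / s))) has_real_derivative flat_exp ([:0, 0, 1:] * (p - pderiv p)) s) (at s)"
    using True_False
    by (auto intro!: derivative_eq_intros DERIV_chain2[where f="poly p"] poly_DERIV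
        simp: flat_exp_def power2_eq_square field_simps)
  then show ?thesis
    by (rule DERIV_cong_ev[OF refl _ refl, THEN iffD1, rotated])
       (use True_False in \<open>auto simp: flat_exp_def eventually_nhds intro!: exI[of _ "{0<..}"]\<close>)
next
  case False_True
  have "((\<lambda>s. 0) has_real_derivative flat_exp ([:0, 0, 1:] * (p - pderiv p)) s) (at s)"
    using False_True by (simp add: flat_exp_def)
  then show ?thesis
    by (rule DERIV_cong_ev[OF refl _ refl, THEN iffD1, rotated])
       (use False_True in \<open>auto simp: flat_exp_def eventually_nhds intro!: exI[of _ "{..<0}"]\<close>)
next
  case False_False
  then have s: "s = 0" by simp
  have "((\<lambda>h. flat_exp p h / h) \<longlongrightarrow> 0) (at_right 0)"
  proof -
    \<comment> \<open>Division by h is absorbed into the polynomial: p(1/h) / h is the value of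
      \<open>pCons 0 p\<close> at 1/h.\<close>
    have "((\<lambda>h. poly (pCons 0 p) (inverse h) * exp (- inverse h)) \<longlongrightarrow> 0) (at_right (0::real))"
      by (rule filterlim_compose[OF poly_mult_exp_neg_tendsto_0 filterlim_inverse_at_top_right])
    then show ?thesis
      by (rule Lim_transform_eventually)
         (auto simp: flat_exp_def eventually_at_right_field divide_simps intro!: exI[of _ 1])
  qed
  moreover have "((\<lambda>h. flat_exp p h / h) \<longlongrightarrow> 0) (at_left 0)"
    by (rule Lim_transform_eventually[OF tendsto_const])
       (auto simp: flat_exp_def eventually_at_left_field intro!: exI[of _ "-1"])
  ultimately have "((\<lambda>h. flat_exp p h / h) \<longlongrightarrow> 0) (at 0)"
    by (simp add: filterlim_at_split)
  then show ?thesis by (simp add: s DERIV_def) (simp add: flat_exp_def)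
qed

lemma flat_exp_smooth_alg: "bounded_linear l \<Longrightarrow> (\<lambda>z. flat_exp p (l z + c)) \<in> smooth_alg"
  using smooth_alg.base[of "\<lambda>k. flat_exp (((\<lambda>p. [:0, 0, 1:] * (p - pderiv p)) ^^ k) p)" l 0 c] flat_exp_has_derivative
  by simp

text \<open>A one-dimensional bump whose rescaled copies, multiplied over the coordinates, serve as
  spatial cutoffs. A single \<open>B\<close> bounds it and two derivatives, as many as the Laplacian
  takes.\<close>

locale cutoff =
  fixes \<kappa> \<kappa>' \<kappa>'' :: "real \<Rightarrow> real" and B :: real
  assumes smooth: "\<kappa> \<in> smooth_alg"
    and deriv: "(\<kappa> has_real_derivative \<kappa>' s) (at s)" "(\<kappa>' has_real_derivative \<kappa>'' s) (at s)"
    and at_0: "\<kappa> 0 = 1" and supp: "\<bar>s\<bar> > 1 \<Longrightarrow> \<kappa> s = 0"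
    and bound: "\<bar>\<kappa> s\<bar> \<le> B" "\<bar>\<kappa>' s\<bar> \<le> B" "\<bar>\<kappa>'' s\<bar> \<le> B" and B_ge_1: "B \<ge> 1"

lemma cutoff_exists: "\<exists>\<kappa> \<kappa>' \<kappa>'' B. cutoff \<kappa> \<kappa>' \<kappa>'' B"
proof -
  \<comment> \<open>At s = 0 each flat factor equals exp (-1); the factor \<open>exp 2\<close>
    normalises the value to 1.\<close>
  define \<kappa> :: "real \<Rightarrow> real" where "\<kappa> s = exp 2 * (flat_exp 1 (s + 1) * flat_exp 1 (- s + 1))" for s
  have sm: "\<kappa> \<in> smooth_alg"
    unfolding \<kappa>_def[abs_def]
    by (intro smooth_alg.mult smooth_alg_const flat_exp_smooth_alg bounded_linear_minus bounded_linear_ident)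
  have deriv: "\<exists>f' \<in> smooth_alg. (\<forall>s. (f has_real_derivative f' s) (at s))" if f: "f \<in> smooth_alg" for f :: "real \<Rightarrow> real"
  proof -
    obtain f' where f': "\<And>z. (f has_derivative f' z) (at z)" "\<And>v. (\<lambda>z. f' z v) \<in> smooth_alg"
      using smooth_alg_has_derivative[OF f] by auto
    have "(f has_real_derivative f' s 1) (at s)" for s
      using has_derivative_imp_has_field_derivative[OF f'(1)[of s], of "f' s 1"] linear_cmul[OF has_derivative_linear[OF f'(1)[of s]]]
      by (metis mult.right_neutral mult.commute real_scaleR_def)
    then show ?thesis using f'(2)[of 1] by (intro bexI[of _ "\<lambda>z. f' z 1"]) auto
  qed
  from deriv[OF sm] obtain \<kappa>' where 1: "\<kappa>' \<in> smooth_alg" "\<And>s. (\<kappa> has_real_derivative \<kappa>' s) (at s)" by auto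
  from deriv[OF 1(1)] obtain \<kappa>'' where 2: "\<kappa>'' \<in> smooth_alg" "\<And>s. (\<kappa>' has_real_derivative \<kappa>'' s) (at s)" by auto
  have z0: "\<kappa> s = 0" if "\<bar>s\<bar> > 1" for s
    using that by (auto simp: \<kappa>_def flat_exp_def)
  \<comment> \<open>Vanishing on an open set passes to the derivative, so \<kappa>' and \<kappa>''
    need no formula.\<close>
  have zd: "f' s = 0" if "\<And>s. \<bar>s\<bar> > 1 \<Longrightarrow> f s = 0" "\<And>s. (f has_real_derivative f' s) (at s)" "\<bar>s\<bar> > 1"
    for f f' :: "real \<Rightarrow> real" and s
  proof -
    have "open {s::real. \<bar>s\<bar> > 1}" by (intro open_Collect_less continuous_intros)
    then have "\<forall>\<^sub>F s in nhds s. f s = 0"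
      using that(1,3) by (auto simp: eventually_nhds intro!: exI[of _ "{s. \<bar>s\<bar> > 1}"])
    then have "((\<lambda>_. 0) has_real_derivative f' s) (at s)"
      using DERIV_cong_ev[of s s f "\<lambda>_. 0" "f' s" "f' s"] that(2)[of s] by simp
    then show ?thesis by (rule DERIV_unique[OF _ DERIV_const])
  qed
  have z1: "\<kappa>' s = 0" if "\<bar>s\<bar> > 1" for s by (rule zd[OF z0 1(2) that])
  have z2: "\<kappa>'' s = 0" if "\<bar>s\<bar> > 1" for s by (rule zd[OF z1 2(2) that])
  have bdd: "\<exists>B. \<forall>s. \<bar>f s\<bar> \<le> B" if "f \<in> smooth_alg" "\<And>s. \<bar>s\<bar> > 1 \<Longrightarrow> f s = 0" for f :: "real \<Rightarrow> real"
  proof -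
    have "compact (f ` {-1..1})"
      by (intro compact_continuous_image smooth_alg_continuous_on that) simp
    then obtain B where B: "\<And>s. s \<in> {-1..1} \<Longrightarrow> \<bar>f s\<bar> \<le> B"
      using compact_imp_bounded[THEN bounded_iff[THEN iffD1]] by (metis image_eqI real_norm_def)
    have "\<bar>f s\<bar> \<le> max 0 B" for s
    proof (cases "\<bar>s\<bar> > 1")
      case False
      then have "s \<in> {-1..1}" by auto
      from B[OF this] show ?thesis by simp
    qed (simp add: that(2))
    then show ?thesis by blast
  qed
  obtain B0 where B0: "\<And>s. \<bar>\<kappa> s\<bar> \<le> B0" using bdd[OF sm z0] by auto
  obtain B1 where B1: "\<And>s. \<bar>\<kappa>' s\<bar> \<le> B1" using bdd[OF 1(1) z1] by auto
  obtain B2 where B2: "\<And>s. \<bar>\<kappa>'' s\<bar> \<le> B2" using bdd[OF 2(1) z2] by auto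
  let ?B = "max 1 (max B0 (max B1 B2))"
  have "\<kappa> 0 = 1" by (simp add: \<kappa>_def flat_exp_def flip: exp_add)
  moreover have "\<bar>\<kappa> s\<bar> \<le> ?B" "\<bar>\<kappa>' s\<bar> \<le> ?B" "\<bar>\<kappa>'' s\<bar> \<le> ?B" for s
    using B0[of s] B1[of s] B2[of s] by linarith+
  ultimately have "cutoff \<kappa> \<kappa>' \<kappa>'' ?B"
    by (intro cutoff.intro sm 1(2) 2(2) z0) simp_all
  then show ?thesis by blast
qed

text \<open>The derivative of \<open>cas\<close>, and at the same time its reflection:
  differentiating the kernel turns the frequency \<xi> into -\<xi>.\<close>

definition sac :: "real \<Rightarrow> real" where "sac \<theta> = cos \<theta> - sin \<theta>"

lemma sac_eq_cas: "sac \<theta> = cas (- \<theta>)"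
  by (simp add: sac_def cas_def)

lemma cas_has_derivative: "(cas has_real_derivative sac \<theta>) (at \<theta>)"
  and sac_has_derivative: "(sac has_real_derivative - cas \<theta>) (at \<theta>)"
  unfolding cas_def[abs_def] sac_def[abs_def] by (auto intro!: derivative_eq_intros)

lemma cas_smooth_alg:
  assumes "bounded_linear l"
  shows "(\<lambda>z. cas (l z)) \<in> smooth_alg"
proof -
  define D where "D k = (if k mod 4 = 0 then cas else if k mod 4 = 1 then sac
      else if k mod 4 = 2 then (\<lambda>s. - cas s) else (\<lambda>s. - sac s))" for k :: nat
  have "(D k has_real_derivative D (Suc k) s) (at s)" for k s
  proof -
    have "k mod 4 < 4" by simp
    then consider "k mod 4 = 0" | "k mod 4 = 1" | "k mod 4 = 2" | "k mod 4 = 3" by linarith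
    then show ?thesis
    proof cases
      case 1
      then have "D k = cas" "D (Suc k) = sac" by (simp_all add: D_def mod_Suc)
      then show ?thesis by (simp add: cas_has_derivative)
    next
      case 2
      then have "D k = sac" "D (Suc k) = (\<lambda>s. - cas s)" by (simp_all add: D_def mod_Suc)
      then show ?thesis by (simp add: sac_has_derivative)
    next
      case 3
      then have "D k = (\<lambda>s. - cas s)" "D (Suc k) = (\<lambda>s. - sac s)" by (simp_all add: D_def mod_Suc)
      then show ?thesis using DERIV_minus[OF cas_has_derivative[of s]] by simp
    next
      case 4
      then have "D k = (\<lambda>s. - sac s)" "D (Suc k) = cas" by (simp_all add: D_def mod_Suc)
      then show ?thesis using DERIV_minus[OF sac_has_derivative[of s]] by simp
    qed
  qed
  from smooth_alg.base[where D=D and k=0 and c=0, OF this assms] show ?thesis by (simp add: D_def)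
qed

text \<open>Differentiability is known from the algebra, so a directional derivative can be found by
  a one-variable computation along a line, without the full derivative.\<close>

lemma frechet_derivative_line:
  assumes f: "f differentiable (at z)" and r: "((\<lambda>s. f (z + s *\<^sub>R v)) has_real_derivative r) (at 0)"
  shows "frechet_derivative f (at z) v = r"
proof -
  have "(f has_derivative frechet_derivative f (at z)) (at (z + 0 *\<^sub>R v))"
    using f by (simp add: frechet_derivative_works)
  moreover have "((\<lambda>s. z + s *\<^sub>R v) has_derivative (\<lambda>s. s *\<^sub>R v)) (at 0)"
    by (auto intro!: derivative_eq_intros)
  ultimately have "((\<lambda>s. f (z + s *\<^sub>R v)) has_derivative (\<lambda>s. frechet_derivative f (at z) (s *\<^sub>R v))) (at 0)"
    using has_derivative_compose[where g=f and f="\<lambda>s. z + s *\<^sub>R v" and f'="\<lambda>s. s *\<^sub>R v" and s=UNIV and x=0] by blast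
  moreover have "(\<lambda>s. frechet_derivative f (at z) (s *\<^sub>R v)) = (*) (frechet_derivative f (at z) v)"
    using linear_cmul[OF linear_frechet_derivative[OF f]] by (auto simp: mult.commute)
  ultimately have "((\<lambda>s. f (z + s *\<^sub>R v)) has_real_derivative frechet_derivative f (at z) v) (at 0)"
    by (simp add: has_field_derivative_def)
  then show ?thesis using r by (rule DERIV_unique)
qed

text \<open>The condition b < T separates the support from the final time. Negative times are
  excluded by the domain, so no lower bound on t is asked for.\<close>

lemma smooth_alg_test_function:
  fixes \<phi> :: "real \<times> (real ^ 'n) \<Rightarrow> real"
  assumes \<phi>: "\<phi> \<in> smooth_alg" and b: "b < T"
    and supp: "\<And>t x. \<phi> (t, x) \<noteq> 0 \<Longrightarrow> t \<le> b \<and> (\<forall>i. \<bar>x $ i\<bar> \<le> R)"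
  shows "\<phi> \<in> test_functions T"
proof -
  let ?S = "{0..<T} \<times> (UNIV :: (real ^ 'n) set)"
  let ?K = "{0..b} \<times> cbox (\<chi> i. - R) (\<chi> i. R) :: (real \<times> (real ^ 'n)) set"
  have smooth: "smooth_on ?S \<phi>"
  proof (rule smooth_alg_smooth_on[OF _ \<phi>])
    fix x i :: "real \<times> (real ^ 'n)" and e :: real
    assume x: "x \<in> ?S" and i: "i \<in> Basis" and e: "e > 0"
    \<comment> \<open>Steps are taken forward: basis vectors have time component 0 or 1, so t = 0
      causes no difficulty and only t + d < T has to be ensured.\<close>
    define d where "d = min (e / 2) ((T - fst x) / 2)"
    have d: "0 < d" "d < e" "d < T - fst x" using x e by (auto simp: d_def min_def field_simps)
    have "fst i = 0 \<or> fst i = 1" using i by (auto simp: Basis_prod_def)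
    then have "x + d *\<^sub>R i \<in> ?S" using x d by (cases x, cases i) auto
    then show "\<exists>d. 0 < \<bar>d\<bar> \<and> \<bar>d\<bar> < e \<and> x + d *\<^sub>R i \<in> ?S"
      using d by (intro exI[of _ d]) auto
  qed
  have sub: "closure (support_on ?S \<phi>) \<subseteq> ?K"
  proof (rule closure_minimal)
    show "support_on ?S \<phi> \<subseteq> ?K"
    proof
      fix z assume z: "z \<in> support_on ?S \<phi>"
      obtain t x where tx: "z = (t, x)" by (cases z)
      have nz: "\<phi> (t, x) \<noteq> 0" "0 \<le> t" using z by (auto simp: support_on_def tx)
      have "t \<le> b" and R: "\<bar>x $ i\<bar> \<le> R" for i using supp[OF nz(1)] by blast+
      moreover have "- R \<le> x $ i \<and> x $ i \<le> R" for i using R[of i] by linarith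
      ultimately show "z \<in> ?K" using nz by (simp add: tx mem_box_cart)
    qed
  qed (intro closed_Times closed_cbox closed_atLeastAtMost)
  have "compact ?K" by (intro compact_Times) auto
  then have "bounded (closure (support_on ?S \<phi>))"
    by (rule bounded_subset[OF compact_imp_bounded sub])
  then have comp: "compact (closure (support_on ?S \<phi>))"
    by (simp add: compact_eq_bounded_closed)
  have KS: "?K \<subseteq> ?S" using b by auto
  show ?thesis
    unfolding test_functions_def using smooth comp order_trans[OF sub KS] by simp
qed

lemma smooth_alg_affine:
  assumes "bounded_linear l"
  shows "(\<lambda>z. l z + c) \<in> smooth_alg"
proof -
  define D :: "nat \<Rightarrow> real \<Rightarrow> real" where
    "D k = (if k = 0 then (\<lambda>s. s) else if k = 1 then (\<lambda>_. 1) else (\<lambda>_. 0))" for k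
  have "(D k has_real_derivative D (Suc k) s) (at s)" for k s
    by (auto simp: D_def)
  from smooth_alg.base[where D=D and k=0, OF this assms] show ?thesis by (simp add: D_def)
qed

text \<open>A smooth approximation of \<open>max 0 (b - t)\<close>, whose derivatives converge boundedly to \<open>- indicator {..<b} t\<close>.\<close>

definition time_cut :: "real \<Rightarrow> nat \<Rightarrow> real \<Rightarrow> real" where
  "time_cut b m t = (b - t) * flat_exp 1 (real (Suc m) * (b - t))"

definition time_cut_deriv :: "real \<Rightarrow> nat \<Rightarrow> real \<Rightarrow> real" where
  "time_cut_deriv b m t = - (flat_exp 1 (real (Suc m) * (b - t))
     + real (Suc m) * (b - t) * flat_exp [:0, 0, 1:] (real (Suc m) * (b - t)))"

lemma time_cut_has_derivative: "(time_cut b m has_real_derivative time_cut_deriv b m t) (at t)"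
proof -
  have f: "(flat_exp 1 has_real_derivative flat_exp [:0, 0, 1:] s) (at s)" for s
    using flat_exp_has_derivative[of 1 s] by simp
  have "((\<lambda>t. flat_exp 1 (real (Suc m) * (b - t))) has_real_derivative
      flat_exp [:0, 0, 1:] (real (Suc m) * (b - t)) * (- real (Suc m))) (at t)"
    by (rule DERIV_chain2[OF f]) (auto intro!: derivative_eq_intros)
  then show ?thesis
    unfolding time_cut_def[abs_def] time_cut_deriv_def
    by (auto intro!: derivative_eq_intros simp: algebra_simps)
qed

lemma flat_exp_1_bounds: "0 \<le> flat_exp 1 s" "flat_exp 1 s \<le> 1"
  by (auto simp: flat_exp_def)

text \<open>With y = 1/s the quantity is y exp (-y). In \<open>time_cut_deriv\<close> the large
  factor \<open>Suc m\<close> from the chain rule occurs only together with b - t in the form s,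
  hence the bound uniform in m.\<close>

lemma flat_exp_2_bounds: "0 \<le> s * flat_exp [:0, 0, 1:] s" "s * flat_exp [:0, 0, 1:] s \<le> 1"
proof -
  have eq: "s * flat_exp [:0, 0, 1:] s = (if s > 0 then (1 / s) * exp (- (1 / s)) else 0)"
    by (simp add: flat_exp_def)
  have le: "y * exp (- y) \<le> 1" for y :: real
  proof -
    have "y \<le> exp y" using exp_ge_add_one_self[of y] by linarith
    then show ?thesis by (simp add: exp_minus field_simps)
  qed
  show "0 \<le> s * flat_exp [:0, 0, 1:] s" "s * flat_exp [:0, 0, 1:] s \<le> 1"
    unfolding eq using le[of "1 / s"] by simp_all
qed

lemma abs_time_cut_deriv_le: "\<bar>time_cut_deriv b m t\<bar> \<le> 2"
  unfolding time_cut_deriv_def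
  using flat_exp_1_bounds[of "real (Suc m) * (b - t)"] flat_exp_2_bounds[of "real (Suc m) * (b - t)"] by linarith

lemma abs_time_cut_le: "\<bar>time_cut b m t\<bar> \<le> \<bar>b - t\<bar>"
  unfolding time_cut_def abs_mult using flat_exp_1_bounds[of "real (Suc m) * (b - t)"]
  by (intro mult_left_le) auto

text \<open>For t < b the arguments of the exponentials tend to 0. For t \<ge> b both functions are
  0 for every m, so the indicator in the limit is that of the open half-line.\<close>

lemma time_cut_tendsto: "(\<lambda>m. time_cut b m t) \<longlonglongrightarrow> max 0 (b - t)"
  and time_cut_deriv_tendsto: "(\<lambda>m. time_cut_deriv b m t) \<longlonglongrightarrow> - indicator {..<b} t"
proof -
  have "(\<lambda>m. time_cut b m t) \<longlonglongrightarrow> max 0 (b - t) \<and> (\<lambda>m. time_cut_deriv b m t) \<longlonglongrightarrow> - indicator {..<b} t"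
  proof (cases "t < b")
    case True
    have 0: "(\<lambda>m. 1 / (real (Suc m) * (b - t))) \<longlonglongrightarrow> 0"
      using tendsto_mult[OF LIMSEQ_Suc[OF lim_1_over_n] tendsto_const[of "1 / (b - t)"]] by simp
    then have "(\<lambda>m. (b - t) * exp (- (1 / (real (Suc m) * (b - t))))) \<longlonglongrightarrow> (b - t) * exp (- 0)"
      by (intro tendsto_intros)
    moreover have "(\<lambda>m. - (exp (- (1 / (real (Suc m) * (b - t)))) + 1 / (real (Suc m) * (b - t)) * exp (- (1 / (real (Suc m) * (b - t))))))
      \<longlonglongrightarrow> - (exp (- 0) + 0 * exp (- 0))"
      using 0 by (intro tendsto_intros)
    moreover have "real (Suc m) * (b - t) > 0" for m using True by simp
    ultimately show ?thesis
      using True unfolding time_cut_def time_cut_deriv_def flat_exp_def by (simp del: of_nat_Suc)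
  next
    case False
    then have "\<not> real (Suc m) * (b - t) > 0" for m by (simp add: mult_nonneg_nonpos not_less)
    with False show ?thesis
      unfolding time_cut_def time_cut_deriv_def flat_exp_def by simp
  qed
  then show "(\<lambda>m. time_cut b m t) \<longlonglongrightarrow> max 0 (b - t)" "(\<lambda>m. time_cut_deriv b m t) \<longlonglongrightarrow> - indicator {..<b} t"
    by auto
qed

section \<open>Cut-off Hartley kernels as test functions\<close>

lemma DERIV_line:
  assumes "\<And>s. (f has_real_derivative f' s) (at s)"
  shows "((\<lambda>s. f (p + s * q)) has_real_derivative f' p * q) (at 0)"
proof -
  have "(f has_real_derivative f' p) (at (p + 0 * q))" using assms by simp
  then show ?thesis
    by (rule DERIV_chain2[where g="\<lambda>s. p + s * q"]) (auto intro!: derivative_eq_intros)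
qed

context cutoff
begin

text \<open>The cutoff factors of the other coordinates; they are constant along axis i, so a
  derivative in that direction leaves them alone.\<close>

definition cross :: "nat \<Rightarrow> 'n::finite \<Rightarrow> real ^ 'n \<Rightarrow> real" where
  "cross m i x = (\<Prod>j\<in>UNIV - {i}. \<kappa> (x $ j / real (Suc m)))"

text \<open>Admissible approximation of max 0 (b - t) \<open>cas\<close> (\<xi> . x), which lacks
  compact support and smoothness at t = b. One index m drives both the time smoothing and the
  spatial radius.\<close>

definition probe :: "real \<Rightarrow> real ^ 'n \<Rightarrow> nat \<Rightarrow> real \<times> (real ^ 'n::finite) \<Rightarrow> real" where
  "probe b \<xi> m z = time_cut b m (fst z) * ((\<Prod>j\<in>UNIV. \<kappa> (snd z $ j / real (Suc m))) * cas (\<xi> \<bullet> snd z))"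

text \<open>Together with \<open>probe2\<close>, the first and second derivative of
  \<open>probe\<close> along axis i. Each derivative that falls on the cutoff brings a factor 1 /
  \<open>Suc m\<close> and disappears in the limit.\<close>

definition probe1 :: "real \<Rightarrow> real ^ 'n \<Rightarrow> nat \<Rightarrow> 'n \<Rightarrow> real \<times> (real ^ 'n::finite) \<Rightarrow> real" where
  "probe1 b \<xi> m i z = time_cut b m (fst z) * (cross m i (snd z) *
     (\<kappa>' (snd z $ i / real (Suc m)) / real (Suc m) * cas (\<xi> \<bullet> snd z)
      + \<kappa> (snd z $ i / real (Suc m)) * (\<xi> $ i * sac (\<xi> \<bullet> snd z))))"

definition probe2 :: "real \<Rightarrow> real ^ 'n \<Rightarrow> nat \<Rightarrow> 'n \<Rightarrow> real \<times> (real ^ 'n::finite) \<Rightarrow> real" where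
  "probe2 b \<xi> m i z = time_cut b m (fst z) * (cross m i (snd z) *
     (\<kappa>'' (snd z $ i / real (Suc m)) / (real (Suc m))\<^sup>2 * cas (\<xi> \<bullet> snd z)
      + 2 * (\<kappa>' (snd z $ i / real (Suc m)) / real (Suc m)) * (\<xi> $ i * sac (\<xi> \<bullet> snd z))
      - \<kappa> (snd z $ i / real (Suc m)) * ((\<xi> $ i)\<^sup>2 * cas (\<xi> \<bullet> snd z))))"

lemma probe_smooth_alg:
  fixes \<xi> :: "real ^ 'n::finite"
  shows "probe b \<xi> m \<in> smooth_alg"
proof -
  have "(\<lambda>z::real \<times> (real ^ 'n). - fst z + b) \<in> smooth_alg"
    by (intro smooth_alg_affine bounded_linear_minus bounded_linear_fst)
  moreover have "(\<lambda>z::real \<times> (real ^ 'n). flat_exp 1 (real (Suc m) * (- fst z) + real (Suc m) * b)) \<in> smooth_alg"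
    by (intro flat_exp_smooth_alg bounded_linear_mult_right[THEN bounded_linear_compose] bounded_linear_minus bounded_linear_fst)
  moreover have "(\<lambda>z::real \<times> (real ^ 'n). cas (\<xi> \<bullet> snd z)) \<in> smooth_alg"
    by (intro cas_smooth_alg bounded_linear_inner_right[THEN bounded_linear_compose] bounded_linear_snd)
  moreover have "(\<lambda>z::real \<times> (real ^ 'n). \<kappa> (snd z $ j / real (Suc m) + 0)) \<in> smooth_alg" for j
    by (intro smooth_alg_compose_affine[OF smooth] bounded_linear_divide[THEN bounded_linear_compose]
        bounded_linear_vec_nth[THEN bounded_linear_compose] bounded_linear_snd)
  ultimately have "(\<lambda>z::real \<times> (real ^ 'n). ((- fst z + b) * flat_exp 1 (real (Suc m) * (- fst z) + real (Suc m) * b))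
      * ((\<Prod>j\<in>UNIV. \<kappa> (snd z $ j / real (Suc m) + 0)) * cas (\<xi> \<bullet> snd z))) \<in> smooth_alg"
    by (intro smooth_alg.mult smooth_alg_prod)
  then show ?thesis
    unfolding probe_def[abs_def] time_cut_def by (simp add: algebra_simps)
qed

lemma probe_test_function:
  fixes \<xi> :: "real ^ 'n::finite"
  assumes "b < T"
  shows "probe b \<xi> m \<in> test_functions T"
  using assms
proof (rule smooth_alg_test_function[OF probe_smooth_alg _, where R="real (Suc m)"])
  fix t and x :: "real ^ 'n" assume nz: "probe b \<xi> m (t, x) \<noteq> 0"
  have "t \<le> b"
  proof (rule ccontr)
    assume "\<not> t \<le> b"
    then have "\<not> real (Suc m) * (b - t) > 0" by (simp add: mult_nonneg_nonpos not_less)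
    then show False using nz by (simp add: probe_def time_cut_def flat_exp_def)
  qed
  moreover have "\<bar>x $ i\<bar> \<le> real (Suc m)" for i
  proof (rule ccontr)
    assume "\<not> \<bar>x $ i\<bar> \<le> real (Suc m)"
    then have "\<kappa> (x $ i / real (Suc m)) = 0" by (intro supp) (simp add: field_simps)
    then have "(\<Prod>j\<in>UNIV. \<kappa> (x $ j / real (Suc m))) = 0" by (intro prod_zero) auto
    then show False using nz by (simp add: probe_def)
  qed
  ultimately show "t \<le> b \<and> (\<forall>i. \<bar>x $ i\<bar> \<le> real (Suc m))" by blast
qed

lemma time_deriv_probe:
  "time_deriv (probe b \<xi> m) z = time_cut_deriv b m (fst z) * ((\<Prod>j\<in>UNIV. \<kappa> (snd z $ j / real (Suc m))) * cas (\<xi> \<bullet> snd z))"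
  unfolding time_deriv_def
proof (rule frechet_derivative_line[OF smooth_alg_differentiable[OF probe_smooth_alg]])
  have "((\<lambda>s. time_cut b m (fst z + s)) has_real_derivative time_cut_deriv b m (fst z)) (at 0)"
    using DERIV_line[where f="time_cut b m", OF time_cut_has_derivative, of "fst z" 1] by simp
  from DERIV_mult[OF this DERIV_const]
  show "((\<lambda>s. probe b \<xi> m (z + s *\<^sub>R (1, 0))) has_real_derivative
    time_cut_deriv b m (fst z) * ((\<Prod>j\<in>UNIV. \<kappa> (snd z $ j / real (Suc m))) * cas (\<xi> \<bullet> snd z))) (at 0)"
    unfolding probe_def by simp
qed

lemma cross_shift: "cross m i (x + s *\<^sub>R axis i 1) = cross m i x"
  unfolding cross_def by (intro prod.cong refl) (simp add: axis_def)

lemma prod_eq_cross: "(\<Prod>j\<in>UNIV. \<kappa> (x $ j / real (Suc m))) = \<kappa> (x $ i / real (Suc m)) * cross m i x"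
  unfolding cross_def by (rule prod.remove) auto

lemma line_derivs:
  shows "((\<lambda>s. \<kappa> (p + s * q)) has_real_derivative \<kappa>' p * q) (at 0)"
    "((\<lambda>s. \<kappa>' (p + s * q)) has_real_derivative \<kappa>'' p * q) (at 0)"
    "((\<lambda>s. cas (p + s * q)) has_real_derivative sac p * q) (at 0)"
    "((\<lambda>s. sac (p + s * q)) has_real_derivative - cas p * q) (at 0)"
  by (rule DERIV_line deriv cas_has_derivative sac_has_derivative)+

lemma axis_line: "(x + s *\<^sub>R axis i 1) $ i / N = x $ i / N + s * (1 / N)"
  "\<xi> \<bullet> (x + s *\<^sub>R axis i 1) = \<xi> \<bullet> x + s * (\<xi> $ i)"
  by (simp_all add: add_divide_distrib inner_add_right inner_axis)

lemma space_deriv_probe: "space_deriv i (probe b \<xi> m) z = probe1 b \<xi> m i z"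
  unfolding space_deriv_def
proof (rule frechet_derivative_line[OF smooth_alg_differentiable[OF probe_smooth_alg]])
  obtain t x where z: "z = (t, x)" by (cases z)
  define N where "N = real (Suc m)"
  define K where "K = time_cut b m t * cross m i x"
  have eq: "(\<lambda>s. probe b \<xi> m (z + s *\<^sub>R (0, axis i 1))) =
    (\<lambda>s. K * (\<kappa> (x $ i / N + s * (1 / N)) * cas (\<xi> \<bullet> x + s * (\<xi> $ i))))"
    unfolding probe_def prod_eq_cross[of _ _ i] unfolding N_def[symmetric]
    by (simp only: z add_Pair scaleR_Pair fst_conv snd_conv cross_shift axis_line K_def) (simp add: mult_ac)
  show "((\<lambda>s. probe b \<xi> m (z + s *\<^sub>R (0, axis i 1))) has_real_derivative probe1 b \<xi> m i z) (at 0)"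
    unfolding eq
    by (rule DERIV_cong[OF DERIV_cmult[OF DERIV_mult[OF line_derivs(1) line_derivs(3)]]])
       (simp only: z probe1_def fst_conv snd_conv N_def[symmetric], simp add: K_def algebra_simps)
qed

lemma space_deriv_probe1: "space_deriv i (probe1 b \<xi> m i) z = probe2 b \<xi> m i z"
  unfolding space_deriv_def
proof (rule frechet_derivative_line[OF smooth_alg_differentiable])
  \<comment> \<open>Smoothness needs no second look at the formula: \<open>probe1\<close> is a
    directional derivative of \<open>probe\<close>, and the algebra is closed under those.\<close>
  show "probe1 b \<xi> m i \<in> smooth_alg"
    using smooth_alg_frechet_derivative[OF probe_smooth_alg, of b \<xi> m "(0, axis i 1)"] space_deriv_probe[of i b \<xi> m]
    by (simp add: space_deriv_def[abs_def])
  obtain t x where z: "z = (t, x)" by (cases z)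
  define N where "N = real (Suc m)"
  define K where "K = time_cut b m t * cross m i x"
  have eq: "(\<lambda>s. probe1 b \<xi> m i (z + s *\<^sub>R (0, axis i 1))) =
    (\<lambda>s. K * (\<kappa>' (x $ i / N + s * (1 / N)) / N * cas (\<xi> \<bullet> x + s * (\<xi> $ i))
      + \<kappa> (x $ i / N + s * (1 / N)) * (\<xi> $ i * sac (\<xi> \<bullet> x + s * (\<xi> $ i)))))"
    unfolding probe1_def N_def[symmetric]
    by (simp only: z add_Pair scaleR_Pair fst_conv snd_conv cross_shift axis_line K_def) (simp add: mult.assoc)
  show "((\<lambda>s. probe1 b \<xi> m i (z + s *\<^sub>R (0, axis i 1))) has_real_derivative probe2 b \<xi> m i z) (at 0)"
    unfolding eq
    by (rule DERIV_cong[OF DERIV_cmult[OF DERIV_add[OF DERIV_mult[OF DERIV_cdivide[OF line_derivs(2)] line_derivs(3)]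
            DERIV_mult[OF line_derivs(1) DERIV_cmult[OF line_derivs(4)]]]]])
       (simp only: z probe2_def fst_conv snd_conv N_def[symmetric],
        simp add: K_def power2_eq_square algebra_simps add_divide_distrib)
qed

lemma space_laplacian_probe: "space_laplacian (probe b \<xi> m) z = (\<Sum>i\<in>UNIV. probe2 b \<xi> m i z)"
  unfolding space_laplacian_def
  by (simp add: space_deriv_probe[abs_def] space_deriv_probe1)

end

section \<open>Bounds and limits of the test functions\<close>

text \<open>
  The weak formulation is only exploited for such test functions: then the integrability of the weak
  integrand, needed to subtract the two weak equations, is immediate.
\<close>

definition tame :: "real \<Rightarrow> (real \<times> (real ^ 'n::finite) \<Rightarrow> real) \<Rightarrow> bool" where
  "tame T \<phi> \<longleftrightarrow> time_deriv \<phi> \<in> borel_measurable borel \<and> space_laplacian \<phi> \<in> borel_measurable borel \<and>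
    (\<forall>i. space_deriv i \<phi> \<in> borel_measurable borel) \<and>
    (\<exists>c. \<forall>z. fst z \<in> {0<..<T} \<longrightarrow> \<bar>time_deriv \<phi> z\<bar> \<le> c \<and> \<bar>space_laplacian \<phi> z\<bar> \<le> c \<and>
      (\<forall>i. \<bar>space_deriv i \<phi> z\<bar> \<le> c))"

context cutoff
begin

text \<open>As \<open>B\<close> is at least 1, the full power bounds products over every set of
  coordinates, hence also \<open>cross\<close>.\<close>

lemma abs_prod_cutoff_le:
  fixes J :: "'n::finite set"
  shows "\<bar>\<Prod>j\<in>J. \<kappa> (y j)\<bar> \<le> B ^ CARD('n)"
  unfolding abs_prod by (rule prod_le_power) (auto simp: bound B_ge_1 intro!: card_mono)

lemma abs_time_deriv_probe_le:
  fixes \<xi> :: "real ^ 'n::finite"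
  shows "\<bar>time_deriv (probe b \<xi> m) z\<bar> \<le> 4 * B ^ CARD('n)"
proof -
  have "\<bar>time_deriv (probe b \<xi> m) z\<bar> \<le> 2 * (B ^ CARD('n) * 2)"
    unfolding time_deriv_probe abs_mult
    by (intro mult_mono abs_time_cut_deriv_le abs_prod_cutoff_le abs_cas_le mult_nonneg_nonneg) (use B_ge_1 in auto)
  then show ?thesis by simp
qed

lemma abs_div_le: "\<bar>a\<bar> \<le> c \<Longrightarrow> \<bar>a / real (Suc m) ^ k\<bar> \<le> c"
proof -
  assume "\<bar>a\<bar> \<le> c"
  moreover have "\<bar>a\<bar> / real (Suc m) ^ k \<le> \<bar>a\<bar> / 1"
    by (intro divide_left_mono) (auto intro!: one_le_power)
  ultimately show ?thesis by (simp add: abs_divide)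
qed

lemma abs_sac_le: "\<bar>sac \<theta>\<bar> \<le> 2"
  unfolding sac_eq_cas by (rule abs_cas_le)

text \<open>The bound is uniform in m and x. Its growth in time is harmless, since it is only used
  for times in (0, T).\<close>

lemma abs_probe1_le:
  fixes \<xi> :: "real ^ 'n::finite"
  shows "\<bar>probe1 b \<xi> m i z\<bar> \<le> \<bar>b - fst z\<bar> * (B ^ CARD('n) * (B * 2 + B * (\<bar>\<xi> $ i\<bar> * 2)))"
proof -
  have "\<bar>\<kappa>' (snd z $ i / real (Suc m)) / real (Suc m)\<bar> \<le> B"
    using abs_div_le[OF bound(2), of _ m 1] by simp
  then have "\<bar>\<kappa>' (snd z $ i / real (Suc m)) / real (Suc m) * cas (\<xi> \<bullet> snd z)
      + \<kappa> (snd z $ i / real (Suc m)) * (\<xi> $ i * sac (\<xi> \<bullet> snd z))\<bar> \<le> B * 2 + B * (\<bar>\<xi> $ i\<bar> * 2)"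
    using B_ge_1 bound unfolding abs_mult[of "\<kappa>' _ / _"]
    by (intro order_trans[OF abs_triangle_ineq] add_mono) (auto simp only: abs_mult intro!: mult_mono abs_cas_le abs_sac_le mult_nonneg_nonneg abs_ge_zero)
  then show ?thesis
    unfolding probe1_def cross_def abs_mult[of "time_cut _ _ _"] abs_mult[of "prod _ _"] using B_ge_1
    by (intro mult_mono abs_time_cut_le abs_prod_cutoff_le) auto
qed

lemma abs_probe2_le:
  fixes \<xi> :: "real ^ 'n::finite"
  shows "\<bar>probe2 b \<xi> m i z\<bar> \<le> \<bar>b - fst z\<bar> * (B ^ CARD('n) * (B * 2 + 2 * B * (\<bar>\<xi> $ i\<bar> * 2) + B * ((\<xi> $ i)\<^sup>2 * 2)))"
proof -
  let ?p = "snd z $ i / real (Suc m)"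
  have 1: "\<bar>\<kappa>' ?p / real (Suc m)\<bar> \<le> B"
    using abs_div_le[OF bound(2), of _ m 1] by simp
  have "\<bar>\<kappa>'' ?p / (real (Suc m))\<^sup>2 * cas (\<xi> \<bullet> snd z)\<bar> \<le> B * 2"
    unfolding abs_mult using B_ge_1 by (intro mult_mono abs_div_le bound abs_cas_le) auto
  moreover have "\<bar>2 * (\<kappa>' ?p / real (Suc m)) * (\<xi> $ i * sac (\<xi> \<bullet> snd z))\<bar> \<le> 2 * B * (\<bar>\<xi> $ i\<bar> * 2)"
    unfolding abs_mult using B_ge_1 1 by (intro mult_mono abs_sac_le) auto
  moreover have "\<bar>\<kappa> ?p * ((\<xi> $ i)\<^sup>2 * cas (\<xi> \<bullet> snd z))\<bar> \<le> B * ((\<xi> $ i)\<^sup>2 * 2)"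
    unfolding abs_mult using B_ge_1 by (intro mult_mono bound abs_cas_le) auto
  ultimately have "\<bar>\<kappa>'' ?p / (real (Suc m))\<^sup>2 * cas (\<xi> \<bullet> snd z) + 2 * (\<kappa>' ?p / real (Suc m)) * (\<xi> $ i * sac (\<xi> \<bullet> snd z))
      - \<kappa> ?p * ((\<xi> $ i)\<^sup>2 * cas (\<xi> \<bullet> snd z))\<bar> \<le> B * 2 + 2 * B * (\<bar>\<xi> $ i\<bar> * 2) + B * ((\<xi> $ i)\<^sup>2 * 2)"
    by linarith
  then show ?thesis
    unfolding probe2_def cross_def abs_mult[of "time_cut _ _ _"] abs_mult[of "prod _ _"] using B_ge_1
    by (intro mult_mono abs_time_cut_le abs_prod_cutoff_le) auto
qed

lemma cutoff_tendsto: "(\<lambda>m. \<kappa> (a / real (Suc m))) \<longlonglongrightarrow> 1"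
proof -
  have "(\<lambda>m. a * (1 / real (Suc m))) \<longlonglongrightarrow> a * 0"
    by (intro tendsto_mult tendsto_const LIMSEQ_Suc[OF lim_1_over_n])
  then have "(\<lambda>m. \<kappa> (a / real (Suc m))) \<longlonglongrightarrow> \<kappa> 0"
    using isCont_tendsto_compose[OF DERIV_isCont[OF deriv(1)[of 0]]] by simp
  then show ?thesis by (simp add: at_0)
qed

lemma cross_tendsto: "(\<lambda>m. cross m i x) \<longlonglongrightarrow> 1"
  using tendsto_prod[of "UNIV - {i}" "\<lambda>j m. \<kappa> (x $ j / real (Suc m))" "\<lambda>_. 1" sequentially] cutoff_tendsto
  unfolding cross_def by simp

lemma bounded_div_tendsto:
  assumes "\<And>m. \<bar>f m\<bar> \<le> B" and "k > 0"
  shows "(\<lambda>m. f m / real (Suc m) ^ k) \<longlonglongrightarrow> 0"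
proof (rule Lim_null_comparison)
  show "\<forall>\<^sub>F m in sequentially. norm (f m / real (Suc m) ^ k) \<le> B * (1 / real (Suc m)) ^ k"
    using assms(1) by (intro always_eventually allI) (auto simp: abs_divide power_divide divide_right_mono simp del: of_nat_Suc)
  have "(\<lambda>m. B * (1 / real (Suc m)) ^ k) \<longlonglongrightarrow> B * 0 ^ k"
    by (intro tendsto_intros LIMSEQ_Suc[OF lim_1_over_n])
  then show "(\<lambda>m. B * (1 / real (Suc m)) ^ k) \<longlonglongrightarrow> 0" using assms(2) by (simp add: power_0_left)
qed

lemma time_deriv_probe_tendsto:
  fixes \<xi> :: "real ^ 'n::finite"
  shows "(\<lambda>m. time_deriv (probe b \<xi> m) z) \<longlonglongrightarrow> - indicator {..<b} (fst z) * cas (\<xi> \<bullet> snd z)"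
proof -
  have "(\<lambda>m. \<Prod>j\<in>UNIV. \<kappa> (snd z $ j / real (Suc m))) \<longlonglongrightarrow> (\<Prod>j\<in>(UNIV::'n set). 1)"
    by (intro tendsto_prod cutoff_tendsto)
  then have "(\<lambda>m. time_deriv (probe b \<xi> m) z) \<longlonglongrightarrow> - indicator {..<b} (fst z) * ((\<Prod>j\<in>(UNIV::'n set). 1) * cas (\<xi> \<bullet> snd z))"
    unfolding time_deriv_probe by (intro tendsto_mult time_cut_deriv_tendsto tendsto_const)
  then show ?thesis by simp
qed

lemma probe1_tendsto:
  "(\<lambda>m. probe1 b \<xi> m i z) \<longlonglongrightarrow> max 0 (b - fst z) * (\<xi> $ i * sac (\<xi> \<bullet> snd z))"
proof -
  have "(\<lambda>m. \<kappa>' (snd z $ i / real (Suc m)) / real (Suc m) ^ 1) \<longlonglongrightarrow> 0"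
    by (rule bounded_div_tendsto) (auto simp: bound)
  then have "(\<lambda>m. probe1 b \<xi> m i z) \<longlonglongrightarrow> max 0 (b - fst z) * (1 * (0 * cas (\<xi> \<bullet> snd z) + 1 * (\<xi> $ i * sac (\<xi> \<bullet> snd z))))"
    unfolding probe1_def power_one_right
    by (intro tendsto_mult tendsto_add time_cut_tendsto cross_tendsto cutoff_tendsto tendsto_const)
  then show ?thesis by simp
qed

lemma probe2_tendsto:
  "(\<lambda>m. probe2 b \<xi> m i z) \<longlonglongrightarrow> max 0 (b - fst z) * (- ((\<xi> $ i)\<^sup>2 * cas (\<xi> \<bullet> snd z)))"
proof -
  have "(\<lambda>m. \<kappa>' (snd z $ i / real (Suc m)) / real (Suc m) ^ 1) \<longlonglongrightarrow> 0"
    "(\<lambda>m. \<kappa>'' (snd z $ i / real (Suc m)) / (real (Suc m))\<^sup>2) \<longlonglongrightarrow> 0"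
    using bounded_div_tendsto[of "\<lambda>m. \<kappa>' (snd z $ i / real (Suc m))" 1]
      bounded_div_tendsto[of "\<lambda>m. \<kappa>'' (snd z $ i / real (Suc m))" 2] bound by auto
  then have "(\<lambda>m. probe2 b \<xi> m i z) \<longlonglongrightarrow> max 0 (b - fst z) * (1 * (0 * cas (\<xi> \<bullet> snd z) +
      2 * 0 * (\<xi> $ i * sac (\<xi> \<bullet> snd z)) - 1 * ((\<xi> $ i)\<^sup>2 * cas (\<xi> \<bullet> snd z))))"
    unfolding probe2_def power_one_right
    by (intro tendsto_mult tendsto_add tendsto_diff time_cut_tendsto cross_tendsto cutoff_tendsto tendsto_const)
  then show ?thesis by simp
qed

lemma probe_measurable:
  fixes \<xi> :: "real ^ 'n::finite"
  shows "(\<lambda>z. time_deriv (probe b \<xi> m) z) \<in> borel_measurable borel"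
    "probe1 b \<xi> m i \<in> borel_measurable borel" "probe2 b \<xi> m i \<in> borel_measurable borel"
proof -
  have d: "(\<lambda>z. frechet_derivative f (at z) v) \<in> borel_measurable borel" if "f \<in> smooth_alg" for f :: "real \<times> (real ^ 'n) \<Rightarrow> real" and v
    by (intro borel_measurable_continuous_onI smooth_alg_continuous_on smooth_alg_frechet_derivative that)
  show "(\<lambda>z. time_deriv (probe b \<xi> m) z) \<in> borel_measurable borel"
    unfolding time_deriv_def by (intro d probe_smooth_alg)
  have eq: "probe1 b \<xi> m i = (\<lambda>z. frechet_derivative (probe b \<xi> m) (at z) (0, axis i 1))"
    using space_deriv_probe[of i b \<xi> m] by (auto simp: space_deriv_def)
  show "probe1 b \<xi> m i \<in> borel_measurable borel" unfolding eq by (intro d probe_smooth_alg)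
  have "probe1 b \<xi> m i \<in> smooth_alg" unfolding eq by (intro smooth_alg_frechet_derivative probe_smooth_alg)
  moreover have "probe2 b \<xi> m i = (\<lambda>z. frechet_derivative (probe1 b \<xi> m i) (at z) (0, axis i 1))"
    using space_deriv_probe1[of i b \<xi> m] by (auto simp: space_deriv_def)
  ultimately show "probe2 b \<xi> m i \<in> borel_measurable borel"
    using d by simp
qed

text \<open>Dominated convergence along the probes extends the weak equation to the test function
  max 0 (b - t) \<open>cas\<close> (\<xi> . x).\<close>

lemma weak_form_limit:
  fixes f0 f1 :: "real \<times> (real ^ 'n::finite) \<Rightarrow> real" and g :: "'n \<Rightarrow> real \<times> (real ^ 'n) \<Rightarrow> real" and \<xi> :: "real ^ 'n"
  assumes int: "integrable lborel f0" "integrable lborel f1" "\<And>i. integrable lborel (g i)"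
    and supp: "\<And>z. fst z \<notin> {0<..<T} \<Longrightarrow> f1 z = 0" "\<And>z i. fst z \<notin> {0<..<T} \<Longrightarrow> g i z = 0"
    and weak: "\<And>\<phi>. \<phi> \<in> test_functions T \<Longrightarrow> tame T \<phi> \<Longrightarrow>
      (LINT z|lborel. time_deriv \<phi> z * f0 z + space_laplacian \<phi> z * f1 z + (\<Sum>i\<in>UNIV. space_deriv i \<phi> z * g i z)) = 0"
    and b: "0 < b" "b < T"
  shows "(LINT z|lborel. - indicator {..<b} (fst z) * cas (\<xi> \<bullet> snd z) * f0 z
    + (\<Sum>i\<in>UNIV. max 0 (b - fst z) * (- ((\<xi> $ i)\<^sup>2 * cas (\<xi> \<bullet> snd z)))) * f1 z
    + (\<Sum>i\<in>UNIV. max 0 (b - fst z) * (\<xi> $ i * sac (\<xi> \<bullet> snd z)) * g i z)) = 0"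
proof -
  define C1 where "C1 i = T * (B ^ CARD('n) * (B * 2 + B * (\<bar>\<xi> $ i\<bar> * 2)))" for i
  define C2 where "C2 i = T * (B ^ CARD('n) * (B * 2 + 2 * B * (\<bar>\<xi> $ i\<bar> * 2) + B * ((\<xi> $ i)\<^sup>2 * 2)))" for i
  have [measurable]: "f0 \<in> borel_measurable borel" "f1 \<in> borel_measurable borel" "\<And>i. g i \<in> borel_measurable borel"
    using int by (auto dest: borel_measurable_integrable)
  note probe_measurable[measurable]
  let ?F = "\<lambda>m z. time_deriv (probe b \<xi> m) z * f0 z + (\<Sum>i\<in>UNIV. probe2 b \<xi> m i z) * f1 z
    + (\<Sum>i\<in>UNIV. probe1 b \<xi> m i z * g i z)"
  let ?L = "\<lambda>z. - indicator {..<b} (fst z) * cas (\<xi> \<bullet> snd z) * f0 z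
    + (\<Sum>i\<in>UNIV. max 0 (b - fst z) * (- ((\<xi> $ i)\<^sup>2 * cas (\<xi> \<bullet> snd z)))) * f1 z
    + (\<Sum>i\<in>UNIV. max 0 (b - fst z) * (\<xi> $ i * sac (\<xi> \<bullet> snd z)) * g i z)"
  \<comment> \<open>The coefficient of \<open>f0\<close> is valid at all times, because the time
    derivative of a probe is bounded everywhere. Those of \<open>f1\<close> and \<open>g\<close>
    hold for times in (0, T) only, outside of which these functions vanish.\<close>
  let ?w = "\<lambda>z. 4 * B ^ CARD('n) * \<bar>f0 z\<bar> + (\<Sum>i\<in>UNIV. C2 i) * \<bar>f1 z\<bar> + (\<Sum>i\<in>UNIV. C1 i * \<bar>g i z\<bar>)"
  have lim: "(\<lambda>m. ?F m z) \<longlonglongrightarrow> ?L z" for z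
    by (intro tendsto_add tendsto_sum tendsto_mult time_deriv_probe_tendsto probe1_tendsto probe2_tendsto tendsto_const)
  have T_pos: "T > 0" using b by simp
  have c: "\<bar>b - t\<bar> \<le> T" if "t \<in> {0<..<T}" for t using that b by (auto simp: abs_le_iff)
  have b1: "\<bar>probe1 b \<xi> m i z\<bar> \<le> C1 i" if "fst z \<in> {0<..<T}" for m i z
    unfolding C1_def
    by (rule order_trans[OF abs_probe1_le]) (use c[OF that] B_ge_1 in \<open>auto intro!: mult_right_mono add_nonneg_nonneg mult_nonneg_nonneg\<close>)
  have b2: "\<bar>probe2 b \<xi> m i z\<bar> \<le> C2 i" if "fst z \<in> {0<..<T}" for m i z
    unfolding C2_def
    by (rule order_trans[OF abs_probe2_le]) (use c[OF that] B_ge_1 in \<open>auto intro!: mult_right_mono add_nonneg_nonneg mult_nonneg_nonneg\<close>)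
  have tame: "tame T (probe b \<xi> m)" for m
  proof -
    let ?c = "max (4 * B ^ CARD('n)) (max (\<Sum>i\<in>UNIV. C2 i) (\<Sum>i\<in>UNIV. C1 i))"
    have C1_nonneg: "0 \<le> C1 i" for i
      using T_pos B_ge_1 unfolding C1_def by (intro mult_nonneg_nonneg add_nonneg_nonneg) auto
    have "\<bar>time_deriv (probe b \<xi> m) z\<bar> \<le> ?c \<and> \<bar>space_laplacian (probe b \<xi> m) z\<bar> \<le> ?c \<and>
        (\<forall>i. \<bar>space_deriv i (probe b \<xi> m) z\<bar> \<le> ?c)" if z: "fst z \<in> {0<..<T}" for z
    proof (intro conjI allI)
      show "\<bar>time_deriv (probe b \<xi> m) z\<bar> \<le> ?c"
        using abs_time_deriv_probe_le[of b \<xi> m z] by linarith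
      have "\<bar>space_laplacian (probe b \<xi> m) z\<bar> \<le> (\<Sum>i\<in>UNIV. C2 i)"
        unfolding space_laplacian_probe by (intro order_trans[OF sum_abs] sum_mono b2 z)
      then show "\<bar>space_laplacian (probe b \<xi> m) z\<bar> \<le> ?c" by linarith
      fix i
      have "C1 i \<le> (\<Sum>i\<in>UNIV. C1 i)" by (rule member_le_sum) (auto simp: C1_nonneg)
      then show "\<bar>space_deriv i (probe b \<xi> m) z\<bar> \<le> ?c"
        using b1[OF z, of m i] unfolding space_deriv_probe by linarith
    qed
    then have "\<exists>c. \<forall>z. fst z \<in> {0<..<T} \<longrightarrow> \<bar>time_deriv (probe b \<xi> m) z\<bar> \<le> c \<and>
        \<bar>space_laplacian (probe b \<xi> m) z\<bar> \<le> c \<and> (\<forall>i. \<bar>space_deriv i (probe b \<xi> m) z\<bar> \<le> c)"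
      by (intro exI[of _ ?c]) blast
    moreover have "time_deriv (probe b \<xi> m) \<in> borel_measurable borel"
      "space_laplacian (probe b \<xi> m) \<in> borel_measurable borel" "space_deriv i (probe b \<xi> m) \<in> borel_measurable borel" for i
      using probe_measurable[of b \<xi> m] by (simp_all add: space_laplacian_probe[abs_def] space_deriv_probe[abs_def])
    ultimately show ?thesis unfolding tame_def by blast
  qed
  have bd: "norm (?F m z) \<le> ?w z" for m z
  proof -
    have "\<bar>time_deriv (probe b \<xi> m) z * f0 z\<bar> \<le> 4 * B ^ CARD('n) * \<bar>f0 z\<bar>"
      unfolding abs_mult by (intro mult_right_mono abs_time_deriv_probe_le) simp
    moreover have "\<bar>(\<Sum>i\<in>UNIV. probe2 b \<xi> m i z) * f1 z\<bar> \<le> (\<Sum>i\<in>UNIV. C2 i) * \<bar>f1 z\<bar>"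
    proof (cases "fst z \<in> {0<..<T}")
      case True
      then have "\<bar>\<Sum>i\<in>UNIV. probe2 b \<xi> m i z\<bar> \<le> (\<Sum>i\<in>UNIV. C2 i)"
        by (intro order_trans[OF sum_abs] sum_mono b2)
      then show ?thesis unfolding abs_mult by (intro mult_right_mono) auto
    qed (simp add: supp)
    moreover have "\<bar>\<Sum>i\<in>UNIV. probe1 b \<xi> m i z * g i z\<bar> \<le> (\<Sum>i\<in>UNIV. C1 i * \<bar>g i z\<bar>)"
    proof (cases "fst z \<in> {0<..<T}")
      case True
      then show ?thesis
        by (intro order_trans[OF sum_abs] sum_mono) (auto simp only: abs_mult intro!: mult_right_mono b1)
    qed (simp add: supp)
    ultimately show ?thesis unfolding real_norm_def by linarith
  qed
  have "(\<lambda>m. LINT z|lborel. ?F m z) \<longlonglongrightarrow> (LINT z|lborel. ?L z)"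
  proof (rule integral_dominated_convergence[where w="?w"])
    show "integrable lborel ?w"
      by (intro Bochner_Integration.integrable_add Bochner_Integration.integrable_sum integrable_mult_right integrable_abs int)
    show "AE z in lborel. (\<lambda>m. ?F m z) \<longlonglongrightarrow> ?L z" using lim by (intro AE_I2)
    show "AE z in lborel. norm (?F m z) \<le> ?w z" for m using bd by (intro AE_I2)
    show "?F m \<in> borel_measurable lborel" for m by measurable
    have [measurable]: "sac \<in> borel_measurable borel" unfolding sac_def[abs_def] by measurable
    have [measurable]: "fst \<in> borel_measurable (borel :: (real \<times> (real ^ 'n)) measure)"
      "snd \<in> borel_measurable (borel :: (real \<times> (real ^ 'n)) measure)"
      by (intro borel_measurable_continuous_onI continuous_intros)+
    show "?L \<in> borel_measurable lborel" by measurable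
  qed
  moreover have "(LINT z|lborel. ?F m z) = 0" for m
    using weak[OF probe_test_function[OF b(2)] tame[of m]] by (simp add: space_laplacian_probe space_deriv_probe)
  ultimately show ?thesis by (simp add: LIMSEQ_const_iff)
qed

end

section \<open>Functions of time\<close>

lemma indicator_lessThan_measurable [measurable (raw)]:
  fixes f g :: "'a \<Rightarrow> real"
  assumes [measurable]: "f \<in> borel_measurable M" "g \<in> borel_measurable M"
  shows "(\<lambda>x. indicator {..<f x} (g x) :: real) \<in> borel_measurable M"
proof -
  have "(\<lambda>x. indicator {..<f x} (g x) :: real) = (\<lambda>x. if g x < f x then 1 else 0)"
    by (auto simp: indicator_def)
  then show ?thesis by simp
qed

text \<open>The positive and the negative part of \<open>q\<close> are densities of finite measures
  that agree on all half-lines, hence of the same measure; densities are unique almost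
  everywhere.\<close>

lemma AE_zero_if_integral_greaterThan_zero:
  fixes q :: "real \<Rightarrow> real"
  assumes q: "integrable lborel q" and z: "\<And>x. (LINT s|lborel. indicator {x<..} s * q s) = 0"
  shows "AE s in lborel. q s = 0"
proof -
  have [measurable]: "q \<in> borel_measurable borel" using q by (auto dest: borel_measurable_integrable)
  let ?P = "density lborel (\<lambda>s. ennreal (max 0 (q s)))"
  let ?N = "density lborel (\<lambda>s. ennreal (max 0 (- q s)))"
  have i: "integrable lborel (\<lambda>s. indicator {x<..} s * max 0 (r s))" if r: "integrable lborel r" for x and r :: "real \<Rightarrow> real"
  proof (rule Bochner_Integration.integrable_bound[OF r])
    have [measurable]: "r \<in> borel_measurable borel" using r by (auto dest: borel_measurable_integrable)
    show "(\<lambda>s. indicator {x<..} s * max 0 (r s)) \<in> borel_measurable lborel" by measurable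
  qed (auto simp: indicator_def)
  have em: "emeasure (density lborel (\<lambda>s. ennreal (max 0 (r s)))) {x<..} = ennreal (LINT s|lborel. indicator {x<..} s * max 0 (r s))"
    if r: "integrable lborel r" for x and r :: "real \<Rightarrow> real"
  proof -
    have [measurable]: "r \<in> borel_measurable borel" using r by (auto dest: borel_measurable_integrable)
    have "emeasure (density lborel (\<lambda>s. ennreal (max 0 (r s)))) {x<..} = (\<integral>\<^sup>+s. ennreal (indicator {x<..} s * max 0 (r s)) \<partial>lborel)"
      by (subst emeasure_density) (auto intro!: nn_integral_cong simp: indicator_def)
    also have "\<dots> = ennreal (LINT s|lborel. indicator {x<..} s * max 0 (r s))"
      by (rule nn_integral_eq_integral[OF i[OF r]]) (auto simp: indicator_def)
    finally show ?thesis .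
  qed
  have "?P = ?N"
  proof (rule measure_eqI_lessThan)
    fix x
    have "(LINT s|lborel. indicator {x<..} s * q s) =
        (LINT s|lborel. indicator {x<..} s * max 0 (q s) - indicator {x<..} s * max 0 (- q s))"
      by (intro Bochner_Integration.integral_cong) (auto simp: indicator_def)
    also have "\<dots> = (LINT s|lborel. indicator {x<..} s * max 0 (q s)) - (LINT s|lborel. indicator {x<..} s * max 0 (- q s))"
      by (intro Bochner_Integration.integral_diff i q Bochner_Integration.integrable_minus)
    finally show "emeasure ?P {x<..} = emeasure ?N {x<..}"
      using z[of x] em[OF q] em[OF Bochner_Integration.integrable_minus[OF q]] by simp
    show "emeasure ?P {x<..} < \<infinity>" unfolding em[OF q] by simp
  qed auto
  then have "AE s in lborel. ennreal (max 0 (q s)) = ennreal (max 0 (- q s))"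
    by (intro sigma_finite_measure.density_unique[OF sigma_finite_lborel]) auto
  then show ?thesis by eventually_elim (auto simp: max_def split: if_splits)
qed

text \<open>Letting b tend to T shows that the total integral is zero as well; half-lines on the
  other side are then complements.\<close>

lemma AE_zero_if_integral_lessThan_zero:
  fixes q :: "real \<Rightarrow> real"
  assumes q: "integrable lborel q" and supp: "\<And>s. s \<notin> {0<..<T} \<Longrightarrow> q s = 0" and T: "T > 0"
    and z: "\<And>b. 0 < b \<Longrightarrow> b < T \<Longrightarrow> (LINT s|lborel. indicator {..<b} s * q s) = 0"
  shows "AE s in lborel. q s = 0"
proof (rule AE_zero_if_integral_greaterThan_zero[OF q])
  have [measurable]: "q \<in> borel_measurable borel" using q by (auto dest: borel_measurable_integrable)
  \<comment> \<open>The shift by two makes \<open>b 0\<close> equal to T/2; a shift by one would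
    give 0, which is not admissible.\<close>
  define b where "b n = T * (1 - 1 / real (Suc (Suc n)))" for n
  have b: "0 < b n" "b n < T" for n using T by (auto simp: b_def field_simps add_pos_nonneg)
  have "b \<longlonglongrightarrow> T * (1 - 0)"
    unfolding b_def by (intro tendsto_intros LIMSEQ_Suc[OF LIMSEQ_Suc[OF lim_1_over_n]])
  then have blim: "b \<longlonglongrightarrow> T" by simp
  have "(\<lambda>n. LINT s|lborel. indicator {..<b n} s * q s) \<longlonglongrightarrow> (LINT s|lborel. q s)"
  proof (rule integral_dominated_convergence[where w="\<lambda>s. \<bar>q s\<bar>"])
    show "AE s in lborel. (\<lambda>n. indicator {..<b n} s * q s) \<longlonglongrightarrow> q s"
    proof (rule AE_I2)
      fix s
      show "(\<lambda>n. indicator {..<b n} s * q s) \<longlonglongrightarrow> q s"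
      proof (cases "s \<in> {0<..<T}")
        case True
        then have "\<forall>\<^sub>F n in sequentially. s < b n" using order_tendstoD(1)[OF blim, of s] by simp
        then have "\<forall>\<^sub>F n in sequentially. indicator {..<b n} s * q s = q s"
          by eventually_elim simp
        then show ?thesis by (rule tendsto_eventually)
      qed (simp add: supp)
    qed
  qed (use q in \<open>auto simp: indicator_def\<close>)
  then have tot: "(LINT s|lborel. q s) = 0" using z[OF b] by (simp add: LIMSEQ_const_iff)
  have all: "(LINT s|lborel. indicator {..<x} s * q s) = 0" for x
  proof -
    consider "x \<le> 0" | "0 < x" "x < T" | "T \<le> x" by linarith
    then show ?thesis
    proof cases
      case 1
      then have "indicator {..<x} s * q s = 0" for s using supp[of s] by (auto simp: indicator_def)
      then show ?thesis by (simp only: Bochner_Integration.integral_zero)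
    next
      case 3
      then have "indicator {..<x} s * q s = q s" for s using supp[of s] by (auto simp: indicator_def)
      then show ?thesis by (simp only: tot)
    qed (use z in auto)
  qed
  fix x
  have "(LINT s|lborel. indicator {x<..} s * q s) = (LINT s|lborel. q s - indicator {..<x} s * q s)"
    by (rule integral_cong_AE) (use AE_lborel_singleton[of x] in \<open>auto simp: indicator_def elim!: eventually_mono\<close>)
  also have "\<dots> = (LINT s|lborel. q s) - (LINT s|lborel. indicator {..<x} s * q s)"
    by (intro Bochner_Integration.integral_diff q Bochner_Integration.integrable_bound[OF q]) (auto simp: indicator_def)
  also have "\<dots> = 0" using tot all[of x] by simp
  finally show "(LINT s|lborel. indicator {x<..} s * q s) = 0" .
qed

text \<open>
  The chain rule for the square of a primitive, obtained from the symmetry of the square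
  \<open>{..<t} \<times> {..<t}\<close> instead of absolute continuity.
\<close>

lemma integral_lessThan_square:
  fixes G :: "real \<Rightarrow> real"
  assumes G: "integrable lborel G"
  shows "(LINT s|lborel. indicator {..<t} s * G s)\<^sup>2 =
    2 * (LINT s|lborel. indicator {..<t} s * (G s * (LINT r|lborel. indicator {..<s} r * G r)))"
proof -
  have [measurable]: "G \<in> borel_measurable borel" using G by (auto dest: borel_measurable_integrable)
  let ?G = "\<lambda>s. indicator {..<t} s * G s"
  have G': "integrable lborel ?G"
    by (rule Bochner_Integration.integrable_bound[OF G]) (auto simp: indicator_def)
  \<comment> \<open>\<open>A\<close> and \<open>A'\<close> restrict G s * G r to the triangles r < s
    and s < r of the square. The diagonal is a null set, and exchanging the variables maps one
    triangle to the other.\<close>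
  define A where "A s r = ?G s * (indicator {..<s} r * G r)" for s r
  define A' where "A' s r = ?G r * (indicator {..<r} s * G s)" for s r
  have iA: "integrable (lborel \<Otimes>\<^sub>M lborel) (case_prod A)"
    unfolding A_def[abs_def]
    by (rule lborel_pair.integrable_pair_bound[OF G G]) (measurable, auto simp: indicator_def abs_mult)
  have iA': "integrable (lborel \<Otimes>\<^sub>M lborel) (case_prod A')"
    unfolding A'_def[abs_def]
    by (rule lborel_pair.integrable_pair_bound[OF G G]) (measurable, auto simp: indicator_def abs_mult)
  have AA: "(LINT s|lborel. LINT r|lborel. A' s r) = (LINT s|lborel. LINT r|lborel. A s r)"
    using lborel_pair.Fubini_integral[OF iA'] by (simp add: A_def A'_def)
  have "(LINT s|lborel. ?G s)\<^sup>2 = (LINT s|lborel. LINT r|lborel. ?G s * ?G r)"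
    by (simp add: power2_eq_square)
  also have "\<dots> = (LINT s|lborel. LINT r|lborel. A s r + A' s r)"
  proof (rule Bochner_Integration.integral_cong[OF refl])
    fix s
    show "(LINT r|lborel. ?G s * ?G r) = (LINT r|lborel. A s r + A' s r)"
    proof (rule integral_cong_AE)
      show "AE r in lborel. ?G s * ?G r = A s r + A' s r"
        using AE_lborel_singleton[of s] by eventually_elim (auto simp: A_def A'_def indicator_def)
      have [measurable]: "(\<lambda>r. A s r) \<in> borel_measurable borel" "(\<lambda>r. A' s r) \<in> borel_measurable borel"
        unfolding A_def A'_def by measurable
      show "(\<lambda>r. ?G s * ?G r) \<in> borel_measurable lborel" "(\<lambda>r. A s r + A' s r) \<in> borel_measurable lborel"
        by measurable
    qed
  qed
  also have "\<dots> = (LINT z|(lborel \<Otimes>\<^sub>M lborel). case_prod A z + case_prod A' z)"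
    using lborel_pair.integral_fst'[OF Bochner_Integration.integrable_add[OF iA iA']] by (simp add: case_prod_beta)
  also have "\<dots> = (LINT z|(lborel \<Otimes>\<^sub>M lborel). case_prod A z) + (LINT z|(lborel \<Otimes>\<^sub>M lborel). case_prod A' z)"
    by (rule Bochner_Integration.integral_add[OF iA iA'])
  also have "\<dots> = 2 * (LINT s|lborel. LINT r|lborel. A s r)"
    using lborel_pair.integral_fst'[OF iA] lborel_pair.integral_fst'[OF iA'] AA by simp
  also have "(LINT s|lborel. LINT r|lborel. A s r) =
      (LINT s|lborel. indicator {..<t} s * (G s * (LINT r|lborel. indicator {..<s} r * G r)))"
    unfolding A_def by (simp add: mult.assoc)
  finally show ?thesis .
qed

lemma
  fixes l s :: real
  assumes l: "l > 0"
  shows integrable_exp_tail: "integrable lborel (\<lambda>t. indicator {s..} t * exp (- l * t))"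
    and integral_exp_tail: "(LINT t|lborel. indicator {s..} t * exp (- l * t)) = exp (- l * s) / l"
proof -
  have "(\<integral>\<^sup>+t. ennreal (exp (- l * t)) * indicator {s..} t \<partial>lborel) = ennreal (0 - (- exp (- l * s) / l))"
  proof (rule nn_integral_FTC_atLeast)
    show "((\<lambda>t. - exp (- l * t) / l) has_real_derivative exp (- l * t)) (at t)" for t
      using l by (auto intro!: derivative_eq_intros)
    show "((\<lambda>t. - exp (- l * t) / l) \<longlongrightarrow> 0) at_top"
      using l by real_asymp
  qed auto
  moreover have "(\<integral>\<^sup>+t. ennreal (exp (- l * t)) * indicator {s..} t \<partial>lborel) =
      (\<integral>\<^sup>+t. ennreal (indicator {s..} t * exp (- l * t)) \<partial>lborel)"
    by (intro nn_integral_cong) (auto simp: indicator_def)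
  ultimately have nn: "(\<integral>\<^sup>+t. ennreal (indicator {s..} t * exp (- l * t)) \<partial>lborel) = ennreal (exp (- l * s) / l)"
    by simp
  show "integrable lborel (\<lambda>t. indicator {s..} t * exp (- l * t))"
  proof (rule integrableI_nonneg)
    show "(\<integral>\<^sup>+t. ennreal (indicator {s..} t * exp (- l * t)) \<partial>lborel) < \<infinity>"
      unfolding nn by simp
  qed auto
  show "(LINT t|lborel. indicator {s..} t * exp (- l * t)) = exp (- l * s) / l"
  proof (subst integral_eq_nn_integral)
    show "enn2real (\<integral>\<^sup>+t. ennreal (indicator {s..} t * exp (- l * t)) \<partial>lborel) = exp (- l * s) / l"
      unfolding nn using l by simp
  qed auto
qed

text \<open>Integrating the inequality against \<open>exp (- 2 C t)\<close> bounds a nonnegative number by half of itself.\<close>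

lemma gronwall_AE_zero:
  fixes e :: "real \<Rightarrow> real"
  assumes e: "integrable lborel e" and nonneg: "\<And>t. e t \<ge> 0" and supp: "\<And>t. t \<le> 0 \<Longrightarrow> e t = 0"
    and C: "C > 0" and le: "AE t in lborel. e t \<le> C * (LINT s|lborel. indicator {..<t} s * e s)"
  shows "AE t in lborel. e t = 0"
proof -
  have [measurable]: "e \<in> borel_measurable borel" using e by (auto dest: borel_measurable_integrable)
  define l where "l = 2 * C"
  have l: "l > 0" using C by (simp add: l_def)
  let ?p = "\<lambda>t. indicator {0..} t * exp (- l * t)"
  have p: "integrable lborel ?p" by (rule integrable_exp_tail[OF l])
  have p1: "0 \<le> ?p t" "?p t \<le> 1" for t using l by (auto simp: indicator_def)
  have pe: "integrable lborel (\<lambda>t. ?p t * e t)"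
  proof (rule Bochner_Integration.integrable_bound[OF e])
    show "AE t in lborel. norm (?p t * e t) \<le> norm (e t)"
      using p1 nonneg by (intro AE_I2) (simp add: abs_mult mult_left_le_one_le)
  qed simp
  have iP: "integrable (lborel \<Otimes>\<^sub>M lborel) (\<lambda>(t, s). ?p t * (indicator {..<t} s * e s))"
    by (rule lborel_pair.integrable_pair_bound[OF p e]) (auto simp: indicator_def abs_mult)
  have "(LINT t|lborel. ?p t * e t) \<le> (LINT t|lborel. C * (LINT s|lborel. ?p t * (indicator {..<t} s * e s)))"
  proof (rule integral_mono_AE[OF pe])
    show "integrable lborel (\<lambda>t. C * (LINT s|lborel. ?p t * (indicator {..<t} s * e s)))"
      using lborel_pair.integrable_fst'[OF iP] by (intro integrable_mult_right) simp
    show "AE t in lborel. ?p t * e t \<le> C * (LINT s|lborel. ?p t * (indicator {..<t} s * e s))"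
      using le
    proof eventually_elim
      case (elim t)
      from mult_left_mono[OF this p1(1)[of t]] show ?case
        unfolding integral_mult_right_zero by (simp only: mult.left_commute[of C])
    qed
  qed
  also have "\<dots> = C * (LINT s|lborel. LINT t|lborel. ?p t * (indicator {..<t} s * e s))"
    using lborel_pair.Fubini_integral[OF iP] by simp
  \<comment> \<open>For fixed s the exponential is integrated over t > s and reproduces itself
    divided by \<open>l\<close>, that is by 2 C; together with the factor C this leaves one
    half.\<close>
  also have "(LINT s|lborel. LINT t|lborel. ?p t * (indicator {..<t} s * e s)) = (LINT s|lborel. (?p s * e s) / l)"
  proof (intro Bochner_Integration.integral_cong refl)
    fix s
    show "(LINT t|lborel. ?p t * (indicator {..<t} s * e s)) = (?p s * e s) / l"
    proof (cases "s \<le> 0")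
      case False
      have "(LINT t|lborel. ?p t * (indicator {..<t} s * e s)) = (LINT t|lborel. e s * (indicator {s..} t * exp (- l * t)))"
      proof (rule integral_cong_AE)
        show "AE t in lborel. ?p t * (indicator {..<t} s * e s) = e s * (indicator {s..} t * exp (- l * t))"
          using AE_lborel_singleton[of s] by eventually_elim (use False in \<open>auto simp: indicator_def\<close>)
      qed measurable
      also have "\<dots> = e s * (exp (- l * s) / l)"
        by (simp only: integral_mult_right_zero integral_exp_tail[OF l])
      finally show ?thesis using False by simp
    qed (simp add: supp)
  qed
  finally have "(LINT t|lborel. ?p t * e t) \<le> 0"
    using C by (simp add: l_def)
  moreover have "0 \<le> (LINT t|lborel. ?p t * e t)" using p1 nonneg by (intro integral_nonneg_AE AE_I2) simp
  ultimately have "(LINT t|lborel. ?p t * e t) = 0" by simp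
  then have "AE t in lborel. ?p t * e t = 0"
    using integral_nonneg_eq_0_iff_AE[OF pe] p1 nonneg by simp
  then show ?thesis
    by eventually_elim (use supp in \<open>auto simp: indicator_def split: if_splits\<close>)
qed

section \<open>The energy argument\<close>

text \<open>
  Here \<open>f0\<close> is the difference of the two solutions, \<open>f1\<close> is \<open>\<beta>(u)/u\<close> times \<open>f0\<close>, and \<open>g\<close> lists the
  components of \<open>b(u) D\<close> times \<open>f0\<close>, all extended by zero in time.
\<close>

locale parabolic_pair =
  fixes f0 f1 :: "real \<times> (real ^ 'n::finite) \<Rightarrow> real" and g :: "'n \<Rightarrow> real \<times> (real ^ 'n) \<Rightarrow> real"
    and T M C :: real
  assumes int: "integrable lborel f0" "integrable lborel f1" "\<And>i. integrable lborel (g i)"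
    and int2: "integrable lborel (\<lambda>z. (f0 z)\<^sup>2)" "integrable lborel (\<lambda>z. (f1 z)\<^sup>2)"
      "\<And>i. integrable lborel (\<lambda>z. (g i z)\<^sup>2)"
    and vanish: "\<And>z. fst z \<notin> {0<..<T} \<Longrightarrow> f0 z = 0" "\<And>z. fst z \<notin> {0<..<T} \<Longrightarrow> f1 z = 0"
      "\<And>z i. fst z \<notin> {0<..<T} \<Longrightarrow> g i z = 0"
    and T: "T > 0" and M: "M > 0" and C: "C \<ge> 0"
    and f1_le: "AE z in lborel. (f1 z)\<^sup>2 \<le> M * (f0 z * f1 z)"
    and g_le: "\<And>i. AE z in lborel. (g i z)\<^sup>2 \<le> C * (f1 z)\<^sup>2"
    and weak: "\<And>\<phi>. \<phi> \<in> test_functions T \<Longrightarrow> tame T \<phi> \<Longrightarrow>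
      (LINT z|lborel. time_deriv \<phi> z * f0 z + space_laplacian \<phi> z * f1 z + (\<Sum>i\<in>UNIV. space_deriv i \<phi> z * g i z)) = 0"
begin

lemma meas:
  shows "f0 \<in> borel_measurable (borel \<Otimes>\<^sub>M borel)" "f1 \<in> borel_measurable (borel \<Otimes>\<^sub>M borel)"
    "g i \<in> borel_measurable (borel \<Otimes>\<^sub>M borel)"
  using int unfolding borel_prod by (auto dest: borel_measurable_integrable)

declare meas [measurable]

text \<open>
  The sign in \<open>Hg\<close> is due to \<open>cas' \<theta> = cas (- \<theta>)\<close>. The weak equation says that \<open>H0\<close> agrees almost
  everywhere with \<open>W\<close>, the primitive of \<open>G\<close>.
\<close>

definition H0 :: "real \<Rightarrow> real ^ 'n \<Rightarrow> real" where "H0 t \<xi> = hartley (\<lambda>x. f0 (t, x)) \<xi>"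
definition H1 :: "real \<Rightarrow> real ^ 'n \<Rightarrow> real" where "H1 t \<xi> = hartley (\<lambda>x. f1 (t, x)) \<xi>"
definition Hg :: "'n \<Rightarrow> real \<Rightarrow> real ^ 'n \<Rightarrow> real" where "Hg i t \<xi> = hartley (\<lambda>x. g i (t, x)) (- \<xi>)"
definition G :: "real \<Rightarrow> real ^ 'n \<Rightarrow> real" where
  "G t \<xi> = (\<Sum>i\<in>UNIV. \<xi> $ i * Hg i t \<xi>) - (\<xi> \<bullet> \<xi>) * H1 t \<xi>"
definition W :: "real \<Rightarrow> real ^ 'n \<Rightarrow> real" where
  "W t \<xi> = (LINT s|lborel. indicator {..<t} s * G s \<xi>)"

lemma H_measurable [measurable (raw)]:
  assumes [measurable]: "a \<in> borel_measurable N" "b \<in> borel_measurable N"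
  shows "(\<lambda>z. H0 (a z) (b z)) \<in> borel_measurable N" "(\<lambda>z. H1 (a z) (b z)) \<in> borel_measurable N"
    "(\<lambda>z. Hg i (a z) (b z)) \<in> borel_measurable N"
  unfolding H0_def H1_def Hg_def by measurable

lemma G_measurable [measurable (raw)]:
  assumes [measurable]: "a \<in> borel_measurable N" "b \<in> borel_measurable N"
  shows "(\<lambda>z. G (a z) (b z)) \<in> borel_measurable N"
proof -
  have [measurable]: "(\<lambda>z. b z $ i) \<in> borel_measurable N" for i
    by (rule measurable_compose[OF assms(2)])
       (intro borel_measurable_continuous_onI linear_continuous_on bounded_linear_vec_nth)
  show ?thesis unfolding G_def by measurable
qed

lemma W_measurable [measurable (raw)]:
  assumes [measurable]: "a \<in> borel_measurable N" "b \<in> borel_measurable N"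
  shows "(\<lambda>z. W (a z) (b z)) \<in> borel_measurable N"
proof -
  have "(\<lambda>(z, s). indicator {..<a z} s * G s (b z)) \<in> borel_measurable (N \<Otimes>\<^sub>M lborel)" by measurable
  then show ?thesis unfolding W_def by (rule lborel.borel_measurable_lebesgue_integral)
qed

lemma H_supp: "t \<notin> {0<..<T} \<Longrightarrow> H0 t \<xi> = 0" "t \<notin> {0<..<T} \<Longrightarrow> H1 t \<xi> = 0"
  "t \<notin> {0<..<T} \<Longrightarrow> Hg i t \<xi> = 0" "t \<notin> {0<..<T} \<Longrightarrow> G t \<xi> = 0"
  by (simp_all add: G_def H0_def H1_def Hg_def hartley_def vanish)

end

text \<open>Fubini with x integrated first. The bound is imposed on the product of \<open>p\<close>
  and \<open>f\<close>, so \<open>p\<close> may be unbounded where \<open>f\<close>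
  vanishes.\<close>

lemma
  fixes f :: "real \<times> (real ^ 'n::finite) \<Rightarrow> real"
  assumes f: "integrable lborel f" and p: "p \<in> borel_measurable borel"
    and bound: "\<And>z. \<bar>p (fst z) * f z\<bar> \<le> c * \<bar>f z\<bar>"
  shows integrable_cas_pair: "integrable lborel (\<lambda>z. p (fst z) * (cas (\<xi> \<bullet> snd z) * f z))"
    and integrable_hartley_slice: "integrable lborel (\<lambda>t. p t * hartley (\<lambda>x. f (t, x)) \<xi>)"
    and integral_hartley_slice: "(LINT z|lborel. p (fst z) * (cas (\<xi> \<bullet> snd z) * f z)) = (LINT t|lborel. p t * hartley (\<lambda>x. f (t, x)) \<xi>)"
proof -
  note [measurable] = p
  have fm[measurable]: "f \<in> borel_measurable (borel \<Otimes>\<^sub>M borel)"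
    using f unfolding borel_prod by (auto dest: borel_measurable_integrable)
  have m: "(\<lambda>z. p (fst z) * (cas (\<xi> \<bullet> snd z) * f z)) \<in> borel_measurable (borel \<Otimes>\<^sub>M borel)" by measurable
  show i: "integrable lborel (\<lambda>z. p (fst z) * (cas (\<xi> \<bullet> snd z) * f z))"
  proof (rule Bochner_Integration.integrable_bound)
    show "integrable lborel (\<lambda>z. 2 * (c * \<bar>f z\<bar>))" using f by simp
    show "AE z in lborel. norm (p (fst z) * (cas (\<xi> \<bullet> snd z) * f z)) \<le> norm (2 * (c * \<bar>f z\<bar>))"
    proof (rule AE_I2)
      fix z
      have "\<bar>cas (\<xi> \<bullet> snd z)\<bar> * \<bar>p (fst z) * f z\<bar> \<le> 2 * (c * \<bar>f z\<bar>)"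
        by (intro mult_mono abs_cas_le bound) auto
      then show "norm (p (fst z) * (cas (\<xi> \<bullet> snd z) * f z)) \<le> norm (2 * (c * \<bar>f z\<bar>))"
        using abs_ge_self[of "2 * (c * \<bar>f z\<bar>)"] by (simp add: abs_mult mult_ac)
    qed
    show "(\<lambda>z. p (fst z) * (cas (\<xi> \<bullet> snd z) * f z)) \<in> borel_measurable lborel"
      using m unfolding borel_prod by simp
  qed
  then have i': "integrable (lborel \<Otimes>\<^sub>M lborel) (\<lambda>z. p (fst z) * (cas (\<xi> \<bullet> snd z) * f z))"
    by (simp add: lborel_prod)
  show "integrable lborel (\<lambda>t. p t * hartley (\<lambda>x. f (t, x)) \<xi>)"
    using lborel_pair.integrable_fst'[OF i'] by (simp add: hartley_def)
  show "(LINT z|lborel. p (fst z) * (cas (\<xi> \<bullet> snd z) * f z)) = (LINT t|lborel. p t * hartley (\<lambda>x. f (t, x)) \<xi>)"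
    using lborel_pair.integral_fst'[OF i'] by (simp add: hartley_def lborel_prod)
qed

context parabolic_pair
begin

lemma H_integrable: "integrable lborel (\<lambda>t. H0 t \<xi>)" "integrable lborel (\<lambda>t. H1 t \<xi>)"
  "integrable lborel (\<lambda>t. Hg i t \<xi>)"
  using integrable_hartley_slice[OF int(1), of "\<lambda>_. 1" 1 \<xi>] integrable_hartley_slice[OF int(2), of "\<lambda>_. 1" 1 \<xi>]
    integrable_hartley_slice[OF int(3)[of i], of "\<lambda>_. 1" 1 "- \<xi>"]
  by (simp_all add: H0_def H1_def Hg_def)

lemma G_integrable: "integrable lborel (\<lambda>t. G t \<xi>)"
  unfolding G_def by (intro Bochner_Integration.integrable_diff Bochner_Integration.integrable_sum integrable_mult_right H_integrable)

text \<open>The weak equation at a single frequency: on the limit test function the time derivative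
  is minus an indicator times the kernel, the Laplacian multiplies by -|\<xi>|^2, and the gradient
  gives \<xi> times the reflected kernel.\<close>

lemma integral_H0_lessThan:
  assumes b: "0 < b" "b < T"
  shows "(LINT t|lborel. indicator {..<b} t * H0 t \<xi>) = (LINT t|lborel. max 0 (b - t) * G t \<xi>)"
proof -
  obtain \<kappa> \<kappa>' \<kappa>'' B where "cutoff \<kappa> \<kappa>' \<kappa>'' B" using cutoff_exists by blast
  then interpret cutoff \<kappa> \<kappa>' \<kappa>'' B .
  let ?m = "\<lambda>t. max 0 (b - t)"
  let ?i = "\<lambda>t. - indicator {..<b} t :: real"
  have mb: "\<bar>?m (fst z) * f z\<bar> \<le> T * \<bar>f z\<bar>" if "fst z \<notin> {0<..<T} \<Longrightarrow> f z = 0" for f :: "real \<times> (real ^ 'n) \<Rightarrow> real" and z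
  proof (cases "fst z \<in> {0<..<T}")
    case True
    then have "\<bar>?m (fst z)\<bar> \<le> T" using b by auto
    then show ?thesis unfolding abs_mult by (intro mult_right_mono) auto
  qed (simp add: that)
  note i0 = integral_hartley_slice[OF int(1), of ?i 1 \<xi>] integrable_cas_pair[OF int(1), of ?i 1 \<xi>]
  have slice: "(LINT z|lborel. ?m (fst z) * (cas (\<zeta> \<bullet> snd z) * f z)) = (LINT t|lborel. ?m t * hartley (\<lambda>x. f (t, x)) \<zeta>)"
      "integrable lborel (\<lambda>z. ?m (fst z) * (cas (\<zeta> \<bullet> snd z) * f z))"
      "integrable lborel (\<lambda>t. ?m t * hartley (\<lambda>x. f (t, x)) \<zeta>)"
    if f: "integrable lborel f" and fz: "\<And>z. fst z \<notin> {0<..<T} \<Longrightarrow> f z = 0" for f :: "real \<times> (real ^ 'n) \<Rightarrow> real" and \<zeta>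
  proof -
    have m: "?m \<in> borel_measurable borel" by measurable
    have bd: "\<bar>?m (fst z) * f z\<bar> \<le> T * \<bar>f z\<bar>" for z by (rule mb[OF fz])
    show "(LINT z|lborel. ?m (fst z) * (cas (\<zeta> \<bullet> snd z) * f z)) = (LINT t|lborel. ?m t * hartley (\<lambda>x. f (t, x)) \<zeta>)"
      by (rule integral_hartley_slice[OF f m bd])
    show "integrable lborel (\<lambda>z. ?m (fst z) * (cas (\<zeta> \<bullet> snd z) * f z))"
      by (rule integrable_cas_pair[OF f m bd])
    show "integrable lborel (\<lambda>t. ?m t * hartley (\<lambda>x. f (t, x)) \<zeta>)"
      by (rule integrable_hartley_slice[OF f m bd])
  qed
  note i1 = slice[OF int(2) vanish(2), of \<xi>]
  have I0: "integrable lborel (\<lambda>z. ?i (fst z) * (cas (\<xi> \<bullet> snd z) * f0 z))"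
    and E0: "(LINT z|lborel. ?i (fst z) * (cas (\<xi> \<bullet> snd z) * f0 z)) = (LINT t|lborel. ?i t * H0 t \<xi>)"
    using i0 by (auto simp: H0_def indicator_def)
  have I1: "integrable lborel (\<lambda>z. ?m (fst z) * (cas (\<xi> \<bullet> snd z) * f1 z))" "integrable lborel (\<lambda>t. ?m t * H1 t \<xi>)"
    and E1: "(LINT z|lborel. ?m (fst z) * (cas (\<xi> \<bullet> snd z) * f1 z)) = (LINT t|lborel. ?m t * H1 t \<xi>)"
    using i1 by (auto simp: H1_def)
  have Ig: "integrable lborel (\<lambda>z. ?m (fst z) * (sac (\<xi> \<bullet> snd z) * g i z))" for i
    unfolding sac_eq_cas inner_minus_left[symmetric] by (rule slice(2)[OF int(3) vanish(3)])
  have Ig': "integrable lborel (\<lambda>t. ?m t * Hg i t \<xi>)" for i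
    unfolding Hg_def by (rule slice(3)[OF int(3) vanish(3)])
  have Eg: "(LINT z|lborel. ?m (fst z) * (sac (\<xi> \<bullet> snd z) * g i z)) = (LINT t|lborel. ?m t * Hg i t \<xi>)" for i
    unfolding Hg_def sac_eq_cas inner_minus_left[symmetric] by (rule slice(1)[OF int(3) vanish(3)])
  have "(LINT z|lborel. - indicator {..<b} (fst z) * cas (\<xi> \<bullet> snd z) * f0 z
    + (\<Sum>i\<in>UNIV. max 0 (b - fst z) * (- ((\<xi> $ i)\<^sup>2 * cas (\<xi> \<bullet> snd z)))) * f1 z
    + (\<Sum>i\<in>UNIV. max 0 (b - fst z) * (\<xi> $ i * sac (\<xi> \<bullet> snd z)) * g i z)) = 0"
    by (rule weak_form_limit[OF int vanish(2,3) weak b])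
  also have "(\<lambda>z. - indicator {..<b} (fst z) * cas (\<xi> \<bullet> snd z) * f0 z
    + (\<Sum>i\<in>UNIV. max 0 (b - fst z) * (- ((\<xi> $ i)\<^sup>2 * cas (\<xi> \<bullet> snd z)))) * f1 z
    + (\<Sum>i\<in>UNIV. max 0 (b - fst z) * (\<xi> $ i * sac (\<xi> \<bullet> snd z)) * g i z)) =
    (\<lambda>z. ?i (fst z) * (cas (\<xi> \<bullet> snd z) * f0 z) - (\<xi> \<bullet> \<xi>) * (?m (fst z) * (cas (\<xi> \<bullet> snd z) * f1 z))
     + (\<Sum>i\<in>UNIV. \<xi> $ i * (?m (fst z) * (sac (\<xi> \<bullet> snd z) * g i z))))"
    by (simp add: inner_vec_def power2_eq_square sum_distrib_left sum_distrib_right sum_negf mult_ac)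
  also have "(LINT z|lborel. ?i (fst z) * (cas (\<xi> \<bullet> snd z) * f0 z) - (\<xi> \<bullet> \<xi>) * (?m (fst z) * (cas (\<xi> \<bullet> snd z) * f1 z))
     + (\<Sum>i\<in>UNIV. \<xi> $ i * (?m (fst z) * (sac (\<xi> \<bullet> snd z) * g i z)))) =
     (LINT t|lborel. ?i t * H0 t \<xi>) - (\<xi> \<bullet> \<xi>) * (LINT t|lborel. ?m t * H1 t \<xi>) + (\<Sum>i\<in>UNIV. \<xi> $ i * (LINT t|lborel. ?m t * Hg i t \<xi>))"
    unfolding E0[symmetric] E1[symmetric] Eg[symmetric]
    by (subst Bochner_Integration.integral_add Bochner_Integration.integral_diff Bochner_Integration.integral_sum
          | intro Bochner_Integration.integrable_diff Bochner_Integration.integrable_sum integrable_mult_right I0 I1 Ig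
          | simp only: integral_mult_right_zero)+
  also have "(LINT t|lborel. ?i t * H0 t \<xi>) = - (LINT t|lborel. indicator {..<b} t * H0 t \<xi>)" by simp
  finally have "(LINT t|lborel. indicator {..<b} t * H0 t \<xi>) =
     (\<Sum>i\<in>UNIV. \<xi> $ i * (LINT t|lborel. ?m t * Hg i t \<xi>)) - (\<xi> \<bullet> \<xi>) * (LINT t|lborel. ?m t * H1 t \<xi>)" by simp
  also have "\<dots> = (LINT t|lborel. (\<Sum>i\<in>UNIV. \<xi> $ i * (?m t * Hg i t \<xi>)) - (\<xi> \<bullet> \<xi>) * (?m t * H1 t \<xi>))"
    by (subst Bochner_Integration.integral_diff Bochner_Integration.integral_sum
          | intro Bochner_Integration.integrable_sum integrable_mult_right I1 Ig'
          | simp only: integral_mult_right_zero)+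
  also have "\<dots> = (LINT t|lborel. max 0 (b - t) * G t \<xi>)"
    unfolding G_def by (intro Bochner_Integration.integral_cong refl) (simp add: algebra_simps sum_distrib_left)
  finally show ?thesis .
qed

text \<open>After exchanging the integrals, the time at which \<open>W\<close> is evaluated ranges
  over (t, b), an interval of length b - t. This is the right-hand side found for
  \<open>H0\<close>.\<close>

lemma integral_W_lessThan:
  assumes b: "0 < b"
  shows "(LINT t|lborel. indicator {..<b} t * W t \<xi>) = (LINT t|lborel. max 0 (b - t) * G t \<xi>)"
proof -
  \<comment> \<open>\<open>G\<close> is 0 for t \<le> 0, so only s in (0, b) contributes. This
    supplies an integrable factor in s, which the indicator of the half-line would not be.\<close>
  have i0: "integrable lborel (\<lambda>s. indicator {0<..<b} s :: real)"
    using b by (intro integrable_real_indicator) auto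
  have Gz: "G t \<xi> = 0" if "t \<le> 0" for t using that by (simp add: H_supp)
  have iP: "integrable (lborel \<Otimes>\<^sub>M lborel) (\<lambda>(s, t). indicator {..<b} s * (indicator {..<s} t * G t \<xi>))"
    by (rule lborel_pair.integrable_pair_bound[OF i0 G_integrable])
      (measurable, use Gz in \<open>auto simp: indicator_def abs_mult not_less\<close>)
  have "(LINT t|lborel. indicator {..<b} t * W t \<xi>) = (LINT s|lborel. LINT t|lborel. indicator {..<b} s * (indicator {..<s} t * G t \<xi>))"
    by (simp add: W_def)
  also have "\<dots> = (LINT t|lborel. LINT s|lborel. indicator {..<b} s * (indicator {..<s} t * G t \<xi>))"
    using lborel_pair.Fubini_integral[OF iP] by simp
  also have "\<dots> = (LINT t|lborel. max 0 (b - t) * G t \<xi>)"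
  proof (rule Bochner_Integration.integral_cong[OF refl])
    fix t
    have "(LINT s|lborel. indicator {..<b} s * (indicator {..<s} t * G t \<xi>)) = (LINT s|lborel. indicator {t<..<b} s * G t \<xi>)"
      by (intro Bochner_Integration.integral_cong refl) (auto simp: indicator_def)
    also have "\<dots> = max 0 (b - t) * G t \<xi>"
      by (cases "t < b") (auto simp: max_def)
    finally show "(LINT s|lborel. indicator {..<b} s * (indicator {..<s} t * G t \<xi>)) = max 0 (b - t) * G t \<xi>" .
  qed
  finally show ?thesis .
qed

lemma abs_W_le: "\<bar>W t \<xi>\<bar> \<le> (LINT s|lborel. \<bar>G s \<xi>\<bar>)"
proof -
  have i: "integrable lborel (\<lambda>s. indicator {..<t} s * G s \<xi>)"
    by (rule Bochner_Integration.integrable_bound[OF G_integrable[of \<xi>]]) (auto simp: indicator_def)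
  have "\<bar>W t \<xi>\<bar> \<le> (LINT s|lborel. \<bar>indicator {..<t} s * G s \<xi>\<bar>)"
    unfolding W_def by (rule integral_abs_bound)
  also have "\<dots> \<le> (LINT s|lborel. \<bar>G s \<xi>\<bar>)"
    by (intro integral_mono integrable_abs i G_integrable) (auto simp: indicator_def)
  finally show ?thesis .
qed

text \<open>Both sides have the same integral over every initial interval ending before T. The
  exceptional set of times may depend on \<xi>.\<close>

lemma AE_H0_eq_W: "AE t in lborel. t \<in> {0<..<T} \<longrightarrow> H0 t \<xi> = W t \<xi>"
proof -
  define q where "q t = indicator {0<..<T} t * (H0 t \<xi> - W t \<xi>)" for t
  have iW: "integrable lborel (\<lambda>t. indicator {0<..<T} t * W t \<xi>)"
  proof (rule Bochner_Integration.integrable_bound)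
    show "integrable lborel (\<lambda>t. indicator {0<..<T} t * (LINT s|lborel. \<bar>G s \<xi>\<bar>))"
      using T by (intro integrable_mult_left integrable_real_indicator) auto
    show "AE t in lborel. norm (indicator {0<..<T} t * W t \<xi>) \<le> norm (indicator {0<..<T} t * (LINT s|lborel. \<bar>G s \<xi>\<bar>))"
      using abs_W_le[of _ \<xi>] by (intro AE_I2) (auto simp: indicator_def intro: order_trans[OF _ abs_ge_self])
  qed measurable
  have iH: "integrable lborel (\<lambda>t. indicator {0<..<T} t * H0 t \<xi>)"
    by (rule Bochner_Integration.integrable_bound[OF H_integrable(1)[of \<xi>]]) (auto simp: indicator_def)
  have q: "integrable lborel q"
    unfolding q_def[abs_def] right_diff_distrib by (intro Bochner_Integration.integrable_diff iW iH)
  have "AE t in lborel. q t = 0"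
  proof (rule AE_zero_if_integral_lessThan_zero[OF q _ T])
    show "q s = 0" if "s \<notin> {0<..<T}" for s using that by (simp add: q_def)
    fix b assume b: "0 < b" "b < T"
    have Wz: "W t \<xi> = 0" if "t \<le> 0" for t
    proof -
      have "indicator {..<t} s * G s \<xi> = 0" for s using that by (auto simp: indicator_def H_supp)
      then show ?thesis unfolding W_def by (simp only: Bochner_Integration.integral_zero)
    qed
    have "(LINT s|lborel. indicator {..<b} s * q s) = (LINT s|lborel. indicator {..<b} s * (indicator {0<..<T} s * H0 s \<xi>) - indicator {..<b} s * (indicator {0<..<T} s * W s \<xi>))"
      by (intro Bochner_Integration.integral_cong refl) (simp add: q_def algebra_simps)
    also have "\<dots> = (LINT s|lborel. indicator {..<b} s * (indicator {0<..<T} s * H0 s \<xi>)) - (LINT s|lborel. indicator {..<b} s * (indicator {0<..<T} s * W s \<xi>))"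
      by (intro Bochner_Integration.integral_diff Bochner_Integration.integrable_bound[OF iH] Bochner_Integration.integrable_bound[OF iW])
         (auto simp: indicator_def)
    also have "(LINT s|lborel. indicator {..<b} s * (indicator {0<..<T} s * H0 s \<xi>)) = (LINT s|lborel. indicator {..<b} s * H0 s \<xi>)"
    proof (rule Bochner_Integration.integral_cong[OF refl])
      fix s
      show "indicator {..<b} s * (indicator {0<..<T} s * H0 s \<xi>) = indicator {..<b} s * H0 s \<xi>"
        by (cases "s \<in> {0<..<T}") (auto simp: H_supp)
    qed
    also have "(LINT s|lborel. indicator {..<b} s * (indicator {0<..<T} s * W s \<xi>)) = (LINT s|lborel. indicator {..<b} s * W s \<xi>)"
    proof (rule Bochner_Integration.integral_cong[OF refl])
      fix s
      show "indicator {..<b} s * (indicator {0<..<T} s * W s \<xi>) = indicator {..<b} s * W s \<xi>"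
        using b Wz[of s] by (cases "s \<le> 0") (auto simp: indicator_def)
    qed
    finally show "(LINT s|lborel. indicator {..<b} s * q s) = 0"
      using integral_H0_lessThan[OF b] integral_W_lessThan[OF b(1)] by simp
  qed
  then show ?thesis by eventually_elim (auto simp: q_def)
qed

end

text \<open>Almost every slice lies in L^1 and L^2, and Parseval on slices followed by Fubini bounds
  the double integral. The parameter \<open>c\<close> is there for the reflection c = -1 in
  \<open>Hg\<close>.\<close>

lemma
  fixes f :: "real \<times> 'a::euclidean_space \<Rightarrow> real"
  assumes f: "integrable lborel f" and f2: "integrable lborel (\<lambda>z. (f z)\<^sup>2)" and c: "\<bar>c\<bar> = 1"
  shows AE_slice_integrable: "AE t in lborel. integrable lborel (\<lambda>x. f (t, x)) \<and> integrable lborel (\<lambda>x. (f (t, x))\<^sup>2)"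
    and integrable_hartley_slice_square:
      "integrable (lborel \<Otimes>\<^sub>M lborel) (\<lambda>(t, \<xi>). (hartley (\<lambda>x. f (t, x)) (c *\<^sub>R \<xi>))\<^sup>2)"
proof -
  have [measurable]: "f \<in> borel_measurable (borel \<Otimes>\<^sub>M borel)"
    using f unfolding borel_prod by (auto dest: borel_measurable_integrable)
  have p: "integrable (lborel \<Otimes>\<^sub>M lborel) f" "integrable (lborel \<Otimes>\<^sub>M lborel) (\<lambda>z. (f z)\<^sup>2)"
    using f f2 by (simp_all add: lborel_prod)
  show ae: "AE t in lborel. integrable lborel (\<lambda>x. f (t, x)) \<and> integrable lborel (\<lambda>x. (f (t, x))\<^sup>2)"
    using lborel_pair.AE_integrable_fst'[OF p(1)] lborel_pair.AE_integrable_fst'[OF p(2)] by eventually_elim simp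
  have h: "integrable lborel (\<lambda>\<xi>. (hartley k (c *\<^sub>R \<xi>))\<^sup>2) \<and>
      (LINT \<xi>|lborel. (hartley k (c *\<^sub>R \<xi>))\<^sup>2) = (2 * pi) ^ DIM('a) * (LINT x|lborel. (k x)\<^sup>2)"
    if "integrable lborel k" "integrable lborel (\<lambda>x. (k x)\<^sup>2)" for k :: "'a \<Rightarrow> real"
  proof -
    have [measurable]: "k \<in> borel_measurable borel" using that by (auto dest: borel_measurable_integrable)
    have m: "(\<lambda>\<xi>. (hartley k \<xi>)\<^sup>2) \<in> borel_measurable borel" by measurable
    have "c \<noteq> 0" using c by auto
    then show ?thesis
      using integral_lborel_affine[OF m, of c 0] integrable_lborel_affine_iff[OF m, of c 0] c
        integral_hartley_square[OF that] integrable_hartley_square[OF that] by simp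
  qed
  show "integrable (lborel \<Otimes>\<^sub>M lborel) (\<lambda>(t, \<xi>). (hartley (\<lambda>x. f (t, x)) (c *\<^sub>R \<xi>))\<^sup>2)"
  proof (rule lborel_pair.Fubini_integrable)
    show "(\<lambda>(t, \<xi>). (hartley (\<lambda>x. f (t, x)) (c *\<^sub>R \<xi>))\<^sup>2) \<in> borel_measurable (lborel \<Otimes>\<^sub>M lborel)"
      by measurable
    show "AE t in lborel. integrable lborel (\<lambda>\<xi>. case (t, \<xi>) of (t, \<xi>) \<Rightarrow> (hartley (\<lambda>x. f (t, x)) (c *\<^sub>R \<xi>))\<^sup>2)"
      using ae by eventually_elim (use h in auto)
    have eq: "AE t in lborel. (2 * pi) ^ DIM('a) * (LINT x|lborel. (f (t, x))\<^sup>2)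
        = (LINT \<xi>|lborel. norm (case (t, \<xi>) of (t, \<xi>) \<Rightarrow> (hartley (\<lambda>x. f (t, x)) (c *\<^sub>R \<xi>))\<^sup>2))"
      using ae by eventually_elim (use h in auto)
    have "integrable lborel (\<lambda>t. (2 * pi) ^ DIM('a) * (LINT x|lborel. (f (t, x))\<^sup>2))"
      using lborel_pair.integrable_fst'[OF p(2)] by simp
    then show "integrable lborel (\<lambda>t. LINT \<xi>|lborel. norm (case (t, \<xi>) of (t, \<xi>) \<Rightarrow> (hartley (\<lambda>x. f (t, x)) (c *\<^sub>R \<xi>))\<^sup>2))"
      by (subst integrable_cong_AE[OF _ _ eq, symmetric]) measurable
  qed
qed

section \<open>The dissipation estimate at a fixed time\<close>

lemma two_mult_le_weighted:
  fixes a b \<delta> :: real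
  assumes "\<delta> > 0" and "b\<^sup>2 \<le> c"
  shows "2 * (a * b) \<le> \<delta> * a\<^sup>2 + c / \<delta>"
proof -
  have "2 * (a * b) \<le> \<delta> * a\<^sup>2 + b\<^sup>2 / \<delta>"
    using abs_mult_le_weighted[OF assms(1), of a b] by (simp add: abs_le_iff)
  also have "\<dots> \<le> \<delta> * a\<^sup>2 + c / \<delta>"
    using assms by (intro add_left_mono divide_right_mono) auto
  finally show ?thesis .
qed

context parabolic_pair
begin

text \<open>The times at which every slice estimate is available, so that only one null set of times
  has to be carried along.\<close>

definition nice :: "real \<Rightarrow> bool" where
  "nice t \<longleftrightarrow> integrable lborel (\<lambda>x. f0 (t, x)) \<and> integrable lborel (\<lambda>x. (f0 (t, x))\<^sup>2) \<and>
    integrable lborel (\<lambda>x. f1 (t, x)) \<and> integrable lborel (\<lambda>x. (f1 (t, x))\<^sup>2) \<and>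
    (\<forall>i. integrable lborel (\<lambda>x. g i (t, x)) \<and> integrable lborel (\<lambda>x. (g i (t, x))\<^sup>2)) \<and>
    (AE x in lborel. (f1 (t, x))\<^sup>2 \<le> M * (f0 (t, x) * f1 (t, x))) \<and>
    (\<forall>i. AE x in lborel. (g i (t, x))\<^sup>2 \<le> C * (f1 (t, x))\<^sup>2)"

lemma AE_nice: "AE t in lborel. nice t"
proof -
  have p: "AE t in lborel. AE x in lborel. P (t, x)" if "AE z in lborel. P z" for P :: "real \<times> (real ^ 'n) \<Rightarrow> bool"
    by (rule lborel_pair.AE_pair) (use that in \<open>simp only: lborel_prod\<close>)
  have "AE t in lborel. \<forall>i. integrable lborel (\<lambda>x. g i (t, x)) \<and> integrable lborel (\<lambda>x. (g i (t, x))\<^sup>2)"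
    unfolding AE_all_countable using AE_slice_integrable[OF int(3) int2(3), of 1] by simp
  moreover have "AE t in lborel. \<forall>i. AE x in lborel. (g i (t, x))\<^sup>2 \<le> C * (f1 (t, x))\<^sup>2"
    unfolding AE_all_countable using p[OF g_le] by simp
  ultimately show ?thesis
    using AE_slice_integrable[OF int(1) int2(1), of 1, OF abs_one] AE_slice_integrable[OF int(2) int2(2), of 1, OF abs_one] p[OF f1_le]
    by eventually_elim (auto simp: nice_def)
qed

definition wt :: "real ^ 'n \<Rightarrow> real" where "wt \<xi> = 1 / (1 + \<xi> \<bullet> \<xi>)"

text \<open>\<open>wt_inner\<close> separates the Laplacian into a leading part without weight and a
  remainder with weight; \<open>wt_component\<close> lets the first-order symbol be absorbed, at the
  cost of one square root of the weight.\<close>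

lemma wt_pos: "wt \<xi> > 0" and wt_le_1: "wt \<xi> \<le> 1"
  and wt_inner: "wt \<xi> * (\<xi> \<bullet> \<xi>) = 1 - wt \<xi>" and wt_component: "(wt \<xi> * \<xi> $ i)\<^sup>2 \<le> wt \<xi>"
proof -
  have p: "1 + \<xi> \<bullet> \<xi> > 0" using inner_ge_zero[of \<xi>] by linarith
  then show 1: "wt \<xi> > 0" and 2: "wt \<xi> \<le> 1" by (auto simp: wt_def)
  show 3: "wt \<xi> * (\<xi> \<bullet> \<xi>) = 1 - wt \<xi>" using p by (simp add: wt_def field_simps)
  have "(\<xi> $ i)\<^sup>2 \<le> \<xi> \<bullet> \<xi>"
    unfolding power2_norm_eq_inner[symmetric] using component_le_norm_cart[of \<xi> i] power_mono[of "\<bar>\<xi> $ i\<bar>" "norm \<xi>" 2] by simp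
  then have "wt \<xi> * (wt \<xi> * (\<xi> $ i)\<^sup>2) \<le> wt \<xi> * (wt \<xi> * (\<xi> \<bullet> \<xi>))"
    using 1 by (intro mult_left_mono) auto
  also have "\<dots> \<le> wt \<xi> * 1" unfolding 3 using 1 by (intro mult_left_mono) auto
  finally show "(wt \<xi> * \<xi> $ i)\<^sup>2 \<le> wt \<xi>" by (simp add: power2_eq_square mult_ac)
qed

lemma wt_measurable [measurable]: "wt \<in> borel_measurable borel"
  unfolding wt_def[abs_def] by measurable

lemma wt_H0_square_le:
  "(wt \<xi> * H0 t \<xi>)\<^sup>2 \<le> wt \<xi> * (H0 t \<xi>)\<^sup>2" "(wt \<xi> * \<xi> $ i * H0 t \<xi>)\<^sup>2 \<le> wt \<xi> * (H0 t \<xi>)\<^sup>2"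
  "wt \<xi> * (H0 t \<xi>)\<^sup>2 \<le> (H0 t \<xi>)\<^sup>2"
proof -
  have "(wt \<xi>)\<^sup>2 \<le> wt \<xi>"
    using wt_pos[of \<xi>] wt_le_1[of \<xi>] by (simp add: power2_eq_square mult_left_le)
  then show "(wt \<xi> * H0 t \<xi>)\<^sup>2 \<le> wt \<xi> * (H0 t \<xi>)\<^sup>2"
    unfolding power_mult_distrib by (intro mult_right_mono) auto
  show "(wt \<xi> * \<xi> $ i * H0 t \<xi>)\<^sup>2 \<le> wt \<xi> * (H0 t \<xi>)\<^sup>2"
    unfolding power_mult_distrib[of "wt \<xi> * \<xi> $ i"] using wt_component by (intro mult_right_mono) auto
  show "wt \<xi> * (H0 t \<xi>)\<^sup>2 \<le> (H0 t \<xi>)\<^sup>2"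
    using wt_pos[of \<xi>] wt_le_1[of \<xi>] by (intro mult_left_le_one_le) auto
qed

text \<open>By \<open>wt_inner\<close> the Laplacian contributes the dissipative product of
  \<open>H0\<close> and \<open>H1\<close> and a lower-order term. In all remaining products one
  factor has its square bounded by wt * H0^2.\<close>

lemma wt_H0_G_eq: "2 * (wt \<xi> * (H0 t \<xi> * G t \<xi>)) =
  - 2 * (H0 t \<xi> * H1 t \<xi>) + 2 * (H1 t \<xi> * (wt \<xi> * H0 t \<xi>)) + (\<Sum>i\<in>UNIV. 2 * (Hg i t \<xi> * (wt \<xi> * \<xi> $ i * H0 t \<xi>)))"
proof -
  have "2 * (wt \<xi> * (H0 t \<xi> * G t \<xi>)) =
    (\<Sum>i\<in>UNIV. 2 * (Hg i t \<xi> * (wt \<xi> * \<xi> $ i * H0 t \<xi>))) - 2 * (H0 t \<xi> * H1 t \<xi>) * (wt \<xi> * (\<xi> \<bullet> \<xi>))"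
    by (simp add: G_def right_diff_distrib sum_distrib_left mult_ac)
  then show ?thesis unfolding wt_inner by (simp add: algebra_simps)
qed

text \<open>Stated for arbitrary measurable \<open>a\<close> and \<open>b\<close>, so that it serves
  a single slice, with constant time, as well as the product space.\<close>

lemma integrable_wt_H0_G:
  fixes N :: "'b measure"
  assumes m[measurable]: "a \<in> borel_measurable N" "b \<in> borel_measurable N"
    and i0: "integrable N (\<lambda>z. (H0 (a z) (b z))\<^sup>2)" and i1: "integrable N (\<lambda>z. (H1 (a z) (b z))\<^sup>2)"
    and ig: "\<And>i. integrable N (\<lambda>z. (Hg i (a z) (b z))\<^sup>2)"
  shows "integrable N (\<lambda>z. wt (b z) * (H0 (a z) (b z))\<^sup>2)"
    "integrable N (\<lambda>z. 2 * (wt (b z) * (H0 (a z) (b z) * G (a z) (b z))))"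
proof -
  have [measurable]: "(\<lambda>z. b z $ i) \<in> borel_measurable N" for i
    by (rule measurable_compose[OF m(2)])
       (intro borel_measurable_continuous_onI linear_continuous_on bounded_linear_vec_nth)
  show iw: "integrable N (\<lambda>z. wt (b z) * (H0 (a z) (b z))\<^sup>2)"
    by (rule Bochner_Integration.integrable_bound[OF i0])
       (use wt_H0_square_le(3) wt_pos in \<open>auto simp: abs_mult less_imp_le intro!: AE_I2\<close>)
  have "integrable N (\<lambda>z. (wt (b z) * H0 (a z) (b z))\<^sup>2)" "\<And>i. integrable N (\<lambda>z. (wt (b z) * b z $ i * H0 (a z) (b z))\<^sup>2)"
    by (rule Bochner_Integration.integrable_bound[OF iw];
        use wt_H0_square_le(1,2) wt_pos in \<open>force simp: abs_mult less_imp_le simp del: power_mult_distrib\<close>)+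
  then show "integrable N (\<lambda>z. 2 * (wt (b z) * (H0 (a z) (b z) * G (a z) (b z))))"
    unfolding wt_H0_G_eq
    by (intro Bochner_Integration.integrable_add Bochner_Integration.integrable_sum integrable_mult_right integrable_mult_L2 i0 i1 ig)
       measurable
qed

text \<open>The sum 1/\<delta> + n/\<eta> for the Young parameters of \<open>energy_slice\<close>:
  one share from the lower-order diffusion term and one from each of the n drift components.\<close>

definition rate :: real where
  "rate = M + real CARD('n) * (M * (real CARD('n) * C + 1))"

lemma rate_pos: "rate > 0"
  unfolding rate_def using M C by (intro add_pos_nonneg) auto

lemma slice_L2:
  assumes "nice t"
  shows "integrable lborel (\<lambda>\<xi>. (H0 t \<xi>)\<^sup>2)" "integrable lborel (\<lambda>\<xi>. (H1 t \<xi>)\<^sup>2)" "integrable lborel (\<lambda>\<xi>. (Hg i t \<xi>)\<^sup>2)"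
    "(LINT \<xi>|lborel. (H0 t \<xi>)\<^sup>2) = (2 * pi) ^ DIM(real ^ 'n) * (LINT x|lborel. (f0 (t, x))\<^sup>2)"
    "(LINT \<xi>|lborel. (H1 t \<xi>)\<^sup>2) = (2 * pi) ^ DIM(real ^ 'n) * (LINT x|lborel. (f1 (t, x))\<^sup>2)"
    "(LINT \<xi>|lborel. (Hg i t \<xi>)\<^sup>2) = (2 * pi) ^ DIM(real ^ 'n) * (LINT x|lborel. (g i (t, x))\<^sup>2)"
    "(LINT \<xi>|lborel. H0 t \<xi> * H1 t \<xi>) = (2 * pi) ^ DIM(real ^ 'n) * (LINT x|lborel. f0 (t, x) * f1 (t, x))"
proof -
  have n: "integrable lborel (\<lambda>x. f0 (t, x))" "integrable lborel (\<lambda>x. (f0 (t, x))\<^sup>2)"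
    "integrable lborel (\<lambda>x. f1 (t, x))" "integrable lborel (\<lambda>x. (f1 (t, x))\<^sup>2)"
    and ng: "integrable lborel (\<lambda>x. g i (t, x))" "integrable lborel (\<lambda>x. (g i (t, x))\<^sup>2)"
    using assms unfolding nice_def by auto
  show "integrable lborel (\<lambda>\<xi>. (H0 t \<xi>)\<^sup>2)" "integrable lborel (\<lambda>\<xi>. (H1 t \<xi>)\<^sup>2)"
    "(LINT \<xi>|lborel. (H0 t \<xi>)\<^sup>2) = (2 * pi) ^ DIM(real ^ 'n) * (LINT x|lborel. (f0 (t, x))\<^sup>2)"
    "(LINT \<xi>|lborel. (H1 t \<xi>)\<^sup>2) = (2 * pi) ^ DIM(real ^ 'n) * (LINT x|lborel. (f1 (t, x))\<^sup>2)"
    "(LINT \<xi>|lborel. H0 t \<xi> * H1 t \<xi>) = (2 * pi) ^ DIM(real ^ 'n) * (LINT x|lborel. f0 (t, x) * f1 (t, x))"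
    unfolding H0_def H1_def
    by (intro integrable_hartley_square integral_hartley_square integral_hartley_mult n)+
  have m: "(\<lambda>\<xi>. (hartley (\<lambda>x. g i (t, x)) \<xi>)\<^sup>2) \<in> borel_measurable borel" by measurable
  show "integrable lborel (\<lambda>\<xi>. (Hg i t \<xi>)\<^sup>2)"
    "(LINT \<xi>|lborel. (Hg i t \<xi>)\<^sup>2) = (2 * pi) ^ DIM(real ^ 'n) * (LINT x|lborel. (g i (t, x))\<^sup>2)"
    unfolding Hg_def
    using integral_lborel_affine[OF m, of "-1" 0] integrable_lborel_affine_iff[OF m, of "-1" 0]
      integral_hartley_square[OF ng] integrable_hartley_square[OF ng] by simp_all
qed

text \<open>By Parseval and \<open>f1_le\<close> the leading term is at most -2/M times the integral
  of f1^2, up to the factor (2 pi)^d. Young's inequality splits each other product into a small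
  multiple of the square of \<open>H1\<close> or \<open>Hg\<close>, which the leading term absorbs,
  and a multiple of the energy density.\<close>

lemma energy_slice:
  assumes t: "nice t"
  shows "(LINT \<xi>|lborel. 2 * (wt \<xi> * (H0 t \<xi> * G t \<xi>))) \<le> rate * (LINT \<xi>|lborel. wt \<xi> * (H0 t \<xi>)\<^sup>2)"
proof -
  note n = slice_L2[OF t]
  let ?K = "(2 * pi) ^ DIM(real ^ 'n) :: real"
  let ?n = "real CARD('n)"
  \<comment> \<open>Each parameter spends one half of the dissipation, that is 1/M times the
    integral of f1^2: \<delta> on \<open>H1\<close> and \<eta> on all \<open>Hg\<close> together.
    The added 1 keeps \<eta> positive when C = 0.\<close>
  define \<delta> where "\<delta> = 1 / M"
  define \<eta> where "\<eta> = 1 / (M * (?n * C + 1))"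
  have nC: "?n * C + 1 > 0" using C by (simp add: add_nonneg_pos)
  have \<delta>: "\<delta> > 0" and \<eta>: "\<eta> > 0" using M nC by (auto simp: \<delta>_def \<eta>_def)
  have K: "?K > 0" by simp
  have i0: "integrable lborel (\<lambda>\<xi>. wt \<xi> * (H0 t \<xi>)\<^sup>2)" and iG: "integrable lborel (\<lambda>\<xi>. 2 * (wt \<xi> * (H0 t \<xi> * G t \<xi>)))"
    by (rule integrable_wt_H0_G; use n in simp)+
  have i01: "integrable lborel (\<lambda>\<xi>. H0 t \<xi> * H1 t \<xi>)"
    by (rule integrable_mult_L2) (use n in auto)
  let ?R = "\<lambda>\<xi>. - 2 * (H0 t \<xi> * H1 t \<xi>) + (\<delta> * (H1 t \<xi>)\<^sup>2 + wt \<xi> * (H0 t \<xi>)\<^sup>2 / \<delta>)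
      + (\<Sum>i\<in>UNIV. \<eta> * (Hg i t \<xi>)\<^sup>2 + wt \<xi> * (H0 t \<xi>)\<^sup>2 / \<eta>)"
  have iR: "integrable lborel ?R"
    by (intro Bochner_Integration.integrable_add Bochner_Integration.integrable_sum integrable_mult_right integrable_divide n i0 i01)
  have pw: "2 * (wt \<xi> * (H0 t \<xi> * G t \<xi>)) \<le> ?R \<xi>" for \<xi>
  proof -
    show ?thesis unfolding wt_H0_G_eq
      by (intro add_mono order_refl sum_mono two_mult_le_weighted \<delta> \<eta> wt_H0_square_le)
  qed
  let ?e = "LINT \<xi>|lborel. wt \<xi> * (H0 t \<xi>)\<^sup>2"
  let ?c = "LINT x|lborel. (f1 (t, x))\<^sup>2"
  have "(LINT \<xi>|lborel. 2 * (wt \<xi> * (H0 t \<xi> * G t \<xi>))) \<le> (LINT \<xi>|lborel. ?R \<xi>)"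
    by (intro integral_mono iG iR pw)
  also have "(LINT \<xi>|lborel. ?R \<xi>) = - 2 * (LINT \<xi>|lborel. H0 t \<xi> * H1 t \<xi>) +
      (\<delta> * (LINT \<xi>|lborel. (H1 t \<xi>)\<^sup>2) + ?e / \<delta>) + (\<Sum>i\<in>UNIV. \<eta> * (LINT \<xi>|lborel. (Hg i t \<xi>)\<^sup>2) + ?e / \<eta>)"
    using n i0 i01 by (simp add: Bochner_Integration.integral_sum)
  also have "\<dots> = ?K * (- 2 * (LINT x|lborel. f0 (t, x) * f1 (t, x)) + \<delta> * ?c + \<eta> * (\<Sum>i\<in>UNIV. LINT x|lborel. (g i (t, x))\<^sup>2)) + (1 / \<delta> + ?n / \<eta>) * ?e"
    unfolding n by (simp add: sum.distrib sum_distrib_left algebra_simps)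
  also have "\<dots> \<le> ?K * 0 + rate * ?e"
  proof (intro add_mono mult_left_mono)
    have nn: "integrable lborel (\<lambda>x. f0 (t, x))" "integrable lborel (\<lambda>x. (f0 (t, x))\<^sup>2)"
      "integrable lborel (\<lambda>x. f1 (t, x))" "integrable lborel (\<lambda>x. (f1 (t, x))\<^sup>2)"
      and ng: "\<And>i. integrable lborel (\<lambda>x. (g i (t, x))\<^sup>2)"
      and ae1: "AE x in lborel. (f1 (t, x))\<^sup>2 \<le> M * (f0 (t, x) * f1 (t, x))"
      and aeg: "\<And>i. AE x in lborel. (g i (t, x))\<^sup>2 \<le> C * (f1 (t, x))\<^sup>2"
      using t unfolding nice_def by auto
    have if01: "integrable lborel (\<lambda>x. f0 (t, x) * f1 (t, x))"
      by (rule integrable_mult_L2) (use nn in \<open>auto dest: borel_measurable_integrable\<close>)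
    have c0: "?c \<ge> 0" by simp
    have "?c \<le> (LINT x|lborel. M * (f0 (t, x) * f1 (t, x)))"
      by (intro integral_mono_AE nn ae1 integrable_mult_right if01)
    then have a: "?c / M \<le> (LINT x|lborel. f0 (t, x) * f1 (t, x))" using M by (simp add: field_simps)
    have "(\<Sum>i\<in>UNIV. LINT x|lborel. (g i (t, x))\<^sup>2) \<le> (\<Sum>i\<in>(UNIV::'n set). C * ?c)"
    proof (rule sum_mono)
      fix i
      have "(LINT x|lborel. (g i (t, x))\<^sup>2) \<le> (LINT x|lborel. C * (f1 (t, x))\<^sup>2)"
        by (intro integral_mono_AE ng nn aeg integrable_mult_right)
      then show "(LINT x|lborel. (g i (t, x))\<^sup>2) \<le> C * ?c" by simp
    qed
    then have "\<eta> * (\<Sum>i\<in>UNIV. LINT x|lborel. (g i (t, x))\<^sup>2) \<le> \<eta> * (?n * C * ?c)"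
      using \<eta> by (intro mult_left_mono) auto
    also have "\<dots> = (?c / M) * (?n * C / (?n * C + 1))" using nC by (simp add: \<eta>_def)
    also have "\<dots> \<le> (?c / M) * 1" using nC M c0 by (intro mult_left_mono) auto
    finally have "\<eta> * (\<Sum>i\<in>UNIV. LINT x|lborel. (g i (t, x))\<^sup>2) \<le> ?c / M" by simp
    moreover have "\<delta> * ?c = ?c / M" by (simp add: \<delta>_def)
    ultimately show "- 2 * (LINT x|lborel. f0 (t, x) * f1 (t, x)) + \<delta> * ?c + \<eta> * (\<Sum>i\<in>UNIV. LINT x|lborel. (g i (t, x))\<^sup>2) \<le> 0"
      using a by linarith
    show "(1 / \<delta> + ?n / \<eta>) * ?e \<le> rate * ?e" by (simp add: rate_def \<delta>_def \<eta>_def)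
  qed (use K in simp)
  finally show ?thesis by simp
qed

end

section \<open>The energy inequality and the vanishing of the difference\<close>

context parabolic_pair
begin

text \<open>Up to a constant, the squared \<open>H\<^sup>-\<^sup>1\<close> norm.\<close>

definition energy :: "real \<Rightarrow> real" where
  "energy t = (LINT \<xi>|lborel. wt \<xi> * (H0 t \<xi>)\<^sup>2)"

lemma pair_integrable:
  "integrable (lborel \<Otimes>\<^sub>M lborel) (\<lambda>z. wt (snd z) * (H0 (fst z) (snd z))\<^sup>2)"
  "integrable (lborel \<Otimes>\<^sub>M lborel) (\<lambda>z. 2 * (wt (snd z) * (H0 (fst z) (snd z) * G (fst z) (snd z))))"
proof -
  have "integrable (lborel \<Otimes>\<^sub>M lborel) (\<lambda>z. (H0 (fst z) (snd z))\<^sup>2)"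
    "integrable (lborel \<Otimes>\<^sub>M lborel) (\<lambda>z. (H1 (fst z) (snd z))\<^sup>2)"
    "integrable (lborel \<Otimes>\<^sub>M lborel) (\<lambda>z. (Hg i (fst z) (snd z))\<^sup>2)" for i
    using integrable_hartley_slice_square[OF int(1) int2(1), of 1] integrable_hartley_slice_square[OF int(2) int2(2), of 1]
      integrable_hartley_slice_square[OF int(3) int2(3), of "-1" i]
    by (simp_all add: H0_def H1_def Hg_def split_beta')
  then show "integrable (lborel \<Otimes>\<^sub>M lborel) (\<lambda>z. wt (snd z) * (H0 (fst z) (snd z))\<^sup>2)"
    "integrable (lborel \<Otimes>\<^sub>M lborel) (\<lambda>z. 2 * (wt (snd z) * (H0 (fst z) (snd z) * G (fst z) (snd z))))"
    by (intro integrable_wt_H0_G; simp)+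
qed

lemma energy_integrable: "integrable lborel energy"
  using lborel_pair.integrable_fst'[OF pair_integrable(1)] by (simp add: energy_def[abs_def])

lemma energy_measurable [measurable]: "energy \<in> borel_measurable borel"
  using borel_measurable_integrable[OF energy_integrable] by simp

lemma energy_nonneg: "energy t \<ge> 0"
  unfolding energy_def using wt_pos by (intro integral_nonneg_AE AE_I2) (simp add: less_imp_le)

lemma energy_supp: "t \<notin> {0<..<T} \<Longrightarrow> energy t = 0"
  by (simp add: energy_def H_supp)

text \<open>Since the set of coincidence is measurable in (t, \<xi>), the null sets of times for
  each frequency turn into null sets of frequencies for almost every time.\<close>

lemma AE_pair_H0_eq_W:
  "AE t in lborel. AE \<xi> in lborel. t \<in> {0<..<T} \<longrightarrow> H0 t \<xi> = W t \<xi>"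
  "AE \<xi> in lborel. AE t in lborel. t \<in> {0<..<T} \<longrightarrow> H0 t \<xi> = W t \<xi>"
proof -
  show 2: "AE \<xi> in lborel. AE t in lborel. t \<in> {0<..<T} \<longrightarrow> H0 t \<xi> = W t \<xi>"
    using AE_H0_eq_W by (rule AE_I2)
  have "{z \<in> space (lborel \<Otimes>\<^sub>M lborel). fst z \<in> {0<..<T} \<longrightarrow> H0 (fst z) (snd z) = W (fst z) (snd z)}
      \<in> sets (lborel \<Otimes>\<^sub>M lborel)"
    by measurable
  from lborel_pair.AE_commute[OF this] 2
  show "AE t in lborel. AE \<xi> in lborel. t \<in> {0<..<T} \<longrightarrow> H0 t \<xi> = W t \<xi>" by simp
qed

text \<open>The square of \<open>W\<close> satisfies an exact chain rule at each frequency; Fubini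
  moves the frequency integral inside, where \<open>energy_slice\<close> applies.\<close>

lemma energy_ineq: "AE t in lborel. energy t \<le> rate * (LINT s|lborel. indicator {..<t} s * energy s)"
  using AE_pair_H0_eq_W(1)
proof eventually_elim
  case (elim t)
  show ?case
  proof (cases "t \<in> {0<..<T}")
    case False
    have "0 \<le> rate * (LINT s|lborel. indicator {..<t} s * energy s)"
      using rate_pos energy_nonneg by (intro mult_nonneg_nonneg integral_nonneg_AE AE_I2) auto
    then show ?thesis using energy_supp[OF False] by simp
  next
    case True
    let ?P = "\<lambda>s \<xi>. 2 * (wt \<xi> * (H0 s \<xi> * G s \<xi>))"
    have iP: "integrable (lborel \<Otimes>\<^sub>M lborel) (\<lambda>(s, \<xi>). indicator {..<t} s * ?P s \<xi>)"
      by (rule Bochner_Integration.integrable_bound[OF pair_integrable(2)]) (auto simp: indicator_def)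
    \<comment> \<open>The chain rule holds for the primitive \<open>W\<close> at every time, not for
      \<open>H0\<close>; this t is one at which both agree for almost every \<xi>.\<close>
    have "energy t = (LINT \<xi>|lborel. wt \<xi> * (W t \<xi>)\<^sup>2)"
      unfolding energy_def using elim True by (intro integral_cong_AE) (auto elim!: eventually_mono)
    also have "\<dots> = (LINT \<xi>|lborel. LINT s|lborel. indicator {..<t} s * ?P s \<xi>)"
    proof (rule integral_cong_AE)
      show "(\<lambda>\<xi>. LINT s|lborel. indicator {..<t} s * ?P s \<xi>) \<in> borel_measurable lborel"
        using borel_measurable_integrable[OF lborel_pair.integrable_snd[OF iP]] by simp
      show "AE \<xi> in lborel. wt \<xi> * (W t \<xi>)\<^sup>2 = (LINT s|lborel. indicator {..<t} s * ?P s \<xi>)"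
        using AE_pair_H0_eq_W(2)
      proof eventually_elim
        case (elim \<xi>)
        have "wt \<xi> * (W t \<xi>)\<^sup>2 = wt \<xi> * (2 * (LINT s|lborel. indicator {..<t} s * (G s \<xi> * W s \<xi>)))"
          using integral_lessThan_square[OF G_integrable, of t \<xi>] by (simp add: W_def)
        also have "\<dots> = (LINT s|lborel. (2 * wt \<xi>) * (indicator {..<t} s * (G s \<xi> * W s \<xi>)))"
          by (subst integral_mult_right_zero) simp
        \<comment> \<open>Inside the time integral \<open>W\<close> becomes \<open>H0\<close> again:
          they agree at almost every s in (0, T), and elsewhere \<open>G\<close> is 0.\<close>
        also have "\<dots> = (LINT s|lborel. indicator {..<t} s * ?P s \<xi>)"
        proof (rule integral_cong_AE)
          show "AE s in lborel. (2 * wt \<xi>) * (indicator {..<t} s * (G s \<xi> * W s \<xi>)) = indicator {..<t} s * ?P s \<xi>"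
            using elim
          proof eventually_elim
            case (elim s)
            then show ?case by (cases "s \<in> {0<..<T}") (auto simp: H_supp)
          qed
        qed measurable
        finally show ?case .
      qed
    qed measurable
    also have "\<dots> = (LINT s|lborel. LINT \<xi>|lborel. indicator {..<t} s * ?P s \<xi>)"
      using lborel_pair.Fubini_integral[OF iP] by simp
    also have "\<dots> \<le> (LINT s|lborel. rate * (indicator {..<t} s * energy s))"
    proof (rule integral_mono_AE)
      show "integrable lborel (\<lambda>s. LINT \<xi>|lborel. indicator {..<t} s * ?P s \<xi>)"
        using lborel_pair.integrable_fst'[OF iP] by simp
      show "integrable lborel (\<lambda>s. rate * (indicator {..<t} s * energy s))"
        by (intro integrable_mult_right Bochner_Integration.integrable_bound[OF energy_integrable])
          (auto simp: indicator_def)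
      show "AE s in lborel. (LINT \<xi>|lborel. indicator {..<t} s * ?P s \<xi>) \<le> rate * (indicator {..<t} s * energy s)"
        using AE_nice
      proof eventually_elim
        case (elim s)
        then show ?case using energy_slice[OF elim] by (auto simp: energy_def indicator_def)
      qed
    qed
    finally show ?thesis by simp
  qed
qed

text \<open>The weight is strictly positive, so zero energy makes the transform of almost every
  slice vanish. Parseval carries this back to \<open>f0\<close> without inverting the
  transform.\<close>

theorem f0_AE_zero: "AE z in lborel. f0 z = 0"
proof -
  have [measurable]: "f0 \<in> borel_measurable borel" using int by (auto dest: borel_measurable_integrable)
  have "AE t in lborel. energy t = 0"
    by (rule gronwall_AE_zero[OF energy_integrable energy_nonneg _ rate_pos energy_ineq]) (auto intro: energy_supp)
  then have "AE t in lborel. (LINT x|lborel. (f0 (t, x))\<^sup>2) = 0"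
    using AE_nice
  proof eventually_elim
    case (elim t)
    note n = slice_L2[OF elim(2)]
    have "integrable lborel (\<lambda>\<xi>. wt \<xi> * (H0 t \<xi>)\<^sup>2)"
      by (rule integrable_wt_H0_G; use n in simp)
    then have "AE \<xi> in lborel. wt \<xi> * (H0 t \<xi>)\<^sup>2 = 0"
      using elim(1) wt_pos unfolding energy_def by (subst (asm) integral_nonneg_eq_0_iff_AE) (auto simp: less_imp_le)
    then have "AE \<xi> in lborel. (H0 t \<xi>)\<^sup>2 = 0"
      by eventually_elim (use wt_pos in \<open>auto simp: less_le\<close>)
    then have "(LINT \<xi>|lborel. (H0 t \<xi>)\<^sup>2) = 0"
      by (subst integral_cong_AE[where g="\<lambda>_. 0"]) auto
    then show ?case using n(4) by simp
  qed
  then have "(LINT t|lborel. LINT x|lborel. (f0 (t, x))\<^sup>2) = (LINT t|(lborel::real measure). 0)"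
    by (intro integral_cong_AE) auto
  then have "(LINT z|lborel. (f0 z)\<^sup>2) = 0"
    using lborel_pair.integral_fst'[of "\<lambda>z. (f0 z)\<^sup>2"] int2(1) by (simp add: lborel_prod)
  then have "AE z in lborel. (f0 z)\<^sup>2 = 0"
    using integral_nonneg_eq_0_iff_AE[OF int2(1)] by simp
  then show ?thesis by simp
qed

end

section \<open>Reduction to Borel representatives\<close>

text \<open>The data are measurable for completed Lebesgue measure, whereas Fubini and the transform
  are used with Borel functions. Agreement is claimed on \<open>S\<close> only.\<close>

lemma lebesgue_on_borel_version:
  fixes f :: "'a::euclidean_space \<Rightarrow> real"
  assumes f: "f \<in> borel_measurable (lebesgue_on S)" and S: "S \<in> sets borel"
  obtains f' where "f' \<in> borel_measurable borel" "AE z in lborel. z \<in> S \<longrightarrow> f z = f' z"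
proof -
  have "(\<lambda>z. indicator S z *\<^sub>R f z) \<in> borel_measurable lebesgue"
    using f S by (subst borel_measurable_restrict_space_iff[symmetric]) auto
  from completion_ex_borel_measurable_real[OF this]
  obtain f' where f': "f' \<in> borel_measurable lborel" "AE z in lborel. indicator S z *\<^sub>R f z = f' z" by auto
  show ?thesis
  proof (rule that)
    show "f' \<in> borel_measurable borel" using f'(1) by simp
    show "AE z in lborel. z \<in> S \<longrightarrow> f z = f' z" using f'(2) by eventually_elim auto
  qed
qed

lemma AE_lebesgue_on_iff:
  assumes "S \<in> sets borel"
  shows "(AE z in lebesgue_on S. P z) \<longleftrightarrow> (AE z in lborel. z \<in> S \<longrightarrow> P z)"
  using assms by (subst AE_restrict_space_iff) (auto simp: AE_completion_iff)

text \<open>Measurability of \<open>h\<close> on \<open>S\<close> is not assumed: it follows from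
  almost everywhere agreement because Lebesgue measure is complete.\<close>

lemma
  fixes h h' :: "'a::euclidean_space \<Rightarrow> real"
  assumes h'[measurable]: "h' \<in> borel_measurable borel" and S[measurable]: "S \<in> sets borel"
    and eq: "AE z in lborel. z \<in> S \<longrightarrow> h z = h' z"
  shows integral_lebesgue_on_borel_version: "(LINT z|lebesgue_on S. h z) = (LINT z|lborel. indicator S z * h' z)"
    and integrable_lebesgue_on_borel_version: "integrable (lebesgue_on S) h \<longleftrightarrow> integrable lborel (\<lambda>z. indicator S z * h' z)"
proof -
  have m: "(\<lambda>z. indicator S z * h' z) \<in> borel_measurable lborel" by measurable
  then have ml: "(\<lambda>z. indicator S z * h' z) \<in> borel_measurable lebesgue" by (rule measurable_completion)
  have ae: "AE z in lebesgue. indicator S z * h' z = indicator S z *\<^sub>R h z"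
    unfolding AE_completion_iff using eq by eventually_elim (auto simp: indicator_def)
  have mh: "(\<lambda>z. indicator S z *\<^sub>R h z) \<in> borel_measurable lebesgue"
    by (rule borel_measurable_AE[OF ml ae])
  have Sl: "S \<inter> space lebesgue \<in> sets lebesgue" using S by auto
  show "(LINT z|lebesgue_on S. h z) = (LINT z|lborel. indicator S z * h' z)"
    unfolding integral_restrict_space[OF Sl] integral_cong_AE[OF ml mh ae, symmetric] by (rule integral_completion[OF m])
  show "integrable (lebesgue_on S) h \<longleftrightarrow> integrable lborel (\<lambda>z. indicator S z * h' z)"
    unfolding integrable_restrict_space[OF Sl] integrable_cong_AE[OF ml mh ae, symmetric] by (rule integrable_completion[OF m])
qed

text \<open>A null set of points x becomes a null cylinder, even though the other factor has
  infinite measure.\<close>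

lemma AE_lborel_snd:
  assumes "AE x in (lborel :: 'b::euclidean_space measure). P x"
  shows "AE z in (lborel :: ('a::euclidean_space \<times> 'b) measure). P (snd z)"
proof -
  obtain N where "{x \<in> space lborel. \<not> P x} \<subseteq> N" "emeasure lborel N = 0" "N \<in> sets (lborel :: 'b measure)"
    by (rule AE_E[OF assms])
  then have N: "N \<in> null_sets (lborel :: 'b measure)" "{x. \<not> P x} \<subseteq> N"
    by (auto simp: null_sets_def)
  have "UNIV \<times> N \<in> null_sets (lborel \<Otimes>\<^sub>M lborel :: ('a \<times> 'b) measure)"
    using N(1) by (auto simp: null_sets_def lborel.emeasure_pair_measure_Times)
  then show ?thesis
    unfolding lborel_prod using N(2) by (intro AE_I'[of "UNIV \<times> N"]) auto
qed

section \<open>Bounds on the coefficients\<close>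

lemma C1_on_UNIV_deriv:
  fixes f :: "real \<Rightarrow> real"
  assumes "f C1_differentiable_on UNIV"
  shows "(f has_real_derivative deriv f s) (at s)" "continuous_on UNIV (deriv f)" "f \<in> borel_measurable borel"
proof -
  obtain D where D: "\<And>s. (f has_real_derivative D s) (at s)" "continuous_on UNIV D"
    using assms unfolding C1_differentiable_on_def has_real_derivative_iff_has_vector_derivative by auto
  have "deriv f = D" using D(1) by (intro ext DERIV_imp_deriv)
  with D show "(f has_real_derivative deriv f s) (at s)" "continuous_on UNIV (deriv f)" by auto
  show "f \<in> borel_measurable borel"
    using D(1) by (intro borel_measurable_continuous_onI continuous_at_imp_continuous_on) (auto intro: DERIV_isCont)
qed

lemma mvt_from_zero:
  fixes k k' :: "real \<Rightarrow> real"
  assumes "\<And>s. (k has_real_derivative k' s) (at s)" "k 0 = 0"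
  shows "\<exists>s. \<bar>s\<bar> \<le> \<bar>r\<bar> \<and> k r = r * k' s"
proof -
  consider "r = 0" | "r > 0" | "r < 0" by linarith
  then show ?thesis
  proof cases
    case 2
    then obtain z where "0 < z" "z < r" "k r - k 0 = (r - 0) * k' z" using MVT2[of 0 r k k'] assms(1) by auto
    then show ?thesis using assms(2) by (intro exI[of _ z]) auto
  next
    case 3
    then obtain z where "r < z" "z < 0" "k 0 - k r = (0 - r) * k' z" using MVT2[of r 0 k k'] assms(1) by auto
    then show ?thesis using assms(2) by (intro exI[of _ z]) auto
  qed (use assms in auto)
qed

text \<open>By the mean value theorem \<beta>(r)/r is a value of \<beta>', which is bounded and
  nonnegative on [-U, U]. For \<open>b\<close>, both \<alpha> \<beta>(r) - b(r) r and \<alpha>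
  \<beta>(r) + b(r) r vanish at 0 and have nonnegative derivative there, so their quotients by r are
  nonnegative.\<close>

lemma diff_quot_bounds:
  assumes beta: "\<beta> C1_differentiable_on UNIV" "\<forall>r. deriv \<beta> r \<ge> 0" "\<beta> 0 = 0"
    and b: "b C1_differentiable_on UNIV"
    and b_beta: "\<forall>K. compact K \<longrightarrow> (\<exists>\<alpha>>0. \<forall>r\<in>K. \<bar>deriv b r * r + b r\<bar> \<le> \<alpha> * \<bar>deriv \<beta> r\<bar>)"
  shows "\<exists>A \<alpha>. A > 0 \<and> \<alpha> > 0 \<and> (\<forall>r. \<bar>r\<bar> \<le> U \<longrightarrow> 0 \<le> diff_quot \<beta> r \<and> diff_quot \<beta> r \<le> A \<and> \<bar>b r\<bar> \<le> \<alpha> * diff_quot \<beta> r)"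
proof -
  note d\<beta> = C1_on_UNIV_deriv[OF beta(1)] and db = C1_on_UNIV_deriv[OF b]
  have "compact (deriv \<beta> ` {-U..U})"
    by (intro compact_continuous_image continuous_on_subset[OF d\<beta>(2)]) auto
  then obtain A where A: "A > 0" "\<And>s. s \<in> {-U..U} \<Longrightarrow> norm (deriv \<beta> s) \<le> A"
    using compact_imp_bounded bounded_pos[of "deriv \<beta> ` {-U..U}"] by auto
  obtain \<alpha> where \<alpha>: "\<alpha> > 0" "\<And>r. r \<in> {-U..U} \<Longrightarrow> \<bar>deriv b r * r + b r\<bar> \<le> \<alpha> * \<bar>deriv \<beta> r\<bar>"
    using b_beta[rule_format, of "{-U..U}"] by auto
  have main: "0 \<le> diff_quot \<beta> r \<and> diff_quot \<beta> r \<le> A \<and> \<bar>b r\<bar> \<le> \<alpha> * diff_quot \<beta> r" if r: "\<bar>r\<bar> \<le> U" for r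
  proof (cases "r = 0")
    case True
    \<comment> \<open>Here the convention \<beta>(0)/0 = \<beta>'(0) enters: at r = 0 the hypothesis
      on \<open>b\<close> reads |b(0)| \<le> \<alpha> |\<beta>'(0)|.\<close>
    then show ?thesis using A(2)[of 0] \<alpha>(2)[of 0] beta(2) r by (auto simp: diff_quot_def)
  next
    case False
    obtain s where s: "\<bar>s\<bar> \<le> \<bar>r\<bar>" "\<beta> r = r * deriv \<beta> s"
      using mvt_from_zero[OF d\<beta>(1) beta(3)] by blast
    have 1: "0 \<le> diff_quot \<beta> r" "diff_quot \<beta> r \<le> A"
      using False s A(2)[of s] beta(2) r by (auto simp: diff_quot_def abs_le_iff)
    \<comment> \<open>The signs \<sigma> = 1 and \<sigma> = -1 together give the bound on the
      absolute value.\<close>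
    have 2: "\<sigma> * b r \<le> \<alpha> * diff_quot \<beta> r" if \<sigma>: "\<bar>\<sigma>\<bar> = 1" for \<sigma>
    proof -
      have "((\<lambda>s. \<alpha> * \<beta> s - \<sigma> * (b s * s)) has_real_derivative \<alpha> * deriv \<beta> s - \<sigma> * (deriv b s * s + b s)) (at s)" for s
        by (auto intro!: derivative_eq_intros d\<beta>(1) db(1))
      from mvt_from_zero[OF this, of r] beta(3)
      obtain s where s: "\<bar>s\<bar> \<le> \<bar>r\<bar>" "\<alpha> * \<beta> r - \<sigma> * (b r * r) = r * (\<alpha> * deriv \<beta> s - \<sigma> * (deriv b s * s + b s))"
        by auto
      have "\<sigma> * (deriv b s * s + b s) \<le> \<bar>\<sigma> * (deriv b s * s + b s)\<bar>" by simp
      also have "\<dots> = \<bar>deriv b s * s + b s\<bar>" using \<sigma> by (simp add: abs_mult)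
      also have "\<dots> \<le> \<alpha> * deriv \<beta> s"
      proof -
        have "s \<in> {-U..U}" using s(1) r by auto
        from \<alpha>(2)[OF this] show ?thesis using beta(2) by simp
      qed
      finally have "0 \<le> \<alpha> * deriv \<beta> s - \<sigma> * (deriv b s * s + b s)" by simp
      also have "\<dots> = (\<alpha> * \<beta> r - \<sigma> * (b r * r)) / r" unfolding s(2) using False by simp
      also have "\<dots> = \<alpha> * diff_quot \<beta> r - \<sigma> * b r" using False by (simp add: diff_quot_def field_simps)
      finally show ?thesis by simp
    qed
    show ?thesis using 1 2[of 1] 2[of "-1"] by (auto simp: abs_le_iff)
  qed
  show ?thesis using A(1) \<alpha>(1) main by blast
qed

theorem corollary4p2:
  fixes \<beta> b :: "real \<Rightarrow> real"
    and D :: "real ^ 'n \<Rightarrow> real ^ 'n"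
    and T :: real
    and u y\<^sub>1 y\<^sub>2 :: "real \<times> (real ^ 'n) \<Rightarrow> real"
    and \<rho>\<^sub>0 :: "(real ^ 'n) measure"
  assumes beta: "\<beta> C1_differentiable_on UNIV" "\<forall>r. deriv \<beta> r \<ge> 0" "\<beta> 0 = 0"
    and D: "D \<in> Linfty lebesgue"
    and b: "b C1_differentiable_on UNIV"
    and b_beta: "\<forall>K. compact K \<longrightarrow>
      (\<exists>\<alpha>>0. \<forall>r\<in>K. \<bar>deriv b r * r + b r\<bar> \<le> \<alpha> * \<bar>deriv \<beta> r\<bar>)"
    and T: "T > 0"
    and u: "u \<in> Linfty (cylinder T)"
    and rho0: "sets \<rho>\<^sub>0 = sets borel" "finite_measure \<rho>\<^sub>0"
    and y1: "y\<^sub>1 \<in> L1 (cylinder T) \<inter> L2 (cylinder T)" "AE z in cylinder T. y\<^sub>1 z \<ge> 0"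
      "weak_solution T \<beta> b D u \<rho>\<^sub>0 y\<^sub>1"
    and y2: "y\<^sub>2 \<in> L1 (cylinder T) \<inter> L2 (cylinder T)" "AE z in cylinder T. y\<^sub>2 z \<ge> 0"
      "weak_solution T \<beta> b D u \<rho>\<^sub>0 y\<^sub>2"
  shows "AE z in cylinder T. y\<^sub>1 z = y\<^sub>2 z"
proof -
  let ?Q = "{0<..<T} \<times> UNIV :: (real \<times> (real ^ 'n)) set"
  have Q[measurable]: "?Q \<in> sets borel" by (intro borel_open open_Times) auto
  have [measurable]: "snd \<in> borel_measurable (borel :: (real \<times> (real ^ 'n)) measure)"
    by (intro borel_measurable_continuous_onI continuous_intros)
  have fstQ: "indicator ?Q z = (0::real)" if "fst z \<notin> {0<..<T}" for z :: "real \<times> (real ^ 'n)"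
    using that by (auto simp: indicator_def)
  obtain u' where [measurable]: "u' \<in> borel_measurable borel" and u': "AE z in lborel. z \<in> ?Q \<longrightarrow> u z = u' z"
    using u lebesgue_on_borel_version[OF _ Q, of u] by (auto simp: Linfty_def)
  obtain U where "AE z in cylinder T. norm (u z) \<le> U" using u by (auto simp: Linfty_def)
  then have U: "AE z in lborel. z \<in> ?Q \<longrightarrow> \<bar>u z\<bar> \<le> U" unfolding AE_lebesgue_on_iff[OF Q] by simp
  obtain A \<alpha> where A: "A > 0" and \<alpha>: "\<alpha> > 0"
    and bounds: "\<And>r. \<bar>r\<bar> \<le> U \<Longrightarrow> 0 \<le> diff_quot \<beta> r \<and> diff_quot \<beta> r \<le> A \<and> \<bar>b r\<bar> \<le> \<alpha> * diff_quot \<beta> r"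
    using diff_quot_bounds[OF beta b b_beta, of U] by blast
  note [measurable] = C1_on_UNIV_deriv(3)[OF beta(1)] C1_on_UNIV_deriv(3)[OF b]
  have [measurable]: "diff_quot \<beta> \<in> borel_measurable borel" unfolding diff_quot_def[abs_def] by measurable
  have "(\<lambda>x. D x $ i) \<in> borel_measurable lebesgue" for i
    using D unfolding Linfty_def
    by (auto intro!: measurable_compose[of D lebesgue borel] borel_measurable_continuous_onI linear_continuous_on bounded_linear_vec_nth)
  then have "\<exists>d. d \<in> borel_measurable borel \<and> (AE x in lborel. D x $ i = d x)" for i
    using completion_ex_borel_measurable_real[of "\<lambda>x. D x $ i" lborel] by auto
  then obtain D' where [measurable]: "\<And>i. D' i \<in> borel_measurable borel" and D': "\<And>i. AE x in lborel. D x $ i = D' i x"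
    by metis
  obtain d where "AE x in lebesgue. norm (D x) \<le> d" using D by (auto simp: Linfty_def)
  then have d: "AE z in (lborel :: (real \<times> (real ^ 'n)) measure). norm (D (snd z)) \<le> d"
    by (intro AE_lborel_snd AE_lborelI)
  have D'z: "AE z in (lborel :: (real \<times> (real ^ 'n)) measure). \<forall>i. D (snd z) $ i = D' i (snd z)"
    unfolding AE_all_countable using AE_lborel_snd[OF D'] by blast
  have coeff: "AE z in lborel. z \<in> ?Q \<longrightarrow> u z = u' z \<and> (\<forall>i. D (snd z) $ i = D' i (snd z)) \<and>
      0 \<le> diff_quot \<beta> (u' z) \<and> diff_quot \<beta> (u' z) \<le> A \<and> (\<forall>i. \<bar>b (u' z) * D' i (snd z)\<bar> \<le> \<alpha> * \<bar>d\<bar> * diff_quot \<beta> (u' z))"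
    using u' U d D'z
  proof eventually_elim
    case (elim z)
    show ?case
    proof
      assume z: "z \<in> ?Q"
      with elim have uz: "u z = u' z" "\<bar>u' z\<bar> \<le> U" by auto
      have "\<bar>b (u' z) * D' i (snd z)\<bar> \<le> \<alpha> * \<bar>d\<bar> * diff_quot \<beta> (u' z)" for i
      proof -
        have "\<bar>D' i (snd z)\<bar> \<le> \<bar>d\<bar>"
          using component_le_norm_cart[of "D (snd z)" i] elim by auto
        then have "\<bar>b (u' z)\<bar> * \<bar>D' i (snd z)\<bar> \<le> (\<alpha> * diff_quot \<beta> (u' z)) * \<bar>d\<bar>"
          using bounds[OF uz(2)] \<alpha> by (intro mult_mono) auto
        then show ?thesis by (simp add: abs_mult mult_ac)
      qed
      with uz bounds[OF uz(2)] elim z show "u z = u' z \<and> (\<forall>i. D (snd z) $ i = D' i (snd z)) \<and>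
        0 \<le> diff_quot \<beta> (u' z) \<and> diff_quot \<beta> (u' z) \<le> A \<and> (\<forall>i. \<bar>b (u' z) * D' i (snd z)\<bar> \<le> \<alpha> * \<bar>d\<bar> * diff_quot \<beta> (u' z))"
        by blast
    qed
  qed
  have version: "\<exists>y'. y' \<in> borel_measurable borel \<and> (AE z in lborel. z \<in> ?Q \<longrightarrow> y z = y' z) \<and>
      integrable lborel (\<lambda>z. indicator ?Q z * y' z) \<and> integrable lborel (\<lambda>z. indicator ?Q z * (y' z)\<^sup>2)"
    if y: "y \<in> L1 (cylinder T) \<inter> L2 (cylinder T)" for y
  proof -
    obtain y' where y': "y' \<in> borel_measurable borel" "AE z in lborel. z \<in> ?Q \<longrightarrow> y z = y' z"
      using y lebesgue_on_borel_version[OF _ Q, of y] by (auto simp: L2_def)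
    have "integrable lborel (\<lambda>z. indicator ?Q z * y' z)"
      using integrable_lebesgue_on_borel_version[OF y'(1) Q y'(2)] y by (simp add: L1_def)
    moreover have "integrable lborel (\<lambda>z. indicator ?Q z * (y' z)\<^sup>2)"
    proof (subst integrable_lebesgue_on_borel_version[of _ _ "\<lambda>z. (y z)\<^sup>2", symmetric, OF _ Q])
      show "AE z in lborel. z \<in> ?Q \<longrightarrow> (y z)\<^sup>2 = (y' z)\<^sup>2" using y'(2) by eventually_elim auto
    qed (use y y' in \<open>auto simp: L2_def\<close>)
    ultimately show ?thesis using y' by blast
  qed
  obtain v1 where v1m[measurable]: "v1 \<in> borel_measurable borel" and v1: "AE z in lborel. z \<in> ?Q \<longrightarrow> y\<^sub>1 z = v1 z"
    "integrable lborel (\<lambda>z. indicator ?Q z * v1 z)" "integrable lborel (\<lambda>z. indicator ?Q z * (v1 z)\<^sup>2)"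
    using version[OF y1(1)] by blast
  obtain v2 where v2m[measurable]: "v2 \<in> borel_measurable borel" and v2: "AE z in lborel. z \<in> ?Q \<longrightarrow> y\<^sub>2 z = v2 z"
    "integrable lborel (\<lambda>z. indicator ?Q z * v2 z)" "integrable lborel (\<lambda>z. indicator ?Q z * (v2 z)\<^sup>2)"
    using version[OF y2(1)] by blast
  \<comment> \<open>With the indicator the coefficient bounds hold almost everywhere on the whole
    space; in \<open>f0\<close> it provides the vanishing outside (0, T).\<close>
  define a where "a z = indicator ?Q z * diff_quot \<beta> (u' z)" for z
  define c where "c i z = indicator ?Q z * (b (u' z) * D' i (snd z))" for i z
  define f0 where "f0 z = indicator ?Q z * (v1 z - v2 z)" for z
  have [measurable]: "a \<in> borel_measurable borel" "c i \<in> borel_measurable borel" "f0 \<in> borel_measurable borel" for i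
    unfolding a_def[abs_def] c_def[abs_def] f0_def[abs_def] by measurable
  have ac: "AE z in lborel. 0 \<le> a z \<and> a z \<le> A \<and> (\<forall>i. \<bar>c i z\<bar> \<le> \<alpha> * \<bar>d\<bar> * a z)"
    using coeff
  proof eventually_elim
    case (elim z)
    then show ?case using A by (cases "z \<in> ?Q") (auto simp: a_def c_def simp del: mem_Times_iff)
  qed
  have f0: "integrable lborel f0"
    using Bochner_Integration.integrable_diff[OF v1(2) v2(2)] by (simp add: f0_def[abs_def] right_diff_distrib)
  have f02: "integrable lborel (\<lambda>z. (f0 z)\<^sup>2)"
  proof (rule Bochner_Integration.integrable_bound)
    show "integrable lborel (\<lambda>z. 2 * (indicator ?Q z * (v1 z)\<^sup>2) + 2 * (indicator ?Q z * (v2 z)\<^sup>2))"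
      by (intro Bochner_Integration.integrable_add integrable_mult_right v1 v2)
    show "AE z in lborel. norm ((f0 z)\<^sup>2) \<le> norm (2 * (indicator ?Q z * (v1 z)\<^sup>2) + 2 * (indicator ?Q z * (v2 z)\<^sup>2))"
    proof (rule AE_I2)
      fix z
      have "0 \<le> (v1 z + v2 z)\<^sup>2" by simp
      then have "(v1 z - v2 z)\<^sup>2 \<le> 2 * (v1 z)\<^sup>2 + 2 * (v2 z)\<^sup>2"
        by (simp add: power2_eq_square algebra_simps)
      then show "norm ((f0 z)\<^sup>2) \<le> norm (2 * (indicator ?Q z * (v1 z)\<^sup>2) + 2 * (indicator ?Q z * (v2 z)\<^sup>2))"
        by (simp add: f0_def indicator_def)
    qed
  qed measurable
  have mult: "integrable lborel (\<lambda>z. h z * f0 z) \<and> integrable lborel (\<lambda>z. (h z * f0 z)\<^sup>2)"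
    if [measurable]: "h \<in> borel_measurable borel" and h: "AE z in lborel. \<bar>h z\<bar> \<le> k" for h k
  proof
    have k: "AE z in lborel. \<bar>h z\<bar> \<le> \<bar>k\<bar>" using h by eventually_elim linarith
    show "integrable lborel (\<lambda>z. h z * f0 z)"
    proof (rule Bochner_Integration.integrable_bound)
      show "integrable lborel (\<lambda>z. \<bar>k\<bar> * f0 z)" by (intro integrable_mult_right f0)
      show "AE z in lborel. norm (h z * f0 z) \<le> norm (\<bar>k\<bar> * f0 z)"
        using k by eventually_elim (simp add: abs_mult mult_right_mono)
    qed measurable
    show "integrable lborel (\<lambda>z. (h z * f0 z)\<^sup>2)"
    proof (rule Bochner_Integration.integrable_bound)
      show "integrable lborel (\<lambda>z. k\<^sup>2 * (f0 z)\<^sup>2)" by (intro integrable_mult_right f02)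
      show "AE z in lborel. norm ((h z * f0 z)\<^sup>2) \<le> norm (k\<^sup>2 * (f0 z)\<^sup>2)"
        using k by eventually_elim (simp add: power_mult_distrib abs_le_square_iff mult_right_mono)
    qed measurable
  qed
  have a_bd: "AE z in lborel. \<bar>a z\<bar> \<le> A" using ac by eventually_elim auto
  have c_bd: "AE z in lborel. \<bar>c i z\<bar> \<le> \<alpha> * \<bar>d\<bar> * A" for i
    using ac
  proof eventually_elim
    case (elim z)
    then have "\<bar>c i z\<bar> \<le> \<alpha> * \<bar>d\<bar> * a z" by blast
    also have "\<dots> \<le> \<alpha> * \<bar>d\<bar> * A" using elim \<alpha> by (intro mult_left_mono) auto
    finally show ?case .
  qed
  \<comment> \<open>From 0 \<le> a \<le> A comes (a y)^2 \<le> A * a y^2, and |c i| \<le> \<alpha>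
    |d| a gives the constant (\<alpha> d)^2. No positive lower bound on \<open>a\<close>
    enters.\<close>
  interpret parabolic_pair f0 "\<lambda>z. a z * f0 z" "\<lambda>i z. c i z * f0 z" T A "(\<alpha> * d)\<^sup>2"
  proof
    show "integrable lborel f0" "integrable lborel (\<lambda>z. (f0 z)\<^sup>2)" by fact+
    show "integrable lborel (\<lambda>z. a z * f0 z)" "integrable lborel (\<lambda>z. (a z * f0 z)\<^sup>2)"
      using mult[OF _ a_bd] by auto
    show "integrable lborel (\<lambda>z. c i z * f0 z)" "integrable lborel (\<lambda>z. (c i z * f0 z)\<^sup>2)" for i
      using mult[OF _ c_bd] by auto
    show "f0 z = 0" "a z * f0 z = 0" "c i z * f0 z = 0" if "fst z \<notin> {0<..<T}" for z i
      using fstQ[OF that] by (simp_all add: f0_def)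
    show "0 < T" "0 < A" "0 \<le> (\<alpha> * d)\<^sup>2" using T A by simp_all
    show "AE z in lborel. (a z * f0 z)\<^sup>2 \<le> A * (f0 z * (a z * f0 z))"
      using ac
    proof eventually_elim
      case (elim z)
      then have "a z * (a z * (f0 z)\<^sup>2) \<le> A * (a z * (f0 z)\<^sup>2)" by (intro mult_right_mono) auto
      then show ?case by (simp add: power2_eq_square mult_ac)
    qed
    show "AE z in lborel. (c i z * f0 z)\<^sup>2 \<le> (\<alpha> * d)\<^sup>2 * (a z * f0 z)\<^sup>2" for i
      using ac
    proof eventually_elim
      case (elim z)
      then have "\<bar>c i z\<bar> \<le> \<bar>\<alpha> * d * a z\<bar>" using \<alpha> by (simp add: abs_mult)
      then have "(c i z)\<^sup>2 \<le> (\<alpha> * d * a z)\<^sup>2" by (simp only: abs_le_square_iff)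
      then have "(c i z)\<^sup>2 * (f0 z)\<^sup>2 \<le> (\<alpha> * d * a z)\<^sup>2 * (f0 z)\<^sup>2" by (intro mult_right_mono) auto
      then show ?case by (simp add: power_mult_distrib mult_ac)
    qed
    fix \<phi> :: "real \<times> (real ^ 'n) \<Rightarrow> real"
    assume \<phi>: "\<phi> \<in> test_functions T" and tame: "tame T \<phi>"
    have [measurable]: "time_deriv \<phi> \<in> borel_measurable borel" "space_laplacian \<phi> \<in> borel_measurable borel"
      "space_deriv i \<phi> \<in> borel_measurable borel" for i
      using tame by (auto simp: tame_def)
    obtain k where k: "\<And>z. fst z \<in> {0<..<T} \<Longrightarrow> \<bar>time_deriv \<phi> z\<bar> \<le> k \<and> \<bar>space_laplacian \<phi> z\<bar> \<le> k \<and> (\<forall>i. \<bar>space_deriv i \<phi> z\<bar> \<le> k)"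
      using tame unfolding tame_def by blast
    \<comment> \<open>The operator applied to \<phi>, the same for both solutions. It is bounded on
      the cylinder because \<phi> is \<open>tame\<close>, so its product with each solution is
      integrable on its own.\<close>
    define E where "E z = time_deriv \<phi> z + diff_quot \<beta> (u' z) * space_laplacian \<phi> z
      + (\<Sum>i\<in>UNIV. b (u' z) * D' i (snd z) * space_deriv i \<phi> z)" for z
    have E_meas[measurable]: "E \<in> borel_measurable borel" unfolding E_def[abs_def] by measurable
    have E_bd: "AE z in lborel. z \<in> ?Q \<longrightarrow> \<bar>E z\<bar> \<le> k + A * k + (\<Sum>i\<in>(UNIV::'n set). \<alpha> * \<bar>d\<bar> * A * k)"
      using coeff
    proof eventually_elim
      case (elim z)
      show ?case
      proof
        assume z: "z \<in> ?Q"
        then have kz: "\<bar>time_deriv \<phi> z\<bar> \<le> k" "\<bar>space_laplacian \<phi> z\<bar> \<le> k" "\<bar>space_deriv i \<phi> z\<bar> \<le> k" for i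
          using k[of z] by auto
        have e: "0 \<le> diff_quot \<beta> (u' z)" "diff_quot \<beta> (u' z) \<le> A"
          "\<bar>b (u' z) * D' i (snd z)\<bar> \<le> \<alpha> * \<bar>d\<bar> * diff_quot \<beta> (u' z)" for i
          using elim z by blast+
        have "\<alpha> * \<bar>d\<bar> * diff_quot \<beta> (u' z) \<le> \<alpha> * \<bar>d\<bar> * A" using e \<alpha> by (intro mult_left_mono) auto
        then have e3: "\<bar>b (u' z) * D' i (snd z)\<bar> \<le> \<alpha> * \<bar>d\<bar> * A" for i using e(3)[of i] by linarith
        have "\<bar>diff_quot \<beta> (u' z) * space_laplacian \<phi> z\<bar> \<le> A * k"
          unfolding abs_mult using e kz A by (intro mult_mono) auto
        moreover have "\<bar>\<Sum>i\<in>UNIV. b (u' z) * D' i (snd z) * space_deriv i \<phi> z\<bar> \<le> (\<Sum>i\<in>(UNIV::'n set). \<alpha> * \<bar>d\<bar> * A * k)"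
        proof (intro order_trans[OF sum_abs] sum_mono)
          fix i
          show "\<bar>b (u' z) * D' i (snd z) * space_deriv i \<phi> z\<bar> \<le> \<alpha> * \<bar>d\<bar> * A * k"
            unfolding abs_mult[of "_ * _" "space_deriv i \<phi> z"] using e3 kz A \<alpha> by (intro mult_mono) auto
        qed
        ultimately show "\<bar>E z\<bar> \<le> k + A * k + (\<Sum>i\<in>(UNIV::'n set). \<alpha> * \<bar>d\<bar> * A * k)"
          unfolding E_def using kz(1) by linarith
      qed
    qed
    have Ei: "integrable lborel (\<lambda>z. indicator ?Q z * (E z * v z))"
      if [measurable]: "v \<in> borel_measurable borel" and v: "integrable lborel (\<lambda>z. indicator ?Q z * v z)" for v
    proof (rule Bochner_Integration.integrable_bound)
      let ?k = "k + A * k + (\<Sum>i\<in>(UNIV::'n set). \<alpha> * \<bar>d\<bar> * A * k)"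
      show "integrable lborel (\<lambda>z. \<bar>?k\<bar> * (indicator ?Q z * v z))" by (intro integrable_mult_right v)
      show "AE z in lborel. norm (indicator ?Q z * (E z * v z)) \<le> norm (\<bar>?k\<bar> * (indicator ?Q z * v z))"
        using E_bd
      proof eventually_elim
        case (elim z)
        show ?case
        proof (cases "z \<in> ?Q")
          case True
          with elim have "\<bar>E z\<bar> \<le> \<bar>?k\<bar>" by linarith
          then have "\<bar>E z\<bar> * \<bar>v z\<bar> \<le> \<bar>?k\<bar> * \<bar>v z\<bar>" by (rule mult_right_mono) simp
          then show ?thesis using True by (simp add: abs_mult)
        qed simp
      qed
    qed measurable
    \<comment> \<open>The value depends on \<phi> and the initial measure but not on the solution,
      so subtraction removes the initial data.\<close>
    have Eeq: "(LINT z|lborel. indicator ?Q z * (E z * v z)) = - (LINT x|\<rho>\<^sub>0. \<phi> (0, x))"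
      if [measurable]: "v \<in> borel_measurable borel" and v: "AE z in lborel. z \<in> ?Q \<longrightarrow> y z = v z"
        and y: "weak_solution T \<beta> b D u \<rho>\<^sub>0 y" for v y
    proof -
      have "AE z in lborel. z \<in> ?Q \<longrightarrow> (time_deriv \<phi> z + diff_quot \<beta> (u z) * space_laplacian \<phi> z
            + b (u z) * (D (snd z) \<bullet> space_grad \<phi> z)) * y z = E z * v z"
        using v coeff
      proof eventually_elim
        case (elim z)
        show ?case
        proof
          assume "z \<in> ?Q"
          with elim have e: "y z = v z" "u z = u' z" "\<And>i. D (snd z) $ i = D' i (snd z)" by blast+
          have "b (u z) * (D (snd z) \<bullet> space_grad \<phi> z) = (\<Sum>i\<in>UNIV. b (u' z) * D' i (snd z) * space_deriv i \<phi> z)"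
            by (simp add: e inner_vec_def space_grad_def sum_distrib_left mult_ac)
          then show "(time_deriv \<phi> z + diff_quot \<beta> (u z) * space_laplacian \<phi> z
            + b (u z) * (D (snd z) \<bullet> space_grad \<phi> z)) * y z = E z * v z"
            by (simp add: E_def e)
        qed
      qed
      from integral_lebesgue_on_borel_version[OF _ Q this]
      show ?thesis using y \<phi> unfolding weak_solution_def by fastforce
    qed
    have "(LINT z|lborel. time_deriv \<phi> z * f0 z + space_laplacian \<phi> z * (a z * f0 z) + (\<Sum>i\<in>UNIV. space_deriv i \<phi> z * (c i z * f0 z)))
      = (LINT z|lborel. indicator ?Q z * (E z * v1 z) - indicator ?Q z * (E z * v2 z))"
    proof (rule Bochner_Integration.integral_cong[OF refl])
      fix z
      show "time_deriv \<phi> z * f0 z + space_laplacian \<phi> z * (a z * f0 z) + (\<Sum>i\<in>UNIV. space_deriv i \<phi> z * (c i z * f0 z))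
        = indicator ?Q z * (E z * v1 z) - indicator ?Q z * (E z * v2 z)"
      proof (cases "z \<in> ?Q")
        case True
        have "(\<Sum>i\<in>UNIV. space_deriv i \<phi> z * (c i z * f0 z)) = (\<Sum>i\<in>UNIV. b (u' z) * D' i (snd z) * space_deriv i \<phi> z) * (v1 z - v2 z)"
          unfolding sum_distrib_right using True by (intro sum.cong) (simp_all add: c_def f0_def)
        then show ?thesis using True by (simp add: E_def a_def f0_def algebra_simps)
      qed (simp add: f0_def)
    qed
    also have "\<dots> = 0"
      by (subst Bochner_Integration.integral_diff) (auto intro!: Ei v1 v2 simp: Eeq[OF _ v1(1) y1(3)] Eeq[OF _ v2(1) y2(3)])
    finally show "(LINT z|lborel. time_deriv \<phi> z * f0 z + space_laplacian \<phi> z * (a z * f0 z) + (\<Sum>i\<in>UNIV. space_deriv i \<phi> z * (c i z * f0 z))) = 0" .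
  qed
  show ?thesis
    unfolding AE_lebesgue_on_iff[OF Q] using f0_AE_zero v1(1) v2(1)
    by eventually_elim (auto simp: f0_def)
qed

end
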